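(* Let $(\mathcal{C},S)$, $(\mathcal{D},T)$, $(\mathcal{P},E)$ be monads and let $J\dashv_{\mathcal{P}}K$ be a parametric adjunction, with $J:\mathcal{C}\times\mathcal{P}\to\mathcal{D}$ and $K:\mathcal{P}^{op}\times\mathcal{D}\to\mathcal{C}$. There is a bijection between the following structures. (i) Parametric adjoint liftings $\widehat{J}\dashv_{\mathcal{P}^{E}}\widehat{K}$ of $J\dashv_{\mathcal P}K$, with $\widehat{J}:\mathcal{C}^{S}\times\mathcal{P}^{E}\to\mathcal{D}^{T}$ and $\widehat{K}:(\mathcal{P}^{E})^{op}\times\mathcal{D}^{T}\to\mathcal{C}^{S}$, such that $$U^{T}\widehat{J}=J(U^{S}\times U^{E}),\qquad U^{S}\widehat{K}=K\big((U^{E})^{op}\times U^{T}\big),$$ and such that $(J,\widehat{J},\lambda^{J\widehat{J}}): F^{S}\times F^{E}\dashv U^{S}\times U^{E}\to F^{T}\dashv U^{T}$ is a left Hopf 1-cell in $\mathbf{Adj}_{R}(\mathbf{Cat})$. (ii) Hopf parametric adjunctions in $\mathbf{Mnd}(\mathbf{Cat})$ of the form $$\big(J(\mathcal{C}\times U^{E}),\,H(\psi^{J})\big)\dashv_{\mathcal{P}^{E}}\big(K((U^{E})^{op}\times\mathcal{D}),\,\psi^{KU^{E}}\big),$$ where $(J,\psi^{J}):(\mathcal{C}\times\mathcal{P},S\times E)\to(\mathcal{D},T)$ is a left Hopf 1-cell in $\mathbf{Mnd}(\mathbf{Cat})$ and $\psi^{KU^{E}}=\mathrm{ad}(H(\p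si^{J}))$.
   Context: All categories are small. A category name also denotes its identity functor, juxtaposition denotes composition of functors and whiskering, and $L\dashv R:\mathcal{C}\to\mathcal{X}$ means $L:\mathcal{C}\to\mathcal{X}$ is left adjoint to $R$. For a monad $(\mathcal{C},S,\mu^S,\eta^S)$, $\mathcal{C}^{S}$ is the Eilenberg–Moore category, with free-forgetful adjunction $F^{S}\dashv U^{S}:\mathcal{C}\to\mathcal{C}^{S}$ and counit $\varepsilon$; objects are $(M,k_M)$. $(\mathcal{C}\times\mathcal{P})^{S\times E}$ is identified with $\mathcal{C}^S\times\mathcal{P}^E$. Parametric adjunction $J\dashv_{\mathcal{P}}K$: functors $J:\mathcal{C}\times\mathcal{P}\to\mathcal{D}$, $K:\mathcal{P}^{op}\times\mathcal{D}\to\mathcal{C}$ with, for each $P$, an adjunction $J_P=J(-,P)\dashv K_P=K(P,-)$ with unit $\eta^P$ and counit $\varepsilon^P$, such that for $p:P\to P'$ the transformations $J_p:J_P\to J_{P'}$ and $K_{p^{op}}:K_{P'}\to K_P$ are conjugate: $K_{p^{op}}=K_P\varepsilon^{P'}\circ K_PJ_pK_{P'}\circ\eta^PK_{P'}$. It induces the parametric adjunction $J(\mathcal{C}\times U^E)\dashv_{\mathcal{P}^E}K((U^E)^{op}\times\mathcal{D})$, with adjunction $J_M\dashv K_M$ at $(M,k_M)$. $\mathbf{Adj}_R(\mathbf{Cat})$: 0-cells are adjunctions; a 1-cell $(J,V,\lambda):(L\dashv R:\mathcal{C}\to\mathcal{X})\to(\overline{L}\dashv\overline{R}:\mathcal{D}\to\mathcal{Y})$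 consists of functors $J:\mathcal{C}\to\mathcal{D}$, $V:\mathcal{X}\to\mathcal{Y}$ and $\lambda:\overline{L}J\to VL$ whose mate $\rho=\overline{R}V\varepsilon^{LR}\circ\overline{R}\lambda R\circ\eta^{\overline{R}\,\overline{L}}JR:JR\to\overline{R}V$ is invertible; a 2-cell $(J,V,\lambda)\to(J',V',\lambda')$ is a pair $(\alpha:J\to J',\beta:V\to V')$ with $\beta L\circ\lambda=\lambda'\circ\overline{L}\alpha$. For (i), $\lambda^{J\widehat{J}}:F^TJ\to\widehat{J}(F^S\times F^E)$ is the transformation whose mate is the identity $J(U^S\times U^E)=U^T\widehat{J}$. This 1-cell is left Hopf if $H(\lambda^{J\widehat{J}})=\widehat{J}(F^S\times\varepsilon^{E})\circ\lambda^{J\widehat{J}}(\mathcal{C}\times U^E):F^TJ(\mathcal{C}\times U^E)\to\widehat{J}(F^S\times\mathcal{P}^E)$ is invertible, where $\varepsilon^{E}$ is the counit of $F^E\dashv U^E$. "Lifting" of the parametric adjunction in (i): for each $(M,k_M)$ in $\mathcal{P}^E$ the unit and counit of $\widehat{J}_{(M,k_M)}\dashv\widehat{K}_{(M,k_M)}$ lie over those of $J_M\dashv K_M$ along the forgetful functors (so that the pairs of units and of counits are 2-cells of $\mathbf{Adj}_R(\mathbf{Cat})$). $\mathbf{Mnd}(\mathbf{Cat})$: 0-cells are monads; a 1-cell $(B,\psi):(\mathcal{C},S)\to(\mathcal{D},T)$ is a functor $B:\mathcal{C}\to\mathcal{D}$ with $\psi:TB\to BS$ satisfying $\psi\circ\mu^TB=B\mu^S\circ\psi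 S\circ T\psi$ and $\psi\circ\eta^TB=B\eta^S$; a 2-cell $(A,\psi^A)\to(B,\psi^B)$ is $\theta:A\to B$ with $\psi^B\circ T\theta=\theta S\circ\psi^A$; composites are $(K,\psi^K)(J,\psi^J)=(KJ,K\psi^J\circ\psi^KJ)$. An adjoint object $(J,\psi^J)\dashv(K,\psi^K)$ is an adjunction $J\dashv K$ whose unit and counit are 2-cells. For a 1-cell $(J,\psi^J):(\mathcal{C}\times\mathcal{P},S\times E)\to(\mathcal{D},T)$, $H(\psi^J):TJ(\mathcal{C}\times U^E)\to J(S\times U^E)$ has component $J(SC,k_M)\circ\psi^J_{(C,M)}$ at $(C,(M,k_M))$; the 1-cell is left Hopf if $H(\psi^J)$ is invertible. Then for each $(M,k_M)$ put $\psi^{JM}=H(\psi^J)_{(-,(M,k_M))}:TJ_M\to J_MS$ and $\psi^{KM}=\mathrm{ad}(\psi^{JM}):=K_MT\varepsilon\circ K_M(\psi^{JM})^{-1}K_M\circ\eta SK_M:SK_M\to K_MT$ (with $\eta,\varepsilon$ the unit and counit of $J_M\dashv K_M$); $\mathrm{ad}(H(\psi^J))=\psi^{KU^E}:SK((U^E)^{op}\times\mathcal{D})\to K((U^E)^{op}\times T)$ is the transformation with components $\psi^{KU^E}((M,k_M),D)=\psi^{KM}_D$. A Hopf parametric adjunction (Hopf parametric adjoint object) in $\mathbf{Mnd}(\mathbf{Cat})$ of the form in (ii) consists of the 1-cells $(J(\mathcal{C}\times U^E),H(\psi^J)):(\mathcal{C}\times\mathcal{P}^E,S\times\mathcal{P}^E)\to(\mathcal{D},T)$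 and $(K((U^E)^{op}\times\mathcal{D}),\psi^{KU^E}):((\mathcal{P}^E)^{op}\times\mathcal{D},(\mathcal{P}^E)^{op}\times T)\to(\mathcal{C},S)$ together with, for each $(M,k_M)$, the adjoint object $(J_M,\psi^{JM})\dashv(K_M,\psi^{KM})$. *)

theory Defs
  imports "HOL-Library.FuncSet"
begin

section \<open>Small categories, functors, natural transformations\<close>

record ('o, 'a) category =
  Obj :: "'o set"
  Arr :: "'a set"
  Dom :: "'a \<Rightarrow> 'o"
  Cod :: "'a \<Rightarrow> 'o"
  Ident :: "'o \<Rightarrow> 'a"
  Comp :: "'a \<Rightarrow> 'a \<Rightarrow> 'a"  (infixl \<open>\<cdot>\<index>\<close> 70)

definition hom :: "('o, 'a) category \<Rightarrow> 'o \<Rightarrow> 'o \<Rightarrow> 'a set" where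
  "hom C X Y = {f \<in> Arr C. Dom C f = X \<and> Cod C f = Y}"

text \<open>\<open>g \<cdot>\<^bsub>C\<^esub> f\<close> is first \<open>f\<close>, then \<open>g\<close>.\<close>

locale category =
  fixes C :: "('o, 'a) category"
  assumes Dom_Obj: "f \<in> Arr C \<Longrightarrow> Dom C f \<in> Obj C"
    and Cod_Obj: "f \<in> Arr C \<Longrightarrow> Cod C f \<in> Obj C"
    and Id_hom: "X \<in> Obj C \<Longrightarrow> Ident C X \<in> hom C X X"
    and Comp_hom: "f \<in> hom C X Y \<Longrightarrow> g \<in> hom C Y Z \<Longrightarrow> g \<cdot>\<^bsub>C\<^esub> f \<in> hom C X Z"
    and Comp_assoc: "f \<in> hom C X Y \<Longrightarrow> g \<in> hom C Y Z \<Longrightarrow> h \<in> hom C Z W \<Longrightarrow>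
      (h \<cdot>\<^bsub>C\<^esub> g) \<cdot>\<^bsub>C\<^esub> f = h \<cdot>\<^bsub>C\<^esub> (g \<cdot>\<^bsub>C\<^esub> f)"
    and Id_left: "f \<in> hom C X Y \<Longrightarrow> Ident C Y \<cdot>\<^bsub>C\<^esub> f = f"
    and Id_right: "f \<in> hom C X Y \<Longrightarrow> f \<cdot>\<^bsub>C\<^esub> Ident C X = f"

definition op_cat :: "('o, 'a) category \<Rightarrow> ('o, 'a) category" where
  "op_cat C = \<lparr>Obj = Obj C, Arr = Arr C, Dom = Cod C, Cod = Dom C, Ident = Ident C,
     Comp = (\<lambda>g f. f \<cdot>\<^bsub>C\<^esub> g)\<rparr>"

definition prod_cat ::
  "('o, 'a) category \<Rightarrow> ('p, 'b) category \<Rightarrow> ('o \<times> 'p, 'a \<times> 'b) category" where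
  "prod_cat C D = \<lparr>Obj = Obj C \<times> Obj D, Arr = Arr C \<times> Arr D,
     Dom = map_prod (Dom C) (Dom D), Cod = map_prod (Cod C) (Cod D),
     Ident = map_prod (Ident C) (Ident D),
     Comp = (\<lambda>(g, g') (f, f'). (g \<cdot>\<^bsub>C\<^esub> f, g' \<cdot>\<^bsub>D\<^esub> f'))\<rparr>"

text \<open>Functors and transformations are required to be \<^emph>\<open>extensional\<close> (\<open>undefined\<close> off their
  source), so that HOL equality is equality of functors and of transformations. A functor does
  not record its source and target, and \<open>F\<close> and its opposite are the same value.\<close>

record ('o, 'a, 'p, 'b) cfun =
  FO :: "'o \<Rightarrow> 'p"
  FA :: "'a \<Rightarrow> 'b"

locale cfunctor = A: category A + B: category B
  for A :: "('o, 'a) category" and B :: "('p, 'b) category" +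
  fixes F :: "('o, 'a, 'p, 'b) cfun"
  assumes FO_ext: "FO F \<in> extensional (Obj A)"
    and FA_ext: "FA F \<in> extensional (Arr A)"
    and FO_Obj: "X \<in> Obj A \<Longrightarrow> FO F X \<in> Obj B"
    and FA_hom: "f \<in> hom A X Y \<Longrightarrow> FA F f \<in> hom B (FO F X) (FO F Y)"
    and FA_Id: "X \<in> Obj A \<Longrightarrow> FA F (Ident A X) = Ident B (FO F X)"
    and FA_Comp: "f \<in> hom A X Y \<Longrightarrow> g \<in> hom A Y Z \<Longrightarrow>
      FA F (g \<cdot>\<^bsub>A\<^esub> f) = FA F g \<cdot>\<^bsub>B\<^esub> FA F f"

definition id_fun :: "('o, 'a) category \<Rightarrow> ('o, 'a, 'o, 'a) cfun" where
  "id_fun A = \<lparr>FO = (\<lambda>X\<in>Obj A. X), FA = (\<lambda>f\<in>Arr A. f)\<rparr>"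

text \<open>\<open>comp_fun A G F\<close> is the composite \<open>G F\<close>, where \<open>A\<close> is the source of \<open>F\<close>.\<close>

definition comp_fun :: "('o, 'a) category \<Rightarrow> ('p, 'b, 'q, 'c) cfun \<Rightarrow> ('o, 'a, 'p, 'b) cfun
    \<Rightarrow> ('o, 'a, 'q, 'c) cfun" where
  "comp_fun A G F = \<lparr>FO = compose (Obj A) (FO G) (FO F), FA = compose (Arr A) (FA G) (FA F)\<rparr>"

text \<open>\<open>prod_fun A B F G\<close> is \<open>F \<times> G\<close>, where \<open>A\<close> and \<open>B\<close> are the sources of \<open>F\<close> and \<open>G\<close>.\<close>

definition prod_fun :: "('o, 'a) category \<Rightarrow> ('p, 'b) category \<Rightarrow> ('o, 'a, 'q, 'c) cfun
    \<Rightarrow> ('p, 'b, 'r, 'd) cfun \<Rightarrow> ('o \<times> 'p, 'a \<times> 'b, 'q \<times> 'r, 'c \<times> 'd) cfun" where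
  "prod_fun A B F G = \<lparr>FO = restrict (map_prod (FO F) (FO G)) (Obj A \<times> Obj B),
     FA = restrict (map_prod (FA F) (FA G)) (Arr A \<times> Arr B)\<rparr>"

locale nat_trans = F: cfunctor A B F + G: cfunctor A B G
  for A :: "('o, 'a) category" and B :: "('p, 'b) category"
    and F :: "('o, 'a, 'p, 'b) cfun" and G :: "('o, 'a, 'p, 'b) cfun" +
  fixes \<tau> :: "'o \<Rightarrow> 'b"
  assumes ext: "\<tau> \<in> extensional (Obj A)"
    and component: "X \<in> Obj A \<Longrightarrow> \<tau> X \<in> hom B (FO F X) (FO G X)"
    and naturality: "f \<in> hom A X Y \<Longrightarrow> \<tau> Y \<cdot>\<^bsub>B\<^esub> FA F f = FA G f \<cdot>\<^bsub>B\<^esub> \<tau> X"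

definition id_trans ::
  "('o, 'a) category \<Rightarrow> ('p, 'b) category \<Rightarrow> ('o, 'a, 'p, 'b) cfun \<Rightarrow> 'o \<Rightarrow> 'b" where
  "id_trans A B F = (\<lambda>X\<in>Obj A. Ident B (FO F X))"

definition inverse_trans :: "('o, 'a) category \<Rightarrow> ('p, 'b) category
    \<Rightarrow> ('o, 'a, 'p, 'b) cfun \<Rightarrow> ('o, 'a, 'p, 'b) cfun \<Rightarrow> ('o \<Rightarrow> 'b) \<Rightarrow> ('o \<Rightarrow> 'b) \<Rightarrow> bool" where
  "inverse_trans A B F G \<tau> \<sigma> \<longleftrightarrow> nat_trans A B F G \<tau> \<and> nat_trans A B G F \<sigma> \<and>
     (\<forall>X\<in>Obj A. \<sigma> X \<cdot>\<^bsub>B\<^esub> \<tau> X = Ident B (FO F X) \<and> \<tau> X \<cdot>\<^bsub>B\<^esub> \<sigma> X = Ident B (FO G X))"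

definition invertible_trans :: "('o, 'a) category \<Rightarrow> ('p, 'b) category
    \<Rightarrow> ('o, 'a, 'p, 'b) cfun \<Rightarrow> ('o, 'a, 'p, 'b) cfun \<Rightarrow> ('o \<Rightarrow> 'b) \<Rightarrow> bool" where
  "invertible_trans A B F G \<tau> \<longleftrightarrow> (\<exists>\<sigma>. inverse_trans A B F G \<tau> \<sigma>)"

definition inv_trans :: "('o, 'a) category \<Rightarrow> ('p, 'b) category
    \<Rightarrow> ('o, 'a, 'p, 'b) cfun \<Rightarrow> ('o, 'a, 'p, 'b) cfun \<Rightarrow> ('o \<Rightarrow> 'b) \<Rightarrow> 'o \<Rightarrow> 'b" where
  "inv_trans A B F G \<tau> = (THE \<sigma>. inverse_trans A B F G \<tau> \<sigma>)"


section \<open>Adjunctions\<close>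

record ('o, 'a, 'p, 'b) adj =
  LeftF :: "('o, 'a, 'p, 'b) cfun"
  RightF :: "('p, 'b, 'o, 'a) cfun"
  Unit :: "'o \<Rightarrow> 'a"
  Counit :: "'p \<Rightarrow> 'b"

locale adjunction =
  fixes C :: "('o, 'a) category" and X :: "('p, 'b) category" and A :: "('o, 'a, 'p, 'b) adj"
  assumes left_fun: "cfunctor C X (LeftF A)"
    and right_fun: "cfunctor X C (RightF A)"
    and unit_trans: "nat_trans C C (id_fun C) (comp_fun C (RightF A) (LeftF A)) (Unit A)"
    and counit_trans: "nat_trans X X (comp_fun X (LeftF A) (RightF A)) (id_fun X) (Counit A)"
    and triangle_left: "c \<in> Obj C \<Longrightarrow>
      Counit A (FO (LeftF A) c) \<cdot>\<^bsub>X\<^esub> FA (LeftF A) (Unit A c) = Ident X (FO (LeftF A) c)"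
    and triangle_right: "x \<in> Obj X \<Longrightarrow>
      FA (RightF A) (Counit A x) \<cdot>\<^bsub>C\<^esub> Unit A (FO (RightF A) x) = Ident C (FO (RightF A) x)"

definition prod_adj :: "('o, 'a) category \<Rightarrow> ('p, 'b) category \<Rightarrow> ('o, 'a, 'p, 'b) adj
    \<Rightarrow> ('q, 'c) category \<Rightarrow> ('r, 'd) category \<Rightarrow> ('q, 'c, 'r, 'd) adj
    \<Rightarrow> ('o \<times> 'q, 'a \<times> 'c, 'p \<times> 'r, 'b \<times> 'd) adj" where
  "prod_adj C X A C' X' A' =
     \<lparr>LeftF = prod_fun C C' (LeftF A) (LeftF A'),
      RightF = prod_fun X X' (RightF A) (RightF A'),
      Unit = restrict (map_prod (Unit A) (Unit A')) (Obj C \<times> Obj C'),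
      Counit = restrict (map_prod (Counit A) (Counit A')) (Obj X \<times> Obj X')\<rparr>"

text \<open>In a parametric adjunction, \<open>PJ : C \<times> P \<rightarrow> D\<close> and \<open>PK : P\<^sup>o\<^sup>p \<times> D \<rightarrow> C\<close>, and \<open>PUnit p\<close>,
  \<open>PCounit p\<close> are the unit and counit of \<open>PJ(-,p) \<stileturn> PK(p,-)\<close>.\<close>

record ('c, 'ca, 'p, 'pa, 'd, 'da) param_adj =
  PJ :: "('c \<times> 'p, 'ca \<times> 'pa, 'd, 'da) cfun"
  PK :: "('p \<times> 'd, 'pa \<times> 'da, 'c, 'ca) cfun"
  PUnit :: "'p \<Rightarrow> 'c \<Rightarrow> 'ca"
  PCounit :: "'p \<Rightarrow> 'd \<Rightarrow> 'da"

definition J_at :: "('c, 'ca) category \<Rightarrow> ('p, 'pa) category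
    \<Rightarrow> ('c \<times> 'p, 'ca \<times> 'pa, 'd, 'da) cfun \<Rightarrow> 'p \<Rightarrow> ('c, 'ca, 'd, 'da) cfun" where
  "J_at C P J p = \<lparr>FO = (\<lambda>c\<in>Obj C. FO J (c, p)), FA = (\<lambda>f\<in>Arr C. FA J (f, Ident P p))\<rparr>"

definition K_at :: "('p, 'pa) category \<Rightarrow> ('d, 'da) category
    \<Rightarrow> ('p \<times> 'd, 'pa \<times> 'da, 'c, 'ca) cfun \<Rightarrow> 'p \<Rightarrow> ('d, 'da, 'c, 'ca) cfun" where
  "K_at P D K p = \<lparr>FO = (\<lambda>d\<in>Obj D. FO K (p, d)), FA = (\<lambda>g\<in>Arr D. FA K (Ident P p, g))\<rparr>"

definition adj_at :: "('c, 'ca) category \<Rightarrow> ('p, 'pa) category \<Rightarrow> ('d, 'da) category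
    \<Rightarrow> ('c, 'ca, 'p, 'pa, 'd, 'da) param_adj \<Rightarrow> 'p \<Rightarrow> ('c, 'ca, 'd, 'da) adj" where
  "adj_at C P D Q p = \<lparr>LeftF = J_at C P (PJ Q) p, RightF = K_at P D (PK Q) p,
     Unit = PUnit Q p, Counit = PCounit Q p\<rparr>"

locale parametric_adjunction =
  fixes C :: "('c, 'ca) category" and P :: "('p, 'pa) category" and D :: "('d, 'da) category"
    and Q :: "('c, 'ca, 'p, 'pa, 'd, 'da) param_adj"
  assumes cat_P: "category P"
    and J_fun: "cfunctor (prod_cat C P) D (PJ Q)"
    and K_fun: "cfunctor (prod_cat (op_cat P) D) C (PK Q)"
    and PUnit_ext: "PUnit Q \<in> extensional (Obj P)"
    and PCounit_ext: "PCounit Q \<in> extensional (Obj P)"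
    and adj: "p \<in> Obj P \<Longrightarrow> adjunction C D (adj_at C P D Q p)"
    and conjugate: "u \<in> hom P p p' \<Longrightarrow> d \<in> Obj D \<Longrightarrow>
      FA (PK Q) (u, Ident D d) =
        FA (K_at P D (PK Q) p) (PCounit Q p' d)
        \<cdot>\<^bsub>C\<^esub> FA (K_at P D (PK Q) p) (FA (PJ Q) (Ident C (FO (PK Q) (p', d)), u))
        \<cdot>\<^bsub>C\<^esub> PUnit Q p (FO (PK Q) (p', d))"

text \<open>The parametric adjunction \<open>J(C \<times> U) \<stileturn> K(U\<^sup>o\<^sup>p \<times> D)\<close> induced by \<open>U : P' \<rightarrow> P\<close>.\<close>

definition reparam :: "('c, 'ca) category \<Rightarrow> ('d, 'da) category \<Rightarrow> ('p2, 'pa2) category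
    \<Rightarrow> ('p2, 'pa2, 'p, 'pa) cfun \<Rightarrow> ('c, 'ca, 'p, 'pa, 'd, 'da) param_adj
    \<Rightarrow> ('c, 'ca, 'p2, 'pa2, 'd, 'da) param_adj" where
  "reparam C D P' U Q =
     \<lparr>PJ = comp_fun (prod_cat C P') (PJ Q) (prod_fun C P' (id_fun C) U),
      PK = comp_fun (prod_cat (op_cat P') D) (PK Q) (prod_fun (op_cat P') D U (id_fun D)),
      PUnit = (\<lambda>m\<in>Obj P'. PUnit Q (FO U m)),
      PCounit = (\<lambda>m\<in>Obj P'. PCounit Q (FO U m))\<rparr>"


section \<open>Monads and Eilenberg--Moore categories\<close>

record ('o, 'a) mnd =
  MF :: "('o, 'a, 'o, 'a) cfun"
  Mult :: "'o \<Rightarrow> 'a"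
  Eta :: "'o \<Rightarrow> 'a"

locale monad = C: category C for C :: "('o, 'a) category" +
  fixes S :: "('o, 'a) mnd"
  assumes mult_trans: "nat_trans C C (comp_fun C (MF S) (MF S)) (MF S) (Mult S)"
    and eta_trans: "nat_trans C C (id_fun C) (MF S) (Eta S)"
    and mult_assoc: "X \<in> Obj C \<Longrightarrow>
      Mult S X \<cdot>\<^bsub>C\<^esub> Mult S (FO (MF S) X) = Mult S X \<cdot>\<^bsub>C\<^esub> FA (MF S) (Mult S X)"
    and eta_left: "X \<in> Obj C \<Longrightarrow> Mult S X \<cdot>\<^bsub>C\<^esub> Eta S (FO (MF S) X) = Ident C (FO (MF S) X)"
    and eta_right: "X \<in> Obj C \<Longrightarrow> Mult S X \<cdot>\<^bsub>C\<^esub> FA (MF S) (Eta S X) = Ident C (FO (MF S) X)"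

definition id_mnd :: "('o, 'a) category \<Rightarrow> ('o, 'a) mnd" where
  "id_mnd C = \<lparr>MF = id_fun C, Mult = id_trans C C (id_fun C), Eta = id_trans C C (id_fun C)\<rparr>"

definition prod_mnd :: "('o, 'a) category \<Rightarrow> ('p, 'b) category \<Rightarrow> ('o, 'a) mnd \<Rightarrow> ('p, 'b) mnd
    \<Rightarrow> ('o \<times> 'p, 'a \<times> 'b) mnd" where
  "prod_mnd C P S E = \<lparr>MF = prod_fun C P (MF S) (MF E),
     Mult = restrict (map_prod (Mult S) (Mult E)) (Obj C \<times> Obj P),
     Eta = restrict (map_prod (Eta S) (Eta E)) (Obj C \<times> Obj P)\<rparr>"

text \<open>An arrow of the Eilenberg--Moore category is a triple (source algebra, target algebra,
  underlying arrow), since the underlying arrow does not determine the algebras.\<close>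

type_synonym ('o, 'a) alg = "'o \<times> 'a"
type_synonym ('o, 'a) alg_arr = "('o \<times> 'a) \<times> ('o \<times> 'a) \<times> 'a"

definition EM_Obj :: "('o, 'a) category \<Rightarrow> ('o, 'a) mnd \<Rightarrow> ('o, 'a) alg set" where
  "EM_Obj C S = {(M, k). M \<in> Obj C \<and> k \<in> hom C (FO (MF S) M) M \<and>
     k \<cdot>\<^bsub>C\<^esub> Mult S M = k \<cdot>\<^bsub>C\<^esub> FA (MF S) k \<and> k \<cdot>\<^bsub>C\<^esub> Eta S M = Ident C M}"

definition EM_Arr :: "('o, 'a) category \<Rightarrow> ('o, 'a) mnd \<Rightarrow> ('o, 'a) alg_arr set" where
  "EM_Arr C S = {((M, k), (N, l), f). (M, k) \<in> EM_Obj C S \<and> (N, l) \<in> EM_Obj C S \<and>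
     f \<in> hom C M N \<and> f \<cdot>\<^bsub>C\<^esub> k = l \<cdot>\<^bsub>C\<^esub> FA (MF S) f}"

definition EM :: "('o, 'a) category \<Rightarrow> ('o, 'a) mnd \<Rightarrow> (('o, 'a) alg, ('o, 'a) alg_arr) category"
  where
  "EM C S = \<lparr>Obj = EM_Obj C S, Arr = EM_Arr C S, Dom = (\<lambda>(x, y, f). x), Cod = (\<lambda>(x, y, f). y),
     Ident = (\<lambda>x. (x, x, Ident C (fst x))),
     Comp = (\<lambda>(y, z, g) (x, y', f). (x, z, g \<cdot>\<^bsub>C\<^esub> f))\<rparr>"

definition EM_free :: "('o, 'a) category \<Rightarrow> ('o, 'a) mnd
    \<Rightarrow> ('o, 'a, ('o, 'a) alg, ('o, 'a) alg_arr) cfun" where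
  "EM_free C S = \<lparr>FO = (\<lambda>X\<in>Obj C. (FO (MF S) X, Mult S X)),
     FA = (\<lambda>f\<in>Arr C. ((FO (MF S) (Dom C f), Mult S (Dom C f)),
                       (FO (MF S) (Cod C f), Mult S (Cod C f)), FA (MF S) f))\<rparr>"

definition EM_forget :: "('o, 'a) category \<Rightarrow> ('o, 'a) mnd
    \<Rightarrow> (('o, 'a) alg, ('o, 'a) alg_arr, 'o, 'a) cfun" where
  "EM_forget C S = \<lparr>FO = (\<lambda>x\<in>EM_Obj C S. fst x), FA = (\<lambda>(x, y, f)\<in>EM_Arr C S. f)\<rparr>"

definition EM_adj :: "('o, 'a) category \<Rightarrow> ('o, 'a) mnd
    \<Rightarrow> ('o, 'a, ('o, 'a) alg, ('o, 'a) alg_arr) adj" where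
  "EM_adj C S = \<lparr>LeftF = EM_free C S, RightF = EM_forget C S, Unit = Eta S,
     Counit = (\<lambda>(M, k)\<in>EM_Obj C S. ((FO (MF S) M, Mult S M), (M, k), k))\<rparr>"


section \<open>The 2-category of adjunctions\<close>

text \<open>For adjunctions \<open>A : L \<stileturn> R : C \<rightarrow> X\<close> and \<open>B : L' \<stileturn> R' : D \<rightarrow> Y\<close>, the mate of
  \<open>\<lambda> : L' J \<rightarrow> V L\<close> is a transformation \<open>J R \<rightarrow> R' V\<close>.\<close>

definition mate :: "('p, 'b) category \<Rightarrow> ('o, 'a, 'p, 'b) adj
    \<Rightarrow> ('q, 'c) category \<Rightarrow> ('q, 'c, 'r, 'd) adj
    \<Rightarrow> ('o, 'a, 'q, 'c) cfun \<Rightarrow> ('p, 'b, 'r, 'd) cfun \<Rightarrow> ('o \<Rightarrow> 'd) \<Rightarrow> 'p \<Rightarrow> 'c" where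
  "mate X A D B J V l = (\<lambda>x\<in>Obj X.
     FA (RightF B) (FA V (Counit A x))
     \<cdot>\<^bsub>D\<^esub> FA (RightF B) (l (FO (RightF A) x))
     \<cdot>\<^bsub>D\<^esub> Unit B (FO J (FO (RightF A) x)))"

definition adjR_1cell :: "('o, 'a) category \<Rightarrow> ('p, 'b) category \<Rightarrow> ('o, 'a, 'p, 'b) adj
    \<Rightarrow> ('q, 'c) category \<Rightarrow> ('r, 'd) category \<Rightarrow> ('q, 'c, 'r, 'd) adj
    \<Rightarrow> ('o, 'a, 'q, 'c) cfun \<Rightarrow> ('p, 'b, 'r, 'd) cfun \<Rightarrow> ('o \<Rightarrow> 'd) \<Rightarrow> bool" where
  "adjR_1cell C X A D Y B J V l \<longleftrightarrow>
     adjunction C X A \<and> adjunction D Y B \<and> cfunctor C D J \<and> cfunctor X Y V \<and>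
     nat_trans C Y (comp_fun C (LeftF B) J) (comp_fun C V (LeftF A)) l \<and>
     invertible_trans X D (comp_fun X J (RightF A)) (comp_fun X (RightF B) V)
       (mate X A D B J V l)"

text \<open>\<open>H(\<lambda>) = V(L\<^sub>1 \<times> \<epsilon>\<^sub>2) \<circ> \<lambda>(C\<^sub>1 \<times> R\<^sub>2)\<close> for a 1-cell \<open>(J, V, \<lambda>)\<close> from the product adjunction
  \<open>L\<^sub>1 \<times> L\<^sub>2 \<stileturn> R\<^sub>1 \<times> R\<^sub>2\<close>, with component at \<open>(c, x)\<close> for \<open>c\<close> in \<open>C\<^sub>1\<close> and \<open>x\<close> in \<open>X\<^sub>2\<close>.\<close>

definition H_adj :: "('o1, 'a1) category \<Rightarrow> ('p1, 'b1) category \<Rightarrow> ('o1, 'a1, 'p1, 'b1) adj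
    \<Rightarrow> ('p2, 'b2) category \<Rightarrow> ('o2, 'a2, 'p2, 'b2) adj \<Rightarrow> ('r, 'd) category
    \<Rightarrow> ('p1 \<times> 'p2, 'b1 \<times> 'b2, 'r, 'd) cfun \<Rightarrow> ('o1 \<times> 'o2 \<Rightarrow> 'd) \<Rightarrow> 'o1 \<times> 'p2 \<Rightarrow> 'd" where
  "H_adj C1 X1 A1 X2 A2 Y V l = (\<lambda>(c, x)\<in>Obj C1 \<times> Obj X2.
     FA V (Ident X1 (FO (LeftF A1) c), Counit A2 x) \<cdot>\<^bsub>Y\<^esub> l (c, FO (RightF A2) x))"

definition left_hopf_adj :: "('o1, 'a1) category \<Rightarrow> ('p1, 'b1) category \<Rightarrow> ('o1, 'a1, 'p1, 'b1) adj
    \<Rightarrow> ('o2, 'a2) category \<Rightarrow> ('p2, 'b2) category \<Rightarrow> ('o2, 'a2, 'p2, 'b2) adj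
    \<Rightarrow> ('q, 'c) category \<Rightarrow> ('r, 'd) category \<Rightarrow> ('q, 'c, 'r, 'd) adj
    \<Rightarrow> ('o1 \<times> 'o2, 'a1 \<times> 'a2, 'q, 'c) cfun \<Rightarrow> ('p1 \<times> 'p2, 'b1 \<times> 'b2, 'r, 'd) cfun
    \<Rightarrow> ('o1 \<times> 'o2 \<Rightarrow> 'd) \<Rightarrow> bool" where
  "left_hopf_adj C1 X1 A1 C2 X2 A2 D Y B J V l \<longleftrightarrow>
     adjR_1cell (prod_cat C1 C2) (prod_cat X1 X2) (prod_adj C1 X1 A1 C2 X2 A2) D Y B J V l \<and>
     invertible_trans (prod_cat C1 X2) Y
       (comp_fun (prod_cat C1 X2) (LeftF B)
         (comp_fun (prod_cat C1 X2) J (prod_fun C1 X2 (id_fun C1) (RightF A2))))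
       (comp_fun (prod_cat C1 X2) V (prod_fun C1 X2 (LeftF A1) (id_fun X2)))
       (H_adj C1 X1 A1 X2 A2 Y V l)"

text \<open>The transformation \<open>F\<^sup>T J \<rightarrow> V(F\<^sup>S \<times> F\<^sup>E)\<close> whose mate is the identity
  \<open>J(U\<^sup>S \<times> U\<^sup>E) = U\<^sup>T V\<close>.\<close>

definition lambda_lift :: "('c, 'ca) category \<Rightarrow> ('c, 'ca) mnd
    \<Rightarrow> ('p, 'pa) category \<Rightarrow> ('p, 'pa) mnd \<Rightarrow> ('d, 'da) category \<Rightarrow> ('d, 'da) mnd
    \<Rightarrow> ('c \<times> 'p, 'ca \<times> 'pa, 'd, 'da) cfun
    \<Rightarrow> (('c, 'ca) alg \<times> ('p, 'pa) alg, ('c, 'ca) alg_arr \<times> ('p, 'pa) alg_arr,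
        ('d, 'da) alg, ('d, 'da) alg_arr) cfun
    \<Rightarrow> 'c \<times> 'p \<Rightarrow> ('d, 'da) alg_arr" where
  "lambda_lift C S P E D T J V = (THE l.
     nat_trans (prod_cat C P) (EM D T)
       (comp_fun (prod_cat C P) (EM_free D T) J)
       (comp_fun (prod_cat C P) V (prod_fun C P (EM_free C S) (EM_free P E))) l \<and>
     mate (prod_cat (EM C S) (EM P E))
       (prod_adj C (EM C S) (EM_adj C S) P (EM P E) (EM_adj P E)) D (EM_adj D T) J V l
     = id_trans (prod_cat (EM C S) (EM P E)) D
         (comp_fun (prod_cat (EM C S) (EM P E)) J
           (prod_fun (EM C S) (EM P E) (EM_forget C S) (EM_forget P E))))"


section \<open>The 2-category of monads\<close>

type_synonym ('o, 'a, 'p, 'b) mnd_cell = "('o, 'a, 'p, 'b) cfun \<times> ('o \<Rightarrow> 'b)"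

definition mnd_1cell :: "('o, 'a) category \<Rightarrow> ('o, 'a) mnd \<Rightarrow> ('p, 'b) category \<Rightarrow> ('p, 'b) mnd
    \<Rightarrow> ('o, 'a, 'p, 'b) mnd_cell \<Rightarrow> bool" where
  "mnd_1cell C S D T = (\<lambda>(B, \<psi>).
     monad C S \<and> monad D T \<and> cfunctor C D B \<and>
     nat_trans C D (comp_fun C (MF T) B) (comp_fun C B (MF S)) \<psi> \<and>
     (\<forall>X\<in>Obj C. \<psi> X \<cdot>\<^bsub>D\<^esub> Mult T (FO B X)
        = FA B (Mult S X) \<cdot>\<^bsub>D\<^esub> \<psi> (FO (MF S) X) \<cdot>\<^bsub>D\<^esub> FA (MF T) (\<psi> X)) \<and>
     (\<forall>X\<in>Obj C. \<psi> X \<cdot>\<^bsub>D\<^esub> Eta T (FO B X) = FA B (Eta S X)))"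

definition mnd_id :: "('o, 'a) category \<Rightarrow> ('o, 'a) mnd \<Rightarrow> ('o, 'a, 'o, 'a) mnd_cell" where
  "mnd_id C S = (id_fun C, id_trans C C (MF S))"

text \<open>\<open>mnd_comp C B k j\<close> is the composite \<open>k j\<close>, where \<open>C\<close> is the source of \<open>j\<close> and \<open>B\<close>
  the target of \<open>k\<close>.\<close>

definition mnd_comp :: "('o, 'a) category \<Rightarrow> ('q, 'c) category
    \<Rightarrow> ('p, 'b, 'q, 'c) mnd_cell \<Rightarrow> ('o, 'a, 'p, 'b) mnd_cell
    \<Rightarrow> ('o, 'a, 'q, 'c) mnd_cell" where
  "mnd_comp C B = (\<lambda>(K, \<psi>K) (J, \<psi>J).
     (comp_fun C K J, \<lambda>X\<in>Obj C. FA K (\<psi>J X) \<cdot>\<^bsub>B\<^esub> \<psi>K (FO J X)))"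

definition mnd_2cell :: "('o, 'a) category \<Rightarrow> ('o, 'a) mnd \<Rightarrow> ('p, 'b) category \<Rightarrow> ('p, 'b) mnd
    \<Rightarrow> ('o, 'a, 'p, 'b) mnd_cell \<Rightarrow> ('o, 'a, 'p, 'b) mnd_cell \<Rightarrow> ('o \<Rightarrow> 'b) \<Rightarrow> bool" where
  "mnd_2cell C S D T = (\<lambda>(A, \<psi>A) (B, \<psi>B) \<theta>.
     mnd_1cell C S D T (A, \<psi>A) \<and> mnd_1cell C S D T (B, \<psi>B) \<and> nat_trans C D A B \<theta> \<and>
     (\<forall>X\<in>Obj C. \<psi>B X \<cdot>\<^bsub>D\<^esub> FA (MF T) (\<theta> X) = \<theta> (FO (MF S) X) \<cdot>\<^bsub>D\<^esub> \<psi>A X))"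

definition mnd_adjoint :: "('o, 'a) category \<Rightarrow> ('o, 'a) mnd \<Rightarrow> ('p, 'b) category \<Rightarrow> ('p, 'b) mnd
    \<Rightarrow> ('o, 'a, 'p, 'b) adj \<Rightarrow> ('o \<Rightarrow> 'b) \<Rightarrow> ('p \<Rightarrow> 'a) \<Rightarrow> bool" where
  "mnd_adjoint C S D T A \<psi>J \<psi>K \<longleftrightarrow>
     adjunction C D A \<and>
     mnd_1cell C S D T (LeftF A, \<psi>J) \<and> mnd_1cell D T C S (RightF A, \<psi>K) \<and>
     mnd_2cell C S C S (mnd_id C S)
       (mnd_comp C C (RightF A, \<psi>K) (LeftF A, \<psi>J)) (Unit A) \<and>
     mnd_2cell D T D T (mnd_comp D D (LeftF A, \<psi>J) (RightF A, \<psi>K))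
       (mnd_id D T) (Counit A)"

definition H_mnd :: "('c, 'ca) category \<Rightarrow> ('c, 'ca) mnd
    \<Rightarrow> ('p, 'pa) category \<Rightarrow> ('p, 'pa) mnd \<Rightarrow> ('d, 'da) category
    \<Rightarrow> ('c \<times> 'p, 'ca \<times> 'pa, 'd, 'da) cfun \<Rightarrow> ('c \<times> 'p \<Rightarrow> 'da) \<Rightarrow> 'c \<times> ('p, 'pa) alg \<Rightarrow> 'da" where
  "H_mnd C S P E D J \<psi> = (\<lambda>(c, (m, k))\<in>Obj C \<times> Obj (EM P E).
     FA J (Ident C (FO (MF S) c), k) \<cdot>\<^bsub>D\<^esub> \<psi> (c, m))"

definition left_hopf_mnd :: "('c, 'ca) category \<Rightarrow> ('c, 'ca) mnd
    \<Rightarrow> ('p, 'pa) category \<Rightarrow> ('p, 'pa) mnd \<Rightarrow> ('d, 'da) category \<Rightarrow> ('d, 'da) mnd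
    \<Rightarrow> ('c \<times> 'p, 'ca \<times> 'pa, 'd, 'da) mnd_cell \<Rightarrow> bool" where
  "left_hopf_mnd C S P E D T = (\<lambda>(J, \<psi>).
     mnd_1cell (prod_cat C P) (prod_mnd C P S E) D T (J, \<psi>) \<and>
     invertible_trans (prod_cat C (EM P E)) D
       (comp_fun (prod_cat C (EM P E)) (MF T)
         (comp_fun (prod_cat C (EM P E)) J (prod_fun C (EM P E) (id_fun C) (EM_forget P E))))
       (comp_fun (prod_cat C (EM P E)) J (prod_fun C (EM P E) (MF S) (EM_forget P E)))
       (H_mnd C S P E D J \<psi>))"

text \<open>For \<open>A : J \<stileturn> K\<close> and invertible \<open>\<psi> : T J \<rightarrow> J S\<close>, the transformation
  \<open>ad(\<psi>) = K T \<epsilon> \<circ> K \<psi>\<^sup>-\<^sup>1 K \<circ> \<eta> S K : S K \<rightarrow> K T\<close>.\<close>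

definition ad :: "('c, 'ca) category \<Rightarrow> ('c, 'ca) mnd \<Rightarrow> ('d, 'da) category \<Rightarrow> ('d, 'da) mnd
    \<Rightarrow> ('c, 'ca, 'd, 'da) adj \<Rightarrow> ('c \<Rightarrow> 'da) \<Rightarrow> 'd \<Rightarrow> 'ca" where
  "ad C S D T A \<psi> = (\<lambda>d\<in>Obj D.
     FA (RightF A) (FA (MF T) (Counit A d))
     \<cdot>\<^bsub>C\<^esub> FA (RightF A)
         (inv_trans C D (comp_fun C (MF T) (LeftF A)) (comp_fun C (LeftF A) (MF S)) \<psi>
           (FO (RightF A) d))
     \<cdot>\<^bsub>C\<^esub> Unit A (FO (MF S) (FO (RightF A) d)))"

text \<open>Components in the first variable of a transformation with parameters, such as
  \<open>\<psi>\<^sup>J\<^sup>M = H(\<psi>\<^sup>J)\<^bsub>(-,M)\<^esub>\<close>, and the transformation \<open>ad(\<phi>)\<close> with \<open>ad(\<phi>)\<^bsub>(M,d)\<^esub> = ad(\<phi>\<^bsub>(-,M)\<^esub>)\<^bsub>d\<^esub>\<close>.\<close>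

definition trans_at :: "('c, 'ca) category \<Rightarrow> ('c \<times> 'p \<Rightarrow> 'da) \<Rightarrow> 'p \<Rightarrow> 'c \<Rightarrow> 'da" where
  "trans_at C \<phi> m = (\<lambda>c\<in>Obj C. \<phi> (c, m))"

definition ad_param :: "('c, 'ca) category \<Rightarrow> ('c, 'ca) mnd \<Rightarrow> ('p, 'pa) category
    \<Rightarrow> ('d, 'da) category \<Rightarrow> ('d, 'da) mnd \<Rightarrow> ('c, 'ca, 'p, 'pa, 'd, 'da) param_adj
    \<Rightarrow> ('c \<times> 'p \<Rightarrow> 'da) \<Rightarrow> 'p \<times> 'd \<Rightarrow> 'ca" where
  "ad_param C S P D T Q \<phi> = (\<lambda>(m, d)\<in>Obj P \<times> Obj D.
     ad C S D T (adj_at C P D Q m) (trans_at C \<phi> m) d)"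


section \<open>The two kinds of structure\<close>

text \<open>Hopf liftings of \<open>Q : J \<stileturn> K\<close>: parametric adjunctions \<open>R\<close> between the Eilenberg--Moore
  categories whose functors, units and counits lie over those of \<open>Q\<close>.\<close>

definition hopf_lifting :: "('c, 'ca) category \<Rightarrow> ('c, 'ca) mnd
    \<Rightarrow> ('p, 'pa) category \<Rightarrow> ('p, 'pa) mnd \<Rightarrow> ('d, 'da) category \<Rightarrow> ('d, 'da) mnd
    \<Rightarrow> ('c, 'ca, 'p, 'pa, 'd, 'da) param_adj
    \<Rightarrow> (('c, 'ca) alg, ('c, 'ca) alg_arr, ('p, 'pa) alg, ('p, 'pa) alg_arr,
        ('d, 'da) alg, ('d, 'da) alg_arr) param_adj \<Rightarrow> bool" where
  "hopf_lifting C S P E D T Q R \<longleftrightarrow>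
     parametric_adjunction (EM C S) (EM P E) (EM D T) R \<and>
     comp_fun (prod_cat (EM C S) (EM P E)) (EM_forget D T) (PJ R)
       = comp_fun (prod_cat (EM C S) (EM P E)) (PJ Q)
           (prod_fun (EM C S) (EM P E) (EM_forget C S) (EM_forget P E)) \<and>
     comp_fun (prod_cat (op_cat (EM P E)) (EM D T)) (EM_forget C S) (PK R)
       = comp_fun (prod_cat (op_cat (EM P E)) (EM D T)) (PK Q)
           (prod_fun (op_cat (EM P E)) (EM D T) (EM_forget P E) (EM_forget D T)) \<and>
     (\<forall>m\<in>Obj (EM P E). \<forall>x\<in>Obj (EM C S).
        FA (EM_forget C S) (PUnit R m x)
          = PUnit (reparam C D (EM P E) (EM_forget P E) Q) m (FO (EM_forget C S) x)) \<and>
     (\<forall>m\<in>Obj (EM P E). \<forall>y\<in>Obj (EM D T).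
        FA (EM_forget D T) (PCounit R m y)
          = PCounit (reparam C D (EM P E) (EM_forget P E) Q) m (FO (EM_forget D T) y)) \<and>
     left_hopf_adj C (EM C S) (EM_adj C S) P (EM P E) (EM_adj P E) D (EM D T) (EM_adj D T)
       (PJ Q) (PJ R) (lambda_lift C S P E D T (PJ Q) (PJ R))"

text \<open>A parametric adjunction in the 2-category of monads is given by an underlying parametric
  adjunction \<open>Under\<close> together with the transformations that make its two functors 1-cells.\<close>

record ('c, 'ca, 'p, 'pa, 'd, 'da) mnd_param_adj =
  Under :: "('c, 'ca, 'p, 'pa, 'd, 'da) param_adj"
  PsiJ :: "'c \<times> 'p \<Rightarrow> 'da"
  PsiK :: "'p \<times> 'd \<Rightarrow> 'ca"

definition hopf_param_adjunction :: "('c, 'ca) category \<Rightarrow> ('c, 'ca) mnd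
    \<Rightarrow> ('p, 'pa) category \<Rightarrow> ('p, 'pa) mnd \<Rightarrow> ('d, 'da) category \<Rightarrow> ('d, 'da) mnd
    \<Rightarrow> ('c, 'ca, 'p, 'pa, 'd, 'da) param_adj
    \<Rightarrow> ('c, 'ca, ('p, 'pa) alg, ('p, 'pa) alg_arr, 'd, 'da) mnd_param_adj \<Rightarrow> bool" where
  "hopf_param_adjunction C S P E D T Q X \<longleftrightarrow>
     Under X = reparam C D (EM P E) (EM_forget P E) Q \<and>
     (\<exists>\<psi>. left_hopf_mnd C S P E D T (PJ Q, \<psi>) \<and> PsiJ X = H_mnd C S P E D (PJ Q) \<psi>) \<and>
     PsiK X = ad_param C S (EM P E) D T (Under X) (PsiJ X) \<and>
     parametric_adjunction C (EM P E) D (Under X) \<and>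
     mnd_1cell (prod_cat C (EM P E)) (prod_mnd C (EM P E) S (id_mnd (EM P E))) D T
       (PJ (Under X), PsiJ X) \<and>
     mnd_1cell (prod_cat (op_cat (EM P E)) D)
       (prod_mnd (op_cat (EM P E)) D (id_mnd (op_cat (EM P E))) T) C S
       (PK (Under X), PsiK X) \<and>
     (\<forall>m\<in>Obj (EM P E). mnd_adjoint C S D T (adj_at C (EM P E) D (Under X) m)
        (trans_at C (PsiJ X) m) (\<lambda>d\<in>Obj D. PsiK X (m, d)))"

text \<open>The correspondence between a lifting \<open>R\<close> and \<open>X\<close>: the algebra structures on the values of
  \<open>R\<close> are those determined by the 1-cells of \<open>X\<close>.\<close>

definition corresponds :: "('c, 'ca) category \<Rightarrow> ('c, 'ca) mnd
    \<Rightarrow> ('p, 'pa) category \<Rightarrow> ('p, 'pa) mnd \<Rightarrow> ('d, 'da) category \<Rightarrow> ('d, 'da) mnd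
    \<Rightarrow> ('c, 'ca, 'p, 'pa, 'd, 'da) param_adj
    \<Rightarrow> (('c, 'ca) alg, ('c, 'ca) alg_arr, ('p, 'pa) alg, ('p, 'pa) alg_arr,
        ('d, 'da) alg, ('d, 'da) alg_arr) param_adj
    \<Rightarrow> ('c, 'ca, ('p, 'pa) alg, ('p, 'pa) alg_arr, 'd, 'da) mnd_param_adj \<Rightarrow> bool" where
  "corresponds C S P E D T Q R X \<longleftrightarrow>
     (\<forall>(c, h)\<in>Obj (EM C S). \<forall>(m, k)\<in>Obj (EM P E).
        FO (PJ R) ((c, h), (m, k))
          = (FO (PJ Q) (c, m), FA (PJ Q) (h, Ident P m) \<cdot>\<^bsub>D\<^esub> PsiJ X (c, (m, k)))) \<and>
     (\<forall>(m, k)\<in>Obj (EM P E). \<forall>(d, l)\<in>Obj (EM D T).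
        FO (PK R) ((m, k), (d, l))
          = (FO (PK Q) (m, d), FA (PK Q) (Ident P m, l) \<cdot>\<^bsub>C\<^esub> PsiK X ((m, k), d)))"

end

theory Submission
  imports Defs
begin

text \<open>
  A lifting \<open>V\<close> of \<open>J\<close> is the same as a 1-cell \<open>(J, \<psi>)\<close>: the algebra structure of
  \<open>V((c,h),(m,k))\<close> is \<open>J(h,k) \<circ> \<psi>\<close>, and \<open>\<psi>\<close> is recovered from the free algebras as
  \<open>a \<circ> T J(\<eta>,\<eta>)\<close>, with \<open>a\<close> the structure of \<open>V(F c, F m)\<close>. Under this correspondence
  \<open>\<lambda>\<close> has underlying transformation \<open>\<psi>\<close> and \<open>H(\<lambda>)\<close> has \<open>H(\<psi>)\<close>; since an algebra
  homomorphism is invertible as soon as its underlying arrow is, the two Hopf conditions agree.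
  For fixed \<open>M\<close>, an invertible 1-cell \<open>(J\<^sub>M, \<psi>)\<close> makes \<open>(K\<^sub>M, ad \<psi>)\<close> its right adjoint;
  its laws and its naturality in \<open>M\<close> are checked on transposes, where \<open>ad \<psi>\<close> becomes
  \<open>T\<epsilon> \<circ> \<psi>\<^sup>-\<^sup>1\<close>. Conversely, once the counit is a homomorphism, the algebra structure
  on \<open>K(M,d)\<close> has no other choice, so a lifting is determined by \<open>H(\<psi>)\<close>.
\<close>

section \<open>Functors and transformations\<close>

text \<open>\<open>\<psi>\<close> runs T J -> J S, but the adjunctions J_M -| K_M turn only arrows
  of the opposite direction J_M S -> T J_M into arrows S K_M -> K_M T. This is where the Hopf
  condition enters, and what it inverts is H(\<open>\<psi>\<close>), not \<open>\<psi>\<close>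
  itself. Passing to P^E turns the monad E on the parameters into an identity monad, so that the
  laws of a 1-cell can be treated one parameter at a time. The exception is naturality of K in the
  parameter, which compares two different adjunctions; there the conjugacy of J_u and K_u enters the
  1-cell laws. A structure of kind (ii) keeps H(\<open>\<psi>\<close>) and merely asserts that some
  \<open>\<psi>\<close> exists. Injectivity therefore does not go through \<open>\<psi>\<close>: the
  relation \<open>corresponds\<close> fixes both lifted functors on objects, and arrows, units and
  counits lying over given ones leave no further freedom.\<close>

lemma hom_iff [simp]: "f \<in> hom C X Y \<longleftrightarrow> f \<in> Arr C \<and> Dom C f = X \<and> Cod C f = Y"
  by (auto simp: hom_def)

context category
begin

declare Dom_Obj [simp] Cod_Obj [simp]

lemma Ident_Arr [simp]: "X \<in> Obj C \<Longrightarrow> Ident C X \<in> Arr C"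
  and Dom_Ident [simp]: "X \<in> Obj C \<Longrightarrow> Dom C (Ident C X) = X"
  and Cod_Ident [simp]: "X \<in> Obj C \<Longrightarrow> Cod C (Ident C X) = X"
  using Id_hom by auto

lemma Comp_Arr [simp]: "f \<in> Arr C \<Longrightarrow> g \<in> Arr C \<Longrightarrow> Cod C f = Dom C g \<Longrightarrow> g \<cdot>\<^bsub>C\<^esub> f \<in> Arr C"
  and Dom_Comp [simp]: "f \<in> Arr C \<Longrightarrow> g \<in> Arr C \<Longrightarrow> Cod C f = Dom C g \<Longrightarrow> Dom C (g \<cdot>\<^bsub>C\<^esub> f) = Dom C f"
  and Cod_Comp [simp]: "f \<in> Arr C \<Longrightarrow> g \<in> Arr C \<Longrightarrow> Cod C f = Dom C g \<Longrightarrow> Cod C (g \<cdot>\<^bsub>C\<^esub> f) = Cod C g"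
  using Comp_hom[of f "Dom C f" "Cod C f" g "Cod C g"] by auto

text \<open>As a rewrite rule this brings every composite to right-nested form. Its side conditions
  concern \<open>Arr\<close>, \<open>Dom\<close> and \<open>Cod\<close> rather than hom-sets, so
  that the simplifier can discharge them by computing endpoints.\<close>

lemma Comp_assoc_Arr [simp]:
  "f \<in> Arr C \<Longrightarrow> g \<in> Arr C \<Longrightarrow> h \<in> Arr C \<Longrightarrow> Cod C f = Dom C g \<Longrightarrow> Cod C g = Dom C h \<Longrightarrow>
    (h \<cdot>\<^bsub>C\<^esub> g) \<cdot>\<^bsub>C\<^esub> f = h \<cdot>\<^bsub>C\<^esub> (g \<cdot>\<^bsub>C\<^esub> f)"
  using Comp_assoc[of f "Dom C f" "Cod C f" g "Cod C g" h "Cod C h"] by auto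

lemma Id_left_Arr [simp]: "f \<in> Arr C \<Longrightarrow> Cod C f = Y \<Longrightarrow> Ident C Y \<cdot>\<^bsub>C\<^esub> f = f"
  and Id_right_Arr [simp]: "f \<in> Arr C \<Longrightarrow> Dom C f = X \<Longrightarrow> f \<cdot>\<^bsub>C\<^esub> Ident C X = f"
  using Id_left[of f "Dom C f" "Cod C f"] Id_right[of f "Dom C f" "Cod C f"] by auto

text \<open>In a right-nested composite an equation for g after f no longer matches, because f is
  grouped with what precedes it. This is the form of the equation with such a tail.\<close>

lemma precomp:
  "g \<cdot>\<^bsub>C\<^esub> f = h \<Longrightarrow> f \<in> Arr C \<Longrightarrow> g \<in> Arr C \<Longrightarrow> Cod C f = Dom C g \<Longrightarrow>
    x \<in> Arr C \<Longrightarrow> Cod C x = Dom C f \<Longrightarrow> g \<cdot>\<^bsub>C\<^esub> (f \<cdot>\<^bsub>C\<^esub> x) = h \<cdot>\<^bsub>C\<^esub> x"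
  by (metis Comp_assoc_Arr)

end

lemma categoryI:
  assumes "\<And>f. f \<in> Arr C \<Longrightarrow> Dom C f \<in> Obj C"
    and "\<And>f. f \<in> Arr C \<Longrightarrow> Cod C f \<in> Obj C"
    and "\<And>X. X \<in> Obj C \<Longrightarrow> Ident C X \<in> Arr C \<and> Dom C (Ident C X) = X \<and> Cod C (Ident C X) = X"
    and "\<And>f g. f \<in> Arr C \<Longrightarrow> g \<in> Arr C \<Longrightarrow> Cod C f = Dom C g \<Longrightarrow>
      g \<cdot>\<^bsub>C\<^esub> f \<in> Arr C \<and> Dom C (g \<cdot>\<^bsub>C\<^esub> f) = Dom C f \<and> Cod C (g \<cdot>\<^bsub>C\<^esub> f) = Cod C g"
    and "\<And>f g h. f \<in> Arr C \<Longrightarrow> g \<in> Arr C \<Longrightarrow> h \<in> Arr C \<Longrightarrow> Cod C f = Dom C g \<Longrightarrow> Cod C g = Dom C h \<Longrightarrow>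
      (h \<cdot>\<^bsub>C\<^esub> g) \<cdot>\<^bsub>C\<^esub> f = h \<cdot>\<^bsub>C\<^esub> (g \<cdot>\<^bsub>C\<^esub> f)"
    and "\<And>f. f \<in> Arr C \<Longrightarrow> Ident C (Cod C f) \<cdot>\<^bsub>C\<^esub> f = f"
    and "\<And>f. f \<in> Arr C \<Longrightarrow> f \<cdot>\<^bsub>C\<^esub> Ident C (Dom C f) = f"
  shows "category C"
  by unfold_locales (use assms in auto)

lemma prod_cat_simps [simp]:
  "Obj (prod_cat C D) = Obj C \<times> Obj D"
  "Arr (prod_cat C D) = Arr C \<times> Arr D"
  "Dom (prod_cat C D) = map_prod (Dom C) (Dom D)"
  "Cod (prod_cat C D) = map_prod (Cod C) (Cod D)"
  "Ident (prod_cat C D) = map_prod (Ident C) (Ident D)"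
  "(g, g') \<cdot>\<^bsub>prod_cat C D\<^esub> (f, f') = (g \<cdot>\<^bsub>C\<^esub> f, g' \<cdot>\<^bsub>D\<^esub> f')"
  by (simp_all add: prod_cat_def)

lemma op_cat_simps [simp]:
  "Obj (op_cat C) = Obj C" "Arr (op_cat C) = Arr C"
  "Dom (op_cat C) = Cod C" "Cod (op_cat C) = Dom C" "Ident (op_cat C) = Ident C"
  "g \<cdot>\<^bsub>op_cat C\<^esub> f = f \<cdot>\<^bsub>C\<^esub> g"
  by (simp_all add: op_cat_def)

lemma category_prod_cat:
  assumes "category C" and "category D"
  shows "category (prod_cat C D)"
proof -
  interpret C: category C by fact
  interpret D: category D by fact
  show ?thesis by (rule categoryI) auto
qed

lemma category_op_cat:
  assumes "category C"
  shows "category (op_cat C)"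
proof -
  interpret C: category C by fact
  show ?thesis by (rule categoryI) auto
qed

context cfunctor
begin

declare FO_Obj [simp] FA_Id [simp]

lemma FA_Arr [simp]: "f \<in> Arr A \<Longrightarrow> FA F f \<in> Arr B"
  and Dom_FA [simp]: "f \<in> Arr A \<Longrightarrow> Dom B (FA F f) = FO F (Dom A f)"
  and Cod_FA [simp]: "f \<in> Arr A \<Longrightarrow> Cod B (FA F f) = FO F (Cod A f)"
  using FA_hom[of f "Dom A f" "Cod A f"] by auto

lemma FA_split:
  "f \<in> Arr A \<Longrightarrow> g \<in> Arr A \<Longrightarrow> Cod A f = Dom A g \<Longrightarrow> FA F (g \<cdot>\<^bsub>A\<^esub> f) = FA F g \<cdot>\<^bsub>B\<^esub> FA F f"
  using FA_Comp[of f "Dom A f" "Cod A f" g "Cod A g"] by auto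

text \<open>The direction opposite to \<open>FA_split\<close>. Neither is a default rewrite rule, so
  each computation decides whether a functor is to be distributed over a composite or pulled out of
  it.\<close>

lemma merge1:
  "f \<in> Arr A \<Longrightarrow> g \<in> Arr A \<Longrightarrow> Cod A f = Dom A g \<Longrightarrow> FA F g \<cdot>\<^bsub>B\<^esub> FA F f = FA F (g \<cdot>\<^bsub>A\<^esub> f)"
  by (simp add: FA_split)

lemma merge2:
  "f \<in> Arr A \<Longrightarrow> g \<in> Arr A \<Longrightarrow> Cod A f = Dom A g \<Longrightarrow> x \<in> Arr B \<Longrightarrow> Cod B x = FO F (Dom A f) \<Longrightarrow>
    FA F g \<cdot>\<^bsub>B\<^esub> (FA F f \<cdot>\<^bsub>B\<^esub> x) = FA F (g \<cdot>\<^bsub>A\<^esub> f) \<cdot>\<^bsub>B\<^esub> x"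
  by (simp add: FA_split)

lemmas merge = merge1 merge2

end

lemma cfunctorI:
  assumes "category A" and "category B"
    and "FO F \<in> extensional (Obj A)" and "FA F \<in> extensional (Arr A)"
    and "\<And>X. X \<in> Obj A \<Longrightarrow> FO F X \<in> Obj B"
    and "\<And>f. f \<in> Arr A \<Longrightarrow> FA F f \<in> Arr B \<and> Dom B (FA F f) = FO F (Dom A f) \<and> Cod B (FA F f) = FO F (Cod A f)"
    and "\<And>X. X \<in> Obj A \<Longrightarrow> FA F (Ident A X) = Ident B (FO F X)"
    and "\<And>f g. f \<in> Arr A \<Longrightarrow> g \<in> Arr A \<Longrightarrow> Cod A f = Dom A g \<Longrightarrow>
      FA F (g \<cdot>\<^bsub>A\<^esub> f) = FA F g \<cdot>\<^bsub>B\<^esub> FA F f"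
  shows "cfunctor A B F"
  unfolding cfunctor_def cfunctor_axioms_def using assms by auto

lemma cfun_eqI:
  assumes "cfunctor A B F" and "cfunctor A B' G"
    and "\<And>X. X \<in> Obj A \<Longrightarrow> FO F X = FO G X" and "\<And>f. f \<in> Arr A \<Longrightarrow> FA F f = FA G f"
  shows "F = G"
proof -
  interpret F: cfunctor A B F by fact
  interpret G: cfunctor A B' G by fact
  have "FO F = FO G" "FA F = FA G"
    using F.FO_ext G.FO_ext F.FA_ext G.FA_ext assms(3,4) by (auto intro: extensionalityI)
  then show ?thesis by simp
qed

text \<open>Identities of a product category are rewritten to pairs of identities, after which the
  general rule \<open>FA_Id\<close> no longer matches.\<close>

lemma FA_Ident_pair:
  assumes "cfunctor (prod_cat A B) D F" and "X \<in> Obj A" and "Y \<in> Obj B"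
  shows "FA F (Ident A X, Ident B Y) = Ident D (FO F (X, Y))"
  using cfunctor.FA_Id[OF assms(1), of "(X, Y)"] assms(2,3) by simp

lemma id_fun_simps [simp]:
  "X \<in> Obj A \<Longrightarrow> FO (id_fun A) X = X" "f \<in> Arr A \<Longrightarrow> FA (id_fun A) f = f"
  by (simp_all add: id_fun_def)

lemma comp_fun_simps [simp]:
  "X \<in> Obj A \<Longrightarrow> FO (comp_fun A G F) X = FO G (FO F X)"
  "f \<in> Arr A \<Longrightarrow> FA (comp_fun A G F) f = FA G (FA F f)"
  by (simp_all add: comp_fun_def compose_def)

lemma prod_fun_simps [simp]:
  "X \<in> Obj A \<Longrightarrow> Y \<in> Obj B \<Longrightarrow> FO (prod_fun A B F G) (X, Y) = (FO F X, FO G Y)"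
  "f \<in> Arr A \<Longrightarrow> g \<in> Arr B \<Longrightarrow> FA (prod_fun A B F G) (f, g) = (FA F f, FA G g)"
  by (simp_all add: prod_fun_def)

lemma cfunctor_id_fun:
  assumes "category A"
  shows "cfunctor A A (id_fun A)"
proof -
  interpret A: category A by fact
  show ?thesis by (rule cfunctorI) (auto simp: assms, auto simp: id_fun_def)
qed

lemma cfunctor_comp_fun:
  assumes "cfunctor A B F" and "cfunctor B C G"
  shows "cfunctor A C (comp_fun A G F)"
proof -
  interpret F: cfunctor A B F by fact
  interpret G: cfunctor B C G by fact
  show ?thesis
    by (rule cfunctorI)
      (auto simp: F.A.category_axioms G.B.category_axioms F.FA_split G.FA_split, auto simp: comp_fun_def)
qed

lemma cfunctor_prod_fun:
  assumes "cfunctor A B F" and "cfunctor A' B' F'"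
  shows "cfunctor (prod_cat A A') (prod_cat B B') (prod_fun A A' F F')"
proof -
  interpret F: cfunctor A B F by fact
  interpret F': cfunctor A' B' F' by fact
  show ?thesis
    by (rule cfunctorI) (auto simp: F.A.category_axioms F.B.category_axioms F'.A.category_axioms
        F'.B.category_axioms category_prod_cat F.FA_split F'.FA_split, auto simp: prod_fun_def)
qed

lemma cfunctor_op_cat:
  assumes "cfunctor A B F"
  shows "cfunctor (op_cat A) (op_cat B) F"
proof -
  interpret F: cfunctor A B F by fact
  show ?thesis
    by (rule cfunctorI) (auto simp: F.A.category_axioms F.B.category_axioms category_op_cat
        F.FA_split F.FO_ext F.FA_ext)
qed

context nat_trans
begin

lemma Arr [simp]: "X \<in> Obj A \<Longrightarrow> \<tau> X \<in> Arr B"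
  and Dom [simp]: "X \<in> Obj A \<Longrightarrow> Dom B (\<tau> X) = FO F X"
  and Cod [simp]: "X \<in> Obj A \<Longrightarrow> Cod B (\<tau> X) = FO G X"
  using component by auto

lemma nat: "f \<in> Arr A \<Longrightarrow> \<tau> (Cod A f) \<cdot>\<^bsub>B\<^esub> FA F f = FA G f \<cdot>\<^bsub>B\<^esub> \<tau> (Dom A f)"
  using naturality[of f "Dom A f" "Cod A f"] by auto

end

lemma nat_transI:
  assumes "cfunctor A B F" and "cfunctor A B G" and "\<tau> \<in> extensional (Obj A)"
    and "\<And>X. X \<in> Obj A \<Longrightarrow> \<tau> X \<in> Arr B \<and> Dom B (\<tau> X) = FO F X \<and> Cod B (\<tau> X) = FO G X"
    and "\<And>f. f \<in> Arr A \<Longrightarrow> \<tau> (Cod A f) \<cdot>\<^bsub>B\<^esub> FA F f = FA G f \<cdot>\<^bsub>B\<^esub> \<tau> (Dom A f)"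
  shows "nat_trans A B F G \<tau>"
  unfolding nat_trans_def nat_trans_axioms_def using assms by auto

lemma id_trans_simp [simp]: "X \<in> Obj A \<Longrightarrow> id_trans A B F X = Ident B (FO F X)"
  by (simp add: id_trans_def)

lemma nat_trans_id_trans:
  assumes "cfunctor A B F"
  shows "nat_trans A B F F (id_trans A B F)"
proof -
  interpret F: cfunctor A B F by fact
  show ?thesis by (rule nat_transI) (auto simp: assms, auto simp: id_trans_def)
qed

text \<open>Inverses of the components of a natural transformation form a natural transformation:
  insert the transformation after its inverse, slide it through the naturality square and cancel.
  Invertibility can hence be tested object by object.\<close>

lemma invertible_trans_iff:
  "invertible_trans A B F G \<tau> \<longleftrightarrow> nat_trans A B F G \<tau> \<and>
    (\<forall>X\<in>Obj A. \<exists>g\<in>hom B (FO G X) (FO F X). g \<cdot>\<^bsub>B\<^esub> \<tau> X = Ident B (FO F X) \<and> \<tau> X \<cdot>\<^bsub>B\<^esub> g = Ident B (FO G X))"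
    (is "_ \<longleftrightarrow> _ \<and> (\<forall>X\<in>_. \<exists>g\<in>_. ?inv X g)")
proof
  assume "invertible_trans A B F G \<tau>"
  then obtain \<sigma> where \<sigma>: "inverse_trans A B F G \<tau> \<sigma>" by (auto simp: invertible_trans_def)
  then interpret \<sigma>: nat_trans A B G F \<sigma> by (simp add: inverse_trans_def)
  have "\<sigma> X \<in> hom B (FO G X) (FO F X)" if "X \<in> Obj A" for X
    using that by simp
  with \<sigma> show "nat_trans A B F G \<tau> \<and> (\<forall>X\<in>Obj A. \<exists>g\<in>hom B (FO G X) (FO F X). ?inv X g)"
    unfolding inverse_trans_def by blast
next
  assume asm: "nat_trans A B F G \<tau> \<and> (\<forall>X\<in>Obj A. \<exists>g\<in>hom B (FO G X) (FO F X). ?inv X g)"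
  then interpret \<tau>: nat_trans A B F G \<tau> by simp
  from asm obtain \<sigma>0 where \<sigma>0: "\<And>X. X \<in> Obj A \<Longrightarrow> \<sigma>0 X \<in> hom B (FO G X) (FO F X) \<and> ?inv X (\<sigma>0 X)"
    by metis
  \<comment> \<open>The choice controls values on objects only; the restriction supplies the default
    value elsewhere that extensionality requires.\<close>
  define \<sigma> where "\<sigma> = restrict \<sigma>0 (Obj A)"
  have \<sigma>: "\<sigma> X \<in> Arr B" "Dom B (\<sigma> X) = FO G X" "Cod B (\<sigma> X) = FO F X"
    "\<sigma> X \<cdot>\<^bsub>B\<^esub> \<tau> X = Ident B (FO F X)" "\<tau> X \<cdot>\<^bsub>B\<^esub> \<sigma> X = Ident B (FO G X)" if "X \<in> Obj A" for X
    using \<sigma>0[OF that] that by (auto simp: \<sigma>_def)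
  have "nat_trans A B G F \<sigma>"
  proof (rule nat_transI)
    fix f assume f: "f \<in> Arr A"
    note [simp] = f \<sigma>
    have "\<sigma> (Cod A f) \<cdot>\<^bsub>B\<^esub> FA G f = \<sigma> (Cod A f) \<cdot>\<^bsub>B\<^esub> FA G f \<cdot>\<^bsub>B\<^esub> \<tau> (Dom A f) \<cdot>\<^bsub>B\<^esub> \<sigma> (Dom A f)"
      by simp
    also have "\<dots> = \<sigma> (Cod A f) \<cdot>\<^bsub>B\<^esub> (FA G f \<cdot>\<^bsub>B\<^esub> \<tau> (Dom A f)) \<cdot>\<^bsub>B\<^esub> \<sigma> (Dom A f)"
      by simp
    also have "\<dots> = \<sigma> (Cod A f) \<cdot>\<^bsub>B\<^esub> \<tau> (Cod A f) \<cdot>\<^bsub>B\<^esub> FA F f \<cdot>\<^bsub>B\<^esub> \<sigma> (Dom A f)"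
      unfolding \<tau>.nat[OF f, symmetric] by (simp del: \<sigma>(4))
    also have "\<dots> = FA F f \<cdot>\<^bsub>B\<^esub> \<sigma> (Dom A f)"
      by simp
    finally show "\<sigma> (Cod A f) \<cdot>\<^bsub>B\<^esub> FA G f = FA F f \<cdot>\<^bsub>B\<^esub> \<sigma> (Dom A f)" .
  qed (auto simp: \<sigma> \<tau>.F.cfunctor_axioms \<tau>.G.cfunctor_axioms, simp add: \<sigma>_def)
  with asm show "invertible_trans A B F G \<tau>"
    using \<sigma> by (auto simp: invertible_trans_def inverse_trans_def)
qed

text \<open>\<open>inv_trans\<close> is a definite description, so the inverse must be unique as a
  HOL function: on objects by cancellation, off them by extensionality.\<close>

lemma inverse_trans_inv_trans:
  assumes "invertible_trans A B F G \<tau>"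
  shows "inverse_trans A B F G \<tau> (inv_trans A B F G \<tau>)"
proof -
  have "\<sigma> = \<sigma>'" if \<sigma>: "inverse_trans A B F G \<tau> \<sigma>" and \<sigma>': "inverse_trans A B F G \<tau> \<sigma>'" for \<sigma> \<sigma>'
  proof -
    interpret \<tau>: nat_trans A B F G \<tau> using \<sigma> by (simp add: inverse_trans_def)
    interpret \<sigma>: nat_trans A B G F \<sigma> using \<sigma> by (simp add: inverse_trans_def)
    interpret \<sigma>': nat_trans A B G F \<sigma>' using \<sigma>' by (simp add: inverse_trans_def)
    show ?thesis
    proof (rule extensionalityI[OF \<sigma>.ext \<sigma>'.ext])
      fix X assume X: "X \<in> Obj A"
      have eqs: "\<sigma> X \<cdot>\<^bsub>B\<^esub> \<tau> X = Ident B (FO F X)" "\<tau> X \<cdot>\<^bsub>B\<^esub> \<sigma>' X = Ident B (FO G X)"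
        using \<sigma> \<sigma>' X by (simp_all add: inverse_trans_def)
      have "(\<sigma> X \<cdot>\<^bsub>B\<^esub> \<tau> X) \<cdot>\<^bsub>B\<^esub> \<sigma>' X = \<sigma> X \<cdot>\<^bsub>B\<^esub> (\<tau> X \<cdot>\<^bsub>B\<^esub> \<sigma>' X)"
        using X by simp
      then show "\<sigma> X = \<sigma>' X" unfolding eqs using X by simp
    qed
  qed
  then show ?thesis
    unfolding inv_trans_def using assms theI[of "inverse_trans A B F G \<tau>"]
    by (metis invertible_trans_def)
qed

section \<open>Adjunctions and Eilenberg--Moore categories\<close>

sublocale adjunction \<subseteq> L: cfunctor C X "LeftF A" by (rule left_fun)
sublocale adjunction \<subseteq> R: cfunctor X C "RightF A" by (rule right_fun)

context adjunction
begin

lemma unit_Arr [simp]: "c \<in> Obj C \<Longrightarrow> Unit A c \<in> Arr C"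
  and Dom_unit [simp]: "c \<in> Obj C \<Longrightarrow> Dom C (Unit A c) = c"
  and Cod_unit [simp]: "c \<in> Obj C \<Longrightarrow> Cod C (Unit A c) = FO (RightF A) (FO (LeftF A) c)"
  using nat_trans.component[OF unit_trans, of c] by auto

lemma counit_Arr [simp]: "x \<in> Obj X \<Longrightarrow> Counit A x \<in> Arr X"
  and Dom_counit [simp]: "x \<in> Obj X \<Longrightarrow> Dom X (Counit A x) = FO (LeftF A) (FO (RightF A) x)"
  and Cod_counit [simp]: "x \<in> Obj X \<Longrightarrow> Cod X (Counit A x) = x"
  using nat_trans.component[OF counit_trans, of x] by auto

lemma unit_nat:
  "f \<in> Arr C \<Longrightarrow> Cod C f = c \<Longrightarrow>
    FA (RightF A) (FA (LeftF A) f) \<cdot>\<^bsub>C\<^esub> Unit A (Dom C f) = Unit A c \<cdot>\<^bsub>C\<^esub> f"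
  using nat_trans.nat[OF unit_trans, of f] by auto

lemma counit_nat:
  "f \<in> Arr X \<Longrightarrow> Cod X f = x \<Longrightarrow>
    Counit A x \<cdot>\<^bsub>X\<^esub> FA (LeftF A) (FA (RightF A) f) = f \<cdot>\<^bsub>X\<^esub> Counit A (Dom X f)"
  using nat_trans.nat[OF counit_trans, of f] by auto

lemma unit_ext: "Unit A \<in> extensional (Obj C)"
  and counit_ext: "Counit A \<in> extensional (Obj X)"
  using unit_trans counit_trans by (simp_all add: nat_trans_def nat_trans_axioms_def)

text \<open>Naturality of the unit moves it in front of f, where a triangle identity removes it
  together with the counit.\<close>

lemma transpose_inverse:
  assumes "f \<in> Arr C" and "x \<in> Obj X" and "Cod C f = FO (RightF A) x"
  shows "FA (RightF A) (Counit A x \<cdot>\<^bsub>X\<^esub> FA (LeftF A) f) \<cdot>\<^bsub>C\<^esub> Unit A (Dom C f) = f"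
  using assms unit_nat[of f "FO (RightF A) x"] L.A.precomp[OF triangle_right[of x], of f]
  by (simp add: R.FA_split)

text \<open>The working tool for the right adjoint: an equation between arrows into R x is tested
  after applying L and the counit, where the laws of the left adjoint are available.\<close>

lemma transpose_inj:
  assumes "f \<in> Arr C" and "g \<in> Arr C" and "x \<in> Obj X" and "Cod C f = FO (RightF A) x"
    and "Cod C g = FO (RightF A) x" and "Dom C f = Dom C g"
    and "Counit A x \<cdot>\<^bsub>X\<^esub> FA (LeftF A) f = Counit A x \<cdot>\<^bsub>X\<^esub> FA (LeftF A) g"
  shows "f = g"
  using transpose_inverse[of f x] transpose_inverse[of g x] assms by metis

lemma transpose_right:
  assumes "g \<in> Arr X" and "c \<in> Obj C" and "Dom X g = FO (LeftF A) c"
  shows "Counit A (Cod X g) \<cdot>\<^bsub>X\<^esub> FA (LeftF A) (FA (RightF A) g \<cdot>\<^bsub>C\<^esub> Unit A c) = g"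
  using assms L.B.precomp[OF counit_nat[of g "Cod X g"], of "FA (LeftF A) (Unit A c)"] triangle_left[of c]
  by (simp add: L.FA_split)

end

lemma adjunctionI:
  assumes "cfunctor C X (LeftF A)" and "cfunctor X C (RightF A)"
    and "Unit A \<in> extensional (Obj C)" and "Counit A \<in> extensional (Obj X)"
    and "\<And>c. c \<in> Obj C \<Longrightarrow> Unit A c \<in> Arr C \<and> Dom C (Unit A c) = c \<and>
      Cod C (Unit A c) = FO (RightF A) (FO (LeftF A) c)"
    and "\<And>x. x \<in> Obj X \<Longrightarrow> Counit A x \<in> Arr X \<and>
      Dom X (Counit A x) = FO (LeftF A) (FO (RightF A) x) \<and> Cod X (Counit A x) = x"
    and "\<And>f. f \<in> Arr C \<Longrightarrow>
      Unit A (Cod C f) \<cdot>\<^bsub>C\<^esub> f = FA (RightF A) (FA (LeftF A) f) \<cdot>\<^bsub>C\<^esub> Unit A (Dom C f)"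
    and "\<And>f. f \<in> Arr X \<Longrightarrow>
      Counit A (Cod X f) \<cdot>\<^bsub>X\<^esub> FA (LeftF A) (FA (RightF A) f) = f \<cdot>\<^bsub>X\<^esub> Counit A (Dom X f)"
    and "\<And>c. c \<in> Obj C \<Longrightarrow>
      Counit A (FO (LeftF A) c) \<cdot>\<^bsub>X\<^esub> FA (LeftF A) (Unit A c) = Ident X (FO (LeftF A) c)"
    and "\<And>x. x \<in> Obj X \<Longrightarrow>
      FA (RightF A) (Counit A x) \<cdot>\<^bsub>C\<^esub> Unit A (FO (RightF A) x) = Ident C (FO (RightF A) x)"
  shows "adjunction C X A"
proof -
  interpret L: cfunctor C X "LeftF A" by fact
  interpret R: cfunctor X C "RightF A" by fact
  show ?thesis
  proof (rule adjunction.intro)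
    show "nat_trans C C (id_fun C) (comp_fun C (RightF A) (LeftF A)) (Unit A)"
      by (rule nat_transI) (use assms in \<open>auto intro: cfunctor_id_fun cfunctor_comp_fun L.A.category_axioms\<close>)
    show "nat_trans X X (comp_fun X (LeftF A) (RightF A)) (id_fun X) (Counit A)"
      by (rule nat_transI) (use assms in \<open>auto intro: cfunctor_id_fun cfunctor_comp_fun L.B.category_axioms\<close>)
  qed (use assms in auto)
qed

lemma prod_adj_simps [simp]:
  "LeftF (prod_adj C X A C' X' A') = prod_fun C C' (LeftF A) (LeftF A')"
  "RightF (prod_adj C X A C' X' A') = prod_fun X X' (RightF A) (RightF A')"
  "x \<in> Obj X \<Longrightarrow> x' \<in> Obj X' \<Longrightarrow> Counit (prod_adj C X A C' X' A') (x, x') = (Counit A x, Counit A' x')"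
  by (simp_all add: prod_adj_def)

lemma adjunction_prod_adj:
  assumes "adjunction C X A" and "adjunction C' X' A'"
  shows "adjunction (prod_cat C C') (prod_cat X X') (prod_adj C X A C' X' A')"
proof -
  interpret A: adjunction C X A by fact
  interpret A': adjunction C' X' A' by fact
  show ?thesis
    by (rule adjunctionI)
      (auto simp: prod_adj_def A.unit_nat A'.unit_nat A.counit_nat A'.counit_nat A.triangle_left
        A'.triangle_left A.triangle_right A'.triangle_right
        intro!: cfunctor_prod_fun A.left_fun A'.left_fun A.right_fun A'.right_fun)
qed

section \<open>Monads and their Eilenberg-Moore adjunctions\<close>

context monad
begin

sublocale S: cfunctor C C "MF S"
  using eta_trans by (simp add: nat_trans_def)

lemma mult_Arr [simp]: "X \<in> Obj C \<Longrightarrow> Mult S X \<in> Arr C"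
  and Dom_mult [simp]: "X \<in> Obj C \<Longrightarrow> Dom C (Mult S X) = FO (MF S) (FO (MF S) X)"
  and Cod_mult [simp]: "X \<in> Obj C \<Longrightarrow> Cod C (Mult S X) = FO (MF S) X"
  using nat_trans.component[OF mult_trans, of X] by auto

lemma eta_Arr [simp]: "X \<in> Obj C \<Longrightarrow> Eta S X \<in> Arr C"
  and Dom_eta [simp]: "X \<in> Obj C \<Longrightarrow> Dom C (Eta S X) = X"
  and Cod_eta [simp]: "X \<in> Obj C \<Longrightarrow> Cod C (Eta S X) = FO (MF S) X"
  using nat_trans.component[OF eta_trans, of X] by auto

lemma mult_nat:
  "f \<in> Arr C \<Longrightarrow> Cod C f = X \<Longrightarrow>
    Mult S X \<cdot>\<^bsub>C\<^esub> FA (MF S) (FA (MF S) f) = FA (MF S) f \<cdot>\<^bsub>C\<^esub> Mult S (Dom C f)"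
  using nat_trans.nat[OF mult_trans, of f] by auto

lemma eta_nat:
  "f \<in> Arr C \<Longrightarrow> Cod C f = X \<Longrightarrow> Eta S X \<cdot>\<^bsub>C\<^esub> f = FA (MF S) f \<cdot>\<^bsub>C\<^esub> Eta S (Dom C f)"
  using nat_trans.nat[OF eta_trans, of f] by auto

lemma eta_ext: "Eta S \<in> extensional (Obj C)"
  using eta_trans by (simp add: nat_trans_def nat_trans_axioms_def)

end

lemma monadI:
  assumes "cfunctor C C (MF S)"
    and "Mult S \<in> extensional (Obj C)" and "Eta S \<in> extensional (Obj C)"
    and "\<And>X. X \<in> Obj C \<Longrightarrow> Mult S X \<in> Arr C \<and>
      Dom C (Mult S X) = FO (MF S) (FO (MF S) X) \<and> Cod C (Mult S X) = FO (MF S) X"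
    and "\<And>X. X \<in> Obj C \<Longrightarrow> Eta S X \<in> Arr C \<and> Dom C (Eta S X) = X \<and> Cod C (Eta S X) = FO (MF S) X"
    and "\<And>f. f \<in> Arr C \<Longrightarrow>
      Mult S (Cod C f) \<cdot>\<^bsub>C\<^esub> FA (MF S) (FA (MF S) f) = FA (MF S) f \<cdot>\<^bsub>C\<^esub> Mult S (Dom C f)"
    and "\<And>f. f \<in> Arr C \<Longrightarrow> Eta S (Cod C f) \<cdot>\<^bsub>C\<^esub> f = FA (MF S) f \<cdot>\<^bsub>C\<^esub> Eta S (Dom C f)"
    and "\<And>X. X \<in> Obj C \<Longrightarrow> Mult S X \<cdot>\<^bsub>C\<^esub> Mult S (FO (MF S) X) = Mult S X \<cdot>\<^bsub>C\<^esub> FA (MF S) (Mult S X)"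
    and "\<And>X. X \<in> Obj C \<Longrightarrow> Mult S X \<cdot>\<^bsub>C\<^esub> Eta S (FO (MF S) X) = Ident C (FO (MF S) X)"
    and "\<And>X. X \<in> Obj C \<Longrightarrow> Mult S X \<cdot>\<^bsub>C\<^esub> FA (MF S) (Eta S X) = Ident C (FO (MF S) X)"
  shows "monad C S"
proof -
  interpret S: cfunctor C C "MF S" by fact
  show ?thesis
  proof (intro monad.intro monad_axioms.intro S.A.category_axioms)
    show "nat_trans C C (comp_fun C (MF S) (MF S)) (MF S) (Mult S)"
      by (rule nat_transI) (use assms in \<open>auto intro: cfunctor_comp_fun\<close>)
    show "nat_trans C C (id_fun C) (MF S) (Eta S)"
      by (rule nat_transI) (use assms in \<open>auto intro: cfunctor_id_fun S.A.category_axioms\<close>)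
  qed (use assms in auto)
qed

lemma id_mnd_simps [simp]:
  "MF (id_mnd C) = id_fun C"
  "X \<in> Obj C \<Longrightarrow> Mult (id_mnd C) X = Ident C X"
  "X \<in> Obj C \<Longrightarrow> Eta (id_mnd C) X = Ident C X"
  by (simp_all add: id_mnd_def)

lemma prod_mnd_simps [simp]:
  "MF (prod_mnd C P S E) = prod_fun C P (MF S) (MF E)"
  "X \<in> Obj C \<Longrightarrow> Y \<in> Obj P \<Longrightarrow> Mult (prod_mnd C P S E) (X, Y) = (Mult S X, Mult E Y)"
  "X \<in> Obj C \<Longrightarrow> Y \<in> Obj P \<Longrightarrow> Eta (prod_mnd C P S E) (X, Y) = (Eta S X, Eta E Y)"
  by (simp_all add: prod_mnd_def)

lemma monad_id_mnd:
  assumes "category C"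
  shows "monad C (id_mnd C)"
proof -
  interpret category C by fact
  show ?thesis
    by (rule monadI) (auto intro: cfunctor_id_fun assms, auto simp: id_mnd_def id_trans_def)
qed

lemma monad_prod_mnd:
  assumes "monad C S" and "monad P E"
  shows "monad (prod_cat C P) (prod_mnd C P S E)"
proof -
  interpret S: monad C S by fact
  interpret E: monad P E by fact
  show ?thesis
    by (rule monadI) (auto simp: S.mult_nat S.eta_nat E.mult_nat E.eta_nat S.mult_assoc S.eta_left
      S.eta_right E.mult_assoc E.eta_left E.eta_right 
      intro: cfunctor_prod_fun S.S.cfunctor_axioms E.S.cfunctor_axioms, auto simp: prod_mnd_def)
qed

lemma EM_Obj_iff:
  "(M, k) \<in> EM_Obj C S \<longleftrightarrow> M \<in> Obj C \<and> k \<in> Arr C \<and> Dom C k = FO (MF S) M \<and> Cod C k = M \<and>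
     k \<cdot>\<^bsub>C\<^esub> Mult S M = k \<cdot>\<^bsub>C\<^esub> FA (MF S) k \<and> k \<cdot>\<^bsub>C\<^esub> Eta S M = Ident C M"
  by (auto simp: EM_Obj_def)

lemma EM_Arr_iff:
  "(x, y, f) \<in> EM_Arr C S \<longleftrightarrow> x \<in> EM_Obj C S \<and> y \<in> EM_Obj C S \<and> f \<in> Arr C \<and>
     Dom C f = fst x \<and> Cod C f = fst y \<and> f \<cdot>\<^bsub>C\<^esub> snd x = snd y \<cdot>\<^bsub>C\<^esub> FA (MF S) f"
  by (cases x; cases y) (auto simp: EM_Arr_def)

lemma EM_simps [simp]:
  "Obj (EM C S) = EM_Obj C S" "Arr (EM C S) = EM_Arr C S"
  "Dom (EM C S) (x, y, f) = x" "Cod (EM C S) (x, y, f) = y"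
  "Ident (EM C S) x = (x, x, Ident C (fst x))"
  "(y, z, g) \<cdot>\<^bsub>EM C S\<^esub> (x, y', f) = (x, z, g \<cdot>\<^bsub>C\<^esub> f)"
  by (simp_all add: EM_def)

lemma EM_forget_simps [simp]:
  "x \<in> EM_Obj C S \<Longrightarrow> FO (EM_forget C S) x = fst x"
  "(x, y, f) \<in> EM_Arr C S \<Longrightarrow> FA (EM_forget C S) (x, y, f) = f"
  by (simp_all add: EM_forget_def)

lemma EM_free_simps [simp]:
  "X \<in> Obj C \<Longrightarrow> FO (EM_free C S) X = (FO (MF S) X, Mult S X)"
  "f \<in> Arr C \<Longrightarrow> FA (EM_free C S) f = ((FO (MF S) (Dom C f), Mult S (Dom C f)),
     (FO (MF S) (Cod C f), Mult S (Cod C f)), FA (MF S) f)"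
  by (simp_all add: EM_free_def)

context monad
begin

lemma EM_Comp_Arr:
  assumes "(x, y, f) \<in> EM_Arr C S" and "(y, z, g) \<in> EM_Arr C S"
  shows "(x, z, g \<cdot>\<^bsub>C\<^esub> f) \<in> EM_Arr C S"
proof (cases x; cases y; cases z)
  fix M k N l O' m assume [simp]: "x = (M, k)" "y = (N, l)" "z = (O', m)"
  have gl: "g \<cdot>\<^bsub>C\<^esub> l = m \<cdot>\<^bsub>C\<^esub> FA (MF S) g" using assms by (simp add: EM_Arr_iff)
  show ?thesis
    using assms C.precomp[OF gl, of "FA (MF S) f"] by (auto simp: EM_Arr_iff EM_Obj_iff S.FA_split)
qed

lemma category_EM: "category (EM C S)"
  by (rule categoryI) (auto intro: EM_Comp_Arr, auto simp: EM_Arr_iff EM_Obj_iff)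

sublocale EM: category "EM C S" by (rule category_EM)

lemma cfunctor_EM_forget: "cfunctor (EM C S) C (EM_forget C S)"
  by (rule cfunctorI)
    (auto simp: C.category_axioms category_EM EM_Comp_Arr, auto simp: EM_forget_def EM_Arr_iff EM_Obj_iff)

lemma free_EM_Obj [simp]: "X \<in> Obj C \<Longrightarrow> (FO (MF S) X, Mult S X) \<in> EM_Obj C S"
  by (simp add: EM_Obj_iff mult_assoc eta_left)

lemma cfunctor_EM_free: "cfunctor C (EM C S) (EM_free C S)"
  by (rule cfunctorI)
    (auto simp: C.category_axioms category_EM EM_Arr_iff mult_nat S.FA_split, auto simp: EM_free_def)

lemma EM_Ident_Arr [simp]: "(M, k) \<in> EM_Obj C S \<Longrightarrow> ((M, k), (M, k), Ident C M) \<in> EM_Arr C S"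
  using EM.Ident_Arr[of "(M, k)"] by simp

lemma free_EM_Arr [simp]:
  "f \<in> Arr C \<Longrightarrow> Dom C f = X \<Longrightarrow> Cod C f = Y \<Longrightarrow>
    ((FO (MF S) X, Mult S X), (FO (MF S) Y, Mult S Y), FA (MF S) f) \<in> EM_Arr C S"
  by (auto simp: EM_Arr_iff mult_nat)

lemma free_EM_Ident_Arr [simp]:
  "X \<in> Obj C \<Longrightarrow> ((FO (MF S) X, Mult S X), (FO (MF S) X, Mult S X), Ident C (FO (MF S) X)) \<in> EM_Arr C S"
  by simp

text \<open>The associativity law of an algebra is the homomorphism square of its structure map,
  taken as an arrow out of the free algebra.\<close>

lemma counit_EM_Arr: "(M, k) \<in> EM_Obj C S \<Longrightarrow> ((FO (MF S) M, Mult S M), (M, k), k) \<in> EM_Arr C S"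
  by (auto simp: EM_Arr_iff) (auto simp: EM_Obj_iff mult_assoc eta_left)

lemma adjunction_EM_adj: "adjunction C (EM C S) (EM_adj C S)"
proof -
  have [simp]: "M \<in> Obj C" "k \<in> Arr C" "Dom C k = FO (MF S) M" "Cod C k = M"
    "k \<cdot>\<^bsub>C\<^esub> Eta S M = Ident C M" if "(M, k) \<in> EM_Obj C S" for M k
    using that by (simp_all add: EM_Obj_iff)
  show ?thesis
    by (rule adjunctionI)
      (auto simp: cfunctor_EM_free cfunctor_EM_forget EM_adj_def eta_ext counit_EM_Arr eta_nat eta_right,
       auto simp: EM_Arr_iff)
qed

end

lemma EM_adj_simps [simp]:
  "LeftF (EM_adj C S) = EM_free C S" "RightF (EM_adj C S) = EM_forget C S" "Unit (EM_adj C S) = Eta S"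
  "(M, k) \<in> EM_Obj C S \<Longrightarrow> Counit (EM_adj C S) (M, k) = ((FO (MF S) M, Mult S M), (M, k), k)"
  by (simp_all add: EM_adj_def)

text \<open>The forgetful functor reflects isomorphisms: insert T f after T g, replace l o T f by f
  o k, and cancel g against f.\<close>

lemma EM_inverse_Arr:
  assumes "monad D T" and "(x, y, f) \<in> EM_Arr D T" and "g \<in> hom D (fst y) (fst x)"
    and "g \<cdot>\<^bsub>D\<^esub> f = Ident D (fst x)" and "f \<cdot>\<^bsub>D\<^esub> g = Ident D (fst y)"
  shows "(y, x, g) \<in> EM_Arr D T"
proof (cases x; cases y)
  fix M k N l assume [simp]: "x = (M, k)" "y = (N, l)"
  interpret T: monad D T by fact
  have [simp]: "f \<in> Arr D" "Dom D f = M" "Cod D f = N" "g \<in> Arr D" "Dom D g = N" "Cod D g = M"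
    and f: "f \<cdot>\<^bsub>D\<^esub> k = l \<cdot>\<^bsub>D\<^esub> FA (MF T) f" and obj: "(M, k) \<in> EM_Obj D T" "(N, l) \<in> EM_Obj D T"
    using assms by (auto simp: EM_Arr_iff)
  have [simp]: "M \<in> Obj D" "k \<in> Arr D" "Dom D k = FO (MF T) M" "Cod D k = M"
    "N \<in> Obj D" "l \<in> Arr D" "Dom D l = FO (MF T) N" "Cod D l = N"
    using obj by (simp_all add: EM_Obj_iff)
  have gf: "g \<cdot>\<^bsub>D\<^esub> f = Ident D M" "f \<cdot>\<^bsub>D\<^esub> g = Ident D N" using assms by simp_all
  have "g \<cdot>\<^bsub>D\<^esub> l = g \<cdot>\<^bsub>D\<^esub> ((l \<cdot>\<^bsub>D\<^esub> FA (MF T) f) \<cdot>\<^bsub>D\<^esub> FA (MF T) g)"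
    by (simp add: T.S.merge gf)
  also have "\<dots> = (g \<cdot>\<^bsub>D\<^esub> f) \<cdot>\<^bsub>D\<^esub> (k \<cdot>\<^bsub>D\<^esub> FA (MF T) g)"
    unfolding f[symmetric] by simp
  finally have "g \<cdot>\<^bsub>D\<^esub> l = k \<cdot>\<^bsub>D\<^esub> FA (MF T) g"
    by (simp add: gf)
  then show ?thesis using obj by (simp add: EM_Arr_iff)
qed

text \<open>Arrows carry their two algebras, so the forgetful functor separates them only between
  fixed endpoints. Units and counits of two liftings are compared in this way.\<close>

lemma EM_arr_eqI:
  assumes "monad A M" and "f \<in> EM_Arr A M" and "g \<in> EM_Arr A M" and "Dom (EM A M) f = Dom (EM A M) g"
    and "Cod (EM A M) f = Cod (EM A M) g" and "FA (EM_forget A M) f = FA (EM_forget A M) g"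
  shows "f = g"
  using assms(2-6) by (cases f; cases g) auto

lemma EM_Obj_fst: "x \<in> EM_Obj C S \<Longrightarrow> fst x \<in> Obj C"
  by (cases x) (simp add: EM_Obj_iff)

lemma EM_Ident_fst_Arr: "monad C S \<Longrightarrow> x \<in> EM_Obj C S \<Longrightarrow> (x, x, Ident C (fst x)) \<in> EM_Arr C S"
  using monad.EM_Ident_Arr[of C S "fst x" "snd x"] by simp

section \<open>Adjoint objects from invertible 1-cells\<close>

locale mnd_cell =
  fixes C :: "('o, 'a) category" and S :: "('o, 'a) mnd"
    and D :: "('p, 'b) category" and T :: "('p, 'b) mnd"
    and B :: "('o, 'a, 'p, 'b) cfun" and \<psi> :: "'o \<Rightarrow> 'b"
  assumes cell: "mnd_1cell C S D T (B, \<psi>)"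

sublocale mnd_cell \<subseteq> S: monad C S using cell by (simp add: mnd_1cell_def)
sublocale mnd_cell \<subseteq> T: monad D T using cell by (simp add: mnd_1cell_def)
sublocale mnd_cell \<subseteq> B: cfunctor C D B using cell by (simp add: mnd_1cell_def)

context mnd_cell
begin

lemma psi_trans: "nat_trans C D (comp_fun C (MF T) B) (comp_fun C B (MF S)) \<psi>"
  using cell by (simp add: mnd_1cell_def)

lemma psi_Arr [simp]: "X \<in> Obj C \<Longrightarrow> \<psi> X \<in> Arr D"
  and Dom_psi [simp]: "X \<in> Obj C \<Longrightarrow> Dom D (\<psi> X) = FO (MF T) (FO B X)"
  and Cod_psi [simp]: "X \<in> Obj C \<Longrightarrow> Cod D (\<psi> X) = FO B (FO (MF S) X)"
  using nat_trans.component[OF psi_trans, of X] by auto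

lemma psi_nat:
  "f \<in> Arr C \<Longrightarrow> Cod C f = X \<Longrightarrow>
    \<psi> X \<cdot>\<^bsub>D\<^esub> FA (MF T) (FA B f) = FA B (FA (MF S) f) \<cdot>\<^bsub>D\<^esub> \<psi> (Dom C f)"
  using nat_trans.nat[OF psi_trans, of f] by auto

lemma psi_mult:
  "X \<in> Obj C \<Longrightarrow> \<psi> X \<cdot>\<^bsub>D\<^esub> Mult T (FO B X)
    = FA B (Mult S X) \<cdot>\<^bsub>D\<^esub> (\<psi> (FO (MF S) X) \<cdot>\<^bsub>D\<^esub> FA (MF T) (\<psi> X))"
  using cell by (auto simp: mnd_1cell_def)

lemma psi_eta: "X \<in> Obj C \<Longrightarrow> \<psi> X \<cdot>\<^bsub>D\<^esub> Eta T (FO B X) = FA B (Eta S X)"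
  using cell by (auto simp: mnd_1cell_def)

lemma psi_ext: "\<psi> \<in> extensional (Obj C)"
  using psi_trans by (simp add: nat_trans_def nat_trans_axioms_def)

text \<open>A 1-cell transports algebras. Associativity combines the multiplication law of
  \<open>\<psi>\<close> with its naturality at the structure map k; the unit law comes from that of
  \<open>\<psi>\<close>.\<close>

lemma alg_EM_Obj:
  assumes "(M, k) \<in> EM_Obj C S"
  shows "(FO B M, FA B k \<cdot>\<^bsub>D\<^esub> \<psi> M) \<in> EM_Obj D T"
proof -
  have [simp]: "M \<in> Obj C" "k \<in> Arr C" "Dom C k = FO (MF S) M" "Cod C k = M"
    and k: "k \<cdot>\<^bsub>C\<^esub> Mult S M = k \<cdot>\<^bsub>C\<^esub> FA (MF S) k" "k \<cdot>\<^bsub>C\<^esub> Eta S M = Ident C M"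
    using assms by (simp_all add: EM_Obj_iff)
  have "FA B k \<cdot>\<^bsub>D\<^esub> (\<psi> M \<cdot>\<^bsub>D\<^esub> Mult T (FO B M))
      = FA B (k \<cdot>\<^bsub>C\<^esub> Mult S M) \<cdot>\<^bsub>D\<^esub> (\<psi> (FO (MF S) M) \<cdot>\<^bsub>D\<^esub> FA (MF T) (\<psi> M))"
    by (simp add: psi_mult B.FA_split)
  also have "\<dots> = FA B k \<cdot>\<^bsub>D\<^esub> ((FA B (FA (MF S) k) \<cdot>\<^bsub>D\<^esub> \<psi> (FO (MF S) M)) \<cdot>\<^bsub>D\<^esub> FA (MF T) (\<psi> M))"
    unfolding k by (simp add: B.FA_split)
  also have "\<dots> = FA B k \<cdot>\<^bsub>D\<^esub> (\<psi> M \<cdot>\<^bsub>D\<^esub> FA (MF T) (FA B k \<cdot>\<^bsub>D\<^esub> \<psi> M))"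
    using psi_nat[of k M] by (simp add: T.S.FA_split T.C.precomp[OF psi_nat[of k M]])
  finally have 1: "FA B k \<cdot>\<^bsub>D\<^esub> (\<psi> M \<cdot>\<^bsub>D\<^esub> Mult T (FO B M)) = \<dots>" .
  have 2: "FA B k \<cdot>\<^bsub>D\<^esub> (\<psi> M \<cdot>\<^bsub>D\<^esub> Eta T (FO B M)) = Ident D (FO B M)"
    using k by (simp add: psi_eta B.merge)
  show ?thesis using 1 2 by (simp add: EM_Obj_iff)
qed

lemma alg_EM_Arr:
  assumes "((M, k), (N, l), f) \<in> EM_Arr C S"
  shows "((FO B M, FA B k \<cdot>\<^bsub>D\<^esub> \<psi> M), (FO B N, FA B l \<cdot>\<^bsub>D\<^esub> \<psi> N), FA B f) \<in> EM_Arr D T"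
proof -
  have M: "(M, k) \<in> EM_Obj C S" and N: "(N, l) \<in> EM_Obj C S"
    and [simp]: "f \<in> Arr C" "Dom C f = M" "Cod C f = N"
    and f: "f \<cdot>\<^bsub>C\<^esub> k = l \<cdot>\<^bsub>C\<^esub> FA (MF S) f"
    using assms by (simp_all add: EM_Arr_iff)
  have [simp]: "M \<in> Obj C" "k \<in> Arr C" "Dom C k = FO (MF S) M" "Cod C k = M"
    "N \<in> Obj C" "l \<in> Arr C" "Dom C l = FO (MF S) N" "Cod C l = N"
    using M N by (simp_all add: EM_Obj_iff)
  have "FA B f \<cdot>\<^bsub>D\<^esub> (FA B k \<cdot>\<^bsub>D\<^esub> \<psi> M) = FA B l \<cdot>\<^bsub>D\<^esub> (FA B (FA (MF S) f) \<cdot>\<^bsub>D\<^esub> \<psi> M)"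
    by (simp add: B.merge f)
  also have "\<dots> = FA B l \<cdot>\<^bsub>D\<^esub> (\<psi> N \<cdot>\<^bsub>D\<^esub> FA (MF T) (FA B f))"
    by (simp add: psi_nat)
  finally show ?thesis using alg_EM_Obj[OF M] alg_EM_Obj[OF N] by (simp add: EM_Arr_iff)
qed

end

lemma mnd_1cellI:
  assumes "monad C S" and "monad D T" and "cfunctor C D B" and "\<psi> \<in> extensional (Obj C)"
    and "\<And>X. X \<in> Obj C \<Longrightarrow> \<psi> X \<in> Arr D \<and> Dom D (\<psi> X) = FO (MF T) (FO B X) \<and>
      Cod D (\<psi> X) = FO B (FO (MF S) X)"
    and "\<And>f. f \<in> Arr C \<Longrightarrow>
      \<psi> (Cod C f) \<cdot>\<^bsub>D\<^esub> FA (MF T) (FA B f) = FA B (FA (MF S) f) \<cdot>\<^bsub>D\<^esub> \<psi> (Dom C f)"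
    and "\<And>X. X \<in> Obj C \<Longrightarrow> \<psi> X \<cdot>\<^bsub>D\<^esub> Mult T (FO B X)
      = FA B (Mult S X) \<cdot>\<^bsub>D\<^esub> (\<psi> (FO (MF S) X) \<cdot>\<^bsub>D\<^esub> FA (MF T) (\<psi> X))"
    and "\<And>X. X \<in> Obj C \<Longrightarrow> \<psi> X \<cdot>\<^bsub>D\<^esub> Eta T (FO B X) = FA B (Eta S X)"
  shows "mnd_1cell C S D T (B, \<psi>)"
proof -
  interpret S: monad C S by fact
  interpret T: monad D T by fact
  interpret B: cfunctor C D B by fact
  have "nat_trans C D (comp_fun C (MF T) B) (comp_fun C B (MF S)) \<psi>"
    by (rule nat_transI)
      (use assms in \<open>auto intro: cfunctor_comp_fun S.S.cfunctor_axioms T.S.cfunctor_axioms\<close>)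
  then show ?thesis
    using assms by (auto simp: mnd_1cell_def)
qed

lemma mnd_1cell_id:
  assumes "monad C S"
  shows "mnd_1cell C S C S (mnd_id C S)"
proof -
  interpret S: monad C S by fact
  show ?thesis
    unfolding mnd_id_def
    by (rule mnd_1cellI) (auto simp: assms intro: cfunctor_id_fun S.C.category_axioms, auto simp: id_trans_def)
qed

text \<open>Required because \<open>mnd_2cell\<close> asks that both boundaries be 1-cells, among
  them the composites of an adjoint pair.\<close>

lemma mnd_1cell_comp:
  assumes "mnd_1cell C S D T (J, \<phi>)" and "mnd_1cell D T B U (K, \<kappa>)"
  shows "mnd_1cell C S B U (mnd_comp C B (K, \<kappa>) (J, \<phi>))"
proof -
  interpret J: mnd_cell C S D T J \<phi> by unfold_locales fact
  interpret K: mnd_cell D T B U K \<kappa> by unfold_locales fact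
  define \<theta> where "\<theta> = (\<lambda>X\<in>Obj C. FA K (\<phi> X) \<cdot>\<^bsub>B\<^esub> \<kappa> (FO J X))"
  have \<theta> [simp]: "\<theta> X = FA K (\<phi> X) \<cdot>\<^bsub>B\<^esub> \<kappa> (FO J X)" if "X \<in> Obj C" for X
    using that by (simp add: \<theta>_def)
  have "mnd_1cell C S B U (comp_fun C K J, \<theta>)"
  proof (rule mnd_1cellI)
    fix f assume [simp]: "f \<in> Arr C"
    let ?X = "Dom C f" and ?Y = "Cod C f"
    have "FA K (\<phi> ?Y) \<cdot>\<^bsub>B\<^esub> (\<kappa> (FO J ?Y) \<cdot>\<^bsub>B\<^esub> FA (MF U) (FA K (FA J f)))
        = FA K (\<phi> ?Y \<cdot>\<^bsub>D\<^esub> FA (MF T) (FA J f)) \<cdot>\<^bsub>B\<^esub> \<kappa> (FO J ?X)"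
      by (simp add: K.psi_nat K.B.FA_split)
    also have "\<dots> = FA K (FA J (FA (MF S) f)) \<cdot>\<^bsub>B\<^esub> (FA K (\<phi> ?X) \<cdot>\<^bsub>B\<^esub> \<kappa> (FO J ?X))"
      by (simp add: J.psi_nat K.B.FA_split)
    finally show "\<theta> ?Y \<cdot>\<^bsub>B\<^esub> FA (MF U) (FA (comp_fun C K J) f)
        = FA (comp_fun C K J) (FA (MF S) f) \<cdot>\<^bsub>B\<^esub> \<theta> ?X"
      by simp
  next
    fix X assume [simp]: "X \<in> Obj C"
    let ?SX = "FO (MF S) X"
    have "FA K (\<phi> X) \<cdot>\<^bsub>B\<^esub> (\<kappa> (FO J X) \<cdot>\<^bsub>B\<^esub> Mult U (FO K (FO J X)))
        = FA K (\<phi> X \<cdot>\<^bsub>D\<^esub> Mult T (FO J X)) \<cdot>\<^bsub>B\<^esub>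
            (\<kappa> (FO (MF T) (FO J X)) \<cdot>\<^bsub>B\<^esub> FA (MF U) (\<kappa> (FO J X)))"
      by (simp add: K.psi_mult K.B.FA_split)
    also have "\<dots> = FA K (FA J (Mult S X)) \<cdot>\<^bsub>B\<^esub> (FA K (\<phi> ?SX) \<cdot>\<^bsub>B\<^esub>
        ((FA K (FA (MF T) (\<phi> X)) \<cdot>\<^bsub>B\<^esub> \<kappa> (FO (MF T) (FO J X))) \<cdot>\<^bsub>B\<^esub> FA (MF U) (\<kappa> (FO J X))))"
      by (simp add: J.psi_mult K.B.FA_split)
    also have "\<dots> = FA K (FA J (Mult S X)) \<cdot>\<^bsub>B\<^esub> (FA K (\<phi> ?SX) \<cdot>\<^bsub>B\<^esub>
        ((\<kappa> (FO J ?SX) \<cdot>\<^bsub>B\<^esub> FA (MF U) (FA K (\<phi> X))) \<cdot>\<^bsub>B\<^esub> FA (MF U) (\<kappa> (FO J X))))"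
      by (simp add: K.psi_nat del: K.T.C.Comp_assoc_Arr)
    finally show "\<theta> X \<cdot>\<^bsub>B\<^esub> Mult U (FO (comp_fun C K J) X) = FA (comp_fun C K J) (Mult S X) \<cdot>\<^bsub>B\<^esub>
        (\<theta> ?SX \<cdot>\<^bsub>B\<^esub> FA (MF U) (\<theta> X))"
      by (simp add: K.T.S.FA_split)
    show "\<theta> X \<cdot>\<^bsub>B\<^esub> Eta U (FO (comp_fun C K J) X) = FA (comp_fun C K J) (Eta S X)"
      by (simp add: K.psi_eta K.B.merge J.psi_eta)
  qed (auto intro: cfunctor_comp_fun J.B.cfunctor_axioms K.B.cfunctor_axioms J.S.monad_axioms
      K.T.monad_axioms, simp add: \<theta>_def)
  then show ?thesis by (simp add: mnd_comp_def \<theta>_def)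
qed

text \<open>One adjunction whose left adjoint is a 1-cell. The invertibility assumption is what
  makes \<open>ad\<close> meaningful: it transposes the inverse of \<open>\<psi>\<close>.\<close>

locale mnd_left_adjoint = adjunction C D A + mnd_cell C S D T "LeftF A" \<psi>
  for C :: "('o, 'a) category" and S :: "('o, 'a) mnd"
    and D :: "('p, 'b) category" and T :: "('p, 'b) mnd"
    and A :: "('o, 'a, 'p, 'b) adj" and \<psi> :: "'o \<Rightarrow> 'b" +
  assumes invertible:
    "invertible_trans C D (comp_fun C (MF T) (LeftF A)) (comp_fun C (LeftF A) (MF S)) \<psi>"
begin

definition psi_inv where
  "psi_inv = inv_trans C D (comp_fun C (MF T) (LeftF A)) (comp_fun C (LeftF A) (MF S)) \<psi>"

lemma psi_inv_trans:
    "nat_trans C D (comp_fun C (LeftF A) (MF S)) (comp_fun C (MF T) (LeftF A)) psi_inv"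
  and psi_inv_left: "X \<in> Obj C \<Longrightarrow> psi_inv X \<cdot>\<^bsub>D\<^esub> \<psi> X = Ident D (FO (MF T) (FO (LeftF A) X))"
  and psi_inv_right: "X \<in> Obj C \<Longrightarrow> \<psi> X \<cdot>\<^bsub>D\<^esub> psi_inv X = Ident D (FO (LeftF A) (FO (MF S) X))"
  using inverse_trans_inv_trans[OF invertible] by (auto simp: inverse_trans_def psi_inv_def)

lemma psi_inv_Arr [simp]: "X \<in> Obj C \<Longrightarrow> psi_inv X \<in> Arr D"
  and Dom_psi_inv [simp]: "X \<in> Obj C \<Longrightarrow> Dom D (psi_inv X) = FO (LeftF A) (FO (MF S) X)"
  and Cod_psi_inv [simp]: "X \<in> Obj C \<Longrightarrow> Cod D (psi_inv X) = FO (MF T) (FO (LeftF A) X)"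
  using nat_trans.component[OF psi_inv_trans, of X] by auto

lemma psi_inv_nat:
  "f \<in> Arr C \<Longrightarrow> Cod C f = X \<Longrightarrow>
    psi_inv X \<cdot>\<^bsub>D\<^esub> FA (LeftF A) (FA (MF S) f) = FA (MF T) (FA (LeftF A) f) \<cdot>\<^bsub>D\<^esub> psi_inv (Dom C f)"
  using nat_trans.nat[OF psi_inv_trans, of f] by auto

lemma psi_inv_eta:
  assumes [simp]: "X \<in> Obj C"
  shows "psi_inv X \<cdot>\<^bsub>D\<^esub> FA (LeftF A) (Eta S X) = Eta T (FO (LeftF A) X)"
  using L.B.precomp[OF psi_inv_left, of X "Eta T (FO (LeftF A) X)"] by (simp add: psi_eta)

text \<open>The inverse obeys the multiplication law with arrows reversed: compose the right-hand
  side with \<open>psi_inv X\<close> after \<open>\<psi> X\<close>, apply the law of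
  \<open>\<psi>\<close>, and let the remaining factors cancel in pairs.\<close>

lemma psi_inv_mult:
  assumes [simp]: "X \<in> Obj C"
  shows "psi_inv X \<cdot>\<^bsub>D\<^esub> FA (LeftF A) (Mult S X)
    = Mult T (FO (LeftF A) X) \<cdot>\<^bsub>D\<^esub> (FA (MF T) (psi_inv X) \<cdot>\<^bsub>D\<^esub> psi_inv (FO (MF S) X))"
    (is "_ = ?rhs")
proof -
  let ?SX = "FO (MF S) X"
  have "FA (MF T) (\<psi> X) \<cdot>\<^bsub>D\<^esub> (FA (MF T) (psi_inv X) \<cdot>\<^bsub>D\<^esub> psi_inv ?SX) = psi_inv ?SX"
    by (simp add: T.S.merge psi_inv_right)
  then have id: "\<psi> ?SX \<cdot>\<^bsub>D\<^esub> (FA (MF T) (\<psi> X) \<cdot>\<^bsub>D\<^esub> (FA (MF T) (psi_inv X) \<cdot>\<^bsub>D\<^esub> psi_inv ?SX))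
      = Ident D (FO (LeftF A) (FO (MF S) ?SX))"
    by (simp add: psi_inv_right)
  have "?rhs = psi_inv X \<cdot>\<^bsub>D\<^esub> ((\<psi> X \<cdot>\<^bsub>D\<^esub> Mult T (FO (LeftF A) X)) \<cdot>\<^bsub>D\<^esub>
      (FA (MF T) (psi_inv X) \<cdot>\<^bsub>D\<^esub> psi_inv ?SX))"
    using L.B.precomp[OF psi_inv_left, of X ?rhs] by simp
  also have "\<dots> = psi_inv X \<cdot>\<^bsub>D\<^esub> FA (LeftF A) (Mult S X)"
    by (simp add: psi_mult id)
  finally show ?thesis ..
qed

abbreviation ad_psi where "ad_psi \<equiv> ad C S D T A \<psi>"

text \<open>Collecting the two R-images into one displays \<open>ad_psi d\<close> as the arrow
  obtained from T eps o \<open>psi_inv\<close> by applying R and precomposing with the unit, the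
  shape to which \<open>transpose_right\<close> applies.\<close>

lemma ad_psi_eq:
  assumes [simp]: "d \<in> Obj D"
  shows "ad_psi d = FA (RightF A) (FA (MF T) (Counit A d) \<cdot>\<^bsub>D\<^esub> psi_inv (FO (RightF A) d))
    \<cdot>\<^bsub>C\<^esub> Unit A (FO (MF S) (FO (RightF A) d))"
  by (simp add: ad_def psi_inv_def[symmetric] R.FA_split)

lemma ad_psi_Arr [simp]: "d \<in> Obj D \<Longrightarrow> ad_psi d \<in> Arr C"
  and Dom_ad_psi [simp]: "d \<in> Obj D \<Longrightarrow> Dom C (ad_psi d) = FO (MF S) (FO (RightF A) d)"
  and Cod_ad_psi [simp]: "d \<in> Obj D \<Longrightarrow> Cod C (ad_psi d) = FO (RightF A) (FO (MF T) d)"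
  by (simp_all add: ad_psi_eq)

lemma ad_psi_ext: "ad_psi \<in> extensional (Obj D)"
  by (simp add: ad_def)

lemma transpose_ad_psi:
  assumes [simp]: "d \<in> Obj D"
  shows "Counit A (FO (MF T) d) \<cdot>\<^bsub>D\<^esub> FA (LeftF A) (ad_psi d)
    = FA (MF T) (Counit A d) \<cdot>\<^bsub>D\<^esub> psi_inv (FO (RightF A) d)"
  using transpose_right[of "FA (MF T) (Counit A d) \<cdot>\<^bsub>D\<^esub> psi_inv (FO (RightF A) d)"
      "FO (MF S) (FO (RightF A) d)"]
  by (simp add: ad_psi_eq)

lemma transpose_ad_psi_comp:
  assumes [simp]: "d \<in> Obj D" "y \<in> Arr D" "Cod D y = FO (LeftF A) (FO (MF S) (FO (RightF A) d))"
  shows "Counit A (FO (MF T) d) \<cdot>\<^bsub>D\<^esub> (FA (LeftF A) (ad_psi d) \<cdot>\<^bsub>D\<^esub> y)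
    = FA (MF T) (Counit A d) \<cdot>\<^bsub>D\<^esub> (psi_inv (FO (RightF A) d) \<cdot>\<^bsub>D\<^esub> y)"
  using L.B.precomp[OF transpose_ad_psi, of d y] by simp

lemma counit_nat_comp:
  assumes [simp]: "f \<in> Arr D" "Cod D f = x" "y \<in> Arr D" "Cod D y = FO (LeftF A) (FO (RightF A) (Dom D f))"
  shows "Counit A x \<cdot>\<^bsub>D\<^esub> (FA (LeftF A) (FA (RightF A) f) \<cdot>\<^bsub>D\<^esub> y) = f \<cdot>\<^bsub>D\<^esub> (Counit A (Dom D f) \<cdot>\<^bsub>D\<^esub> y)"
  using L.B.precomp[OF counit_nat, of f x y] assms(2) L.B.Cod_Obj[of f] by simp

text \<open>Each law is tested on transposes, where it turns into the corresponding reversed law of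
  \<open>psi_inv\<close> together with naturality of the counit and of the structure of T.\<close>

lemma mnd_1cell_ad_psi: "mnd_1cell D T C S (RightF A, ad_psi)"
proof (rule mnd_1cellI)
  fix f assume [simp]: "f \<in> Arr D"
  let ?x = "Dom D f" and ?y = "Cod D f"
  show "ad_psi ?y \<cdot>\<^bsub>C\<^esub> FA (MF S) (FA (RightF A) f) = FA (RightF A) (FA (MF T) f) \<cdot>\<^bsub>C\<^esub> ad_psi ?x"
  proof (rule transpose_inj[where x = "FO (MF T) ?y"])
    have "Counit A (FO (MF T) ?y) \<cdot>\<^bsub>D\<^esub> FA (LeftF A) (ad_psi ?y \<cdot>\<^bsub>C\<^esub> FA (MF S) (FA (RightF A) f))
      = FA (MF T) (Counit A ?y \<cdot>\<^bsub>D\<^esub> FA (LeftF A) (FA (RightF A) f)) \<cdot>\<^bsub>D\<^esub> psi_inv (FO (RightF A) ?x)"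
      by (simp add: L.FA_split transpose_ad_psi_comp psi_inv_nat T.S.FA_split)
    also have "\<dots> = Counit A (FO (MF T) ?y) \<cdot>\<^bsub>D\<^esub> FA (LeftF A) (FA (RightF A) (FA (MF T) f) \<cdot>\<^bsub>C\<^esub> ad_psi ?x)"
      by (simp add: counit_nat L.FA_split counit_nat_comp transpose_ad_psi T.S.FA_split)
    finally show "Counit A (FO (MF T) ?y) \<cdot>\<^bsub>D\<^esub> FA (LeftF A) (ad_psi ?y \<cdot>\<^bsub>C\<^esub> FA (MF S) (FA (RightF A) f))
      = Counit A (FO (MF T) ?y) \<cdot>\<^bsub>D\<^esub> FA (LeftF A) (FA (RightF A) (FA (MF T) f) \<cdot>\<^bsub>C\<^esub> ad_psi ?x)" .
  qed auto
next
  fix d assume [simp]: "d \<in> Obj D"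
  let ?Rd = "FO (RightF A) d" and ?Td = "FO (MF T) d"
  show "ad_psi d \<cdot>\<^bsub>C\<^esub> Mult S ?Rd
      = FA (RightF A) (Mult T d) \<cdot>\<^bsub>C\<^esub> (ad_psi ?Td \<cdot>\<^bsub>C\<^esub> FA (MF S) (ad_psi d))" (is "?l = ?r")
  proof (rule transpose_inj[where x = ?Td])
    have "Counit A ?Td \<cdot>\<^bsub>D\<^esub> FA (LeftF A) ?l = FA (MF T) (Counit A d) \<cdot>\<^bsub>D\<^esub>
        (Mult T (FO (LeftF A) ?Rd) \<cdot>\<^bsub>D\<^esub> (FA (MF T) (psi_inv ?Rd) \<cdot>\<^bsub>D\<^esub> psi_inv (FO (MF S) ?Rd)))"
      by (simp add: L.FA_split transpose_ad_psi_comp psi_inv_mult)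
    also have "\<dots> = (Mult T d \<cdot>\<^bsub>D\<^esub> FA (MF T) (FA (MF T) (Counit A d))) \<cdot>\<^bsub>D\<^esub>
        (FA (MF T) (psi_inv ?Rd) \<cdot>\<^bsub>D\<^esub> psi_inv (FO (MF S) ?Rd))"
      by (subst T.mult_nat) simp_all
    also have "\<dots> = Mult T d \<cdot>\<^bsub>D\<^esub> (FA (MF T) (FA (MF T) (Counit A d) \<cdot>\<^bsub>D\<^esub> psi_inv ?Rd)
        \<cdot>\<^bsub>D\<^esub> psi_inv (FO (MF S) ?Rd))"
      by (simp add: T.S.FA_split)
    \<comment> \<open>Below the outer T, the composite T eps o \<open>psi_inv\<close> is itself the
      transpose of \<open>ad_psi d\<close>. Rewriting it backwards produces T L
      (\<open>ad_psi d\<close>), which naturality of \<open>psi_inv\<close> exchanges for L S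
      (\<open>ad_psi d\<close>).\<close>
    also have "\<dots> = Counit A ?Td \<cdot>\<^bsub>D\<^esub> FA (LeftF A) ?r"
      unfolding transpose_ad_psi[OF \<open>d \<in> Obj D\<close>, symmetric]
      by (simp add: L.FA_split counit_nat_comp transpose_ad_psi_comp psi_inv_nat T.S.FA_split)
    finally show "Counit A ?Td \<cdot>\<^bsub>D\<^esub> FA (LeftF A) ?l = Counit A ?Td \<cdot>\<^bsub>D\<^esub> FA (LeftF A) ?r" .
  qed auto
  show "ad_psi d \<cdot>\<^bsub>C\<^esub> Eta S ?Rd = FA (RightF A) (Eta T d)"
  proof (rule transpose_inj[where x = ?Td])
    show "Counit A ?Td \<cdot>\<^bsub>D\<^esub> FA (LeftF A) (ad_psi d \<cdot>\<^bsub>C\<^esub> Eta S ?Rd)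
        = Counit A ?Td \<cdot>\<^bsub>D\<^esub> FA (LeftF A) (FA (RightF A) (Eta T d))"
      by (simp add: L.FA_split transpose_ad_psi_comp psi_inv_eta counit_nat T.eta_nat)
  qed auto
qed (auto intro: S.monad_axioms T.monad_axioms right_fun simp: ad_psi_ext)

text \<open>The two inverse laws are used separately: \<open>\<psi>\<close> after
  \<open>psi_inv\<close>, with a triangle identity, makes the unit a 2-cell, and
  \<open>psi_inv\<close> after \<open>\<psi>\<close> makes the counit one.\<close>

lemma mnd_adjoint_ad_psi: "mnd_adjoint C S D T A \<psi> ad_psi"
proof -
  have "(FA (RightF A) (\<psi> c) \<cdot>\<^bsub>C\<^esub> ad_psi (FO (LeftF A) c)) \<cdot>\<^bsub>C\<^esub> FA (MF S) (Unit A c) = Unit A (FO (MF S) c)"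
    if [simp]: "c \<in> Obj C" for c
  proof (rule transpose_inj[where x = "FO (LeftF A) (FO (MF S) c)"])
    have "FA (MF T) (Counit A (FO (LeftF A) c)) \<cdot>\<^bsub>D\<^esub> (FA (MF T) (FA (LeftF A) (Unit A c)) \<cdot>\<^bsub>D\<^esub> psi_inv c) = psi_inv c"
      by (simp add: T.S.merge triangle_left)
    then show "Counit A (FO (LeftF A) (FO (MF S) c)) \<cdot>\<^bsub>D\<^esub> FA (LeftF A)
        ((FA (RightF A) (\<psi> c) \<cdot>\<^bsub>C\<^esub> ad_psi (FO (LeftF A) c)) \<cdot>\<^bsub>C\<^esub> FA (MF S) (Unit A c))
      = Counit A (FO (LeftF A) (FO (MF S) c)) \<cdot>\<^bsub>D\<^esub> FA (LeftF A) (Unit A (FO (MF S) c))"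
      by (simp add: L.FA_split counit_nat_comp transpose_ad_psi_comp psi_inv_nat triangle_left psi_inv_right)
  qed auto
  moreover have "Counit A (FO (MF T) d) \<cdot>\<^bsub>D\<^esub> (FA (LeftF A) (ad_psi d) \<cdot>\<^bsub>D\<^esub> \<psi> (FO (RightF A) d))
      = FA (MF T) (Counit A d)" if [simp]: "d \<in> Obj D" for d
    by (simp add: transpose_ad_psi_comp psi_inv_left)
  ultimately show ?thesis
    using mnd_1cell_comp[OF cell mnd_1cell_ad_psi] mnd_1cell_comp[OF mnd_1cell_ad_psi cell]
      mnd_1cell_id[OF S.monad_axioms] mnd_1cell_id[OF T.monad_axioms]
    unfolding mnd_adjoint_def mnd_2cell_def mnd_id_def mnd_comp_def
    by (auto simp: adjunction_axioms cell mnd_1cell_ad_psi unit_trans counit_trans)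
qed

end

section \<open>Parametric adjunctions\<close>

lemma J_at_simps [simp]:
  "c \<in> Obj C \<Longrightarrow> FO (J_at C P J p) c = FO J (c, p)"
  "f \<in> Arr C \<Longrightarrow> FA (J_at C P J p) f = FA J (f, Ident P p)"
  by (simp_all add: J_at_def)

lemma K_at_simps [simp]:
  "d \<in> Obj D \<Longrightarrow> FO (K_at P D K p) d = FO K (p, d)"
  "g \<in> Arr D \<Longrightarrow> FA (K_at P D K p) g = FA K (Ident P p, g)"
  by (simp_all add: K_at_def)

lemma adj_at_simps [simp]:
  "LeftF (adj_at C P D Q p) = J_at C P (PJ Q) p"
  "RightF (adj_at C P D Q p) = K_at P D (PK Q) p"
  "Unit (adj_at C P D Q p) = PUnit Q p"
  "Counit (adj_at C P D Q p) = PCounit Q p"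
  by (simp_all add: adj_at_def)

lemma trans_at_simp [simp]: "c \<in> Obj C \<Longrightarrow> trans_at C \<phi> m c = \<phi> (c, m)"
  by (simp add: trans_at_def)

sublocale parametric_adjunction \<subseteq> P: category P by (rule cat_P)
sublocale parametric_adjunction \<subseteq> J: cfunctor "prod_cat C P" D "PJ Q" by (rule J_fun)
sublocale parametric_adjunction \<subseteq> K: cfunctor "prod_cat (op_cat P) D" C "PK Q" by (rule K_fun)

context parametric_adjunction
begin

lemma PUnit_Arr [simp]: "p \<in> Obj P \<Longrightarrow> c \<in> Obj C \<Longrightarrow> PUnit Q p c \<in> Arr C"
  and Dom_PUnit [simp]: "p \<in> Obj P \<Longrightarrow> c \<in> Obj C \<Longrightarrow> Dom C (PUnit Q p c) = c"
  and Cod_PUnit [simp]: "p \<in> Obj P \<Longrightarrow> c \<in> Obj C \<Longrightarrow>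
    Cod C (PUnit Q p c) = FO (PK Q) (p, FO (PJ Q) (c, p))"
  using adjunction.unit_Arr[OF adj, of p c] adjunction.Dom_unit[OF adj, of p c]
    adjunction.Cod_unit[OF adj, of p c] by auto

lemma PCounit_Arr [simp]: "p \<in> Obj P \<Longrightarrow> d \<in> Obj D \<Longrightarrow> PCounit Q p d \<in> Arr D"
  and Dom_PCounit [simp]: "p \<in> Obj P \<Longrightarrow> d \<in> Obj D \<Longrightarrow>
    Dom D (PCounit Q p d) = FO (PJ Q) (FO (PK Q) (p, d), p)"
  and Cod_PCounit [simp]: "p \<in> Obj P \<Longrightarrow> d \<in> Obj D \<Longrightarrow> Cod D (PCounit Q p d) = d"
  using adjunction.counit_Arr[OF adj, of p d] adjunction.Dom_counit[OF adj, of p d]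
    adjunction.Cod_counit[OF adj, of p d] by auto

lemma transpose_inj_at:
  assumes "p \<in> Obj P" and "f \<in> Arr C" and "g \<in> Arr C" and "d \<in> Obj D" and "Cod C f = FO (PK Q) (p, d)"
    and "Cod C g = FO (PK Q) (p, d)" and "Dom C f = Dom C g"
    and "PCounit Q p d \<cdot>\<^bsub>D\<^esub> FA (PJ Q) (f, Ident P p) = PCounit Q p d \<cdot>\<^bsub>D\<^esub> FA (PJ Q) (g, Ident P p)"
  shows "f = g"
  using adjunction.transpose_inj[OF adj, of p f g d] assms by simp

text \<open>The conjugacy formula presents K_u as K_p applied to eps^p' o J(1,u), precomposed with
  the unit. Transposing it back gives extranaturality of the counit in the parameter.\<close>

lemma conjugate_transpose:
  assumes [simp]: "u \<in> Arr P" "d \<in> Obj D"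
  shows "PCounit Q (Dom P u) d \<cdot>\<^bsub>D\<^esub> FA (PJ Q) (FA (PK Q) (u, Ident D d), Ident P (Dom P u))
    = PCounit Q (Cod P u) d \<cdot>\<^bsub>D\<^esub> FA (PJ Q) (Ident C (FO (PK Q) (Cod P u, d)), u)"
proof -
  interpret A: adjunction C D "adj_at C P D Q (Dom P u)" by (rule adj) simp
  show ?thesis
    using A.transpose_right[of "PCounit Q (Cod P u) d \<cdot>\<^bsub>D\<^esub> FA (PJ Q) (Ident C (FO (PK Q) (Cod P u, d)), u)"
        "FO (PK Q) (Cod P u, d)"] conjugate[of u "Dom P u" "Cod P u" d]
    by (simp add: K.FA_split[symmetric])
qed

end

lemma reparam_simps [simp]:
  "PJ (reparam C D P' U Q) = comp_fun (prod_cat C P') (PJ Q) (prod_fun C P' (id_fun C) U)"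
  "PK (reparam C D P' U Q)
    = comp_fun (prod_cat (op_cat P') D) (PK Q) (prod_fun (op_cat P') D U (id_fun D))"
  "m \<in> Obj P' \<Longrightarrow> PUnit (reparam C D P' U Q) m = PUnit Q (FO U m)"
  "m \<in> Obj P' \<Longrightarrow> PCounit (reparam C D P' U Q) m = PCounit Q (FO U m)"
  by (simp_all add: reparam_def)

text \<open>An equality of records and not just an isomorphism: U preserves identities, so both
  sides evaluate J and K at the same pairs, and all fields are restricted to the same sets.\<close>

lemma adj_at_reparam:
  assumes "parametric_adjunction C P D Q" and "cfunctor P' P U" and "m \<in> Obj P'"
  shows "adj_at C P' D (reparam C D P' U Q) m = adj_at C P D Q (FO U m)"
proof -
  interpret parametric_adjunction C P D Q by fact
  interpret U: cfunctor P' P U by fact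
  have "J_at C P' (PJ (reparam C D P' U Q)) m = J_at C P (PJ Q) (FO U m)"
    using assms(3) unfolding J_at_def by (auto intro!: restrict_ext)
  moreover have "K_at P' D (PK (reparam C D P' U Q)) m = K_at P D (PK Q) (FO U m)"
    using assms(3) unfolding K_at_def by (auto intro!: restrict_ext)
  ultimately show ?thesis using assms(3) by (simp add: adj_at_def)
qed

lemma parametric_adjunction_reparam:
  assumes "parametric_adjunction C P D Q" and "cfunctor P' P U"
  shows "parametric_adjunction C P' D (reparam C D P' U Q)"
proof -
  interpret parametric_adjunction C P D Q by fact
  interpret U: cfunctor P' P U by fact
  show ?thesis
  proof (rule parametric_adjunction.intro)
    show "cfunctor (prod_cat C P') D (PJ (reparam C D P' U Q))"
      by (auto intro!: cfunctor_comp_fun[where B = "prod_cat C P"] cfunctor_prod_fun cfunctor_id_fun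
          K.B.category_axioms assms(2) J_fun)
    show "cfunctor (prod_cat (op_cat P') D) C (PK (reparam C D P' U Q))"
      by (auto intro!: cfunctor_comp_fun[where B = "prod_cat (op_cat P) D"] cfunctor_prod_fun cfunctor_id_fun
          cfunctor_op_cat J.B.category_axioms assms(2) K_fun)
    show "adjunction C D (adj_at C P' D (reparam C D P' U Q) m)" if "m \<in> Obj P'" for m
      using adj[of "FO U m"] adj_at_reparam[OF assms that] that by simp
    show "FA (PK (reparam C D P' U Q)) (u, Ident D d) =
        FA (K_at P' D (PK (reparam C D P' U Q)) p) (PCounit (reparam C D P' U Q) p' d)
        \<cdot>\<^bsub>C\<^esub> FA (K_at P' D (PK (reparam C D P' U Q)) p)
              (FA (PJ (reparam C D P' U Q)) (Ident C (FO (PK (reparam C D P' U Q)) (p', d)), u))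
        \<cdot>\<^bsub>C\<^esub> PUnit (reparam C D P' U Q) p (FO (PK (reparam C D P' U Q)) (p', d))"
      if "u \<in> hom P' p p'" "d \<in> Obj D" for u p p' d
      using that conjugate[of "FA U u" "FO U p" "FO U p'" d] U.A.Dom_Obj[of u] U.A.Cod_Obj[of u]
      by (auto simp del: U.A.Dom_Obj U.A.Cod_Obj)
  qed (auto simp: U.A.category_axioms reparam_def)
qed

text \<open>To be used with the algebras of E as parameters, the reparametrised adjunction and
  \<open>\<phi>\<close> = H(\<open>\<psi>\<close>). The parameters carry the identity monad, so
  \<open>\<phi>\<close> is a 1-cell in each fixed parameter.\<close>

locale parametric_mnd_cell = parametric_adjunction C P D Q +
  mnd_cell "prod_cat C P" "prod_mnd C P S (id_mnd P)" D T "PJ Q" \<phi> + CS: monad C S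
  for C :: "('c, 'ca) category" and S :: "('c, 'ca) mnd" and P :: "('p, 'pa) category"
    and D :: "('d, 'da) category" and T :: "('d, 'da) mnd"
    and Q :: "('c, 'ca, 'p, 'pa, 'd, 'da) param_adj" and \<phi> :: "'c \<times> 'p \<Rightarrow> 'da" +
  assumes invertible: "invertible_trans (prod_cat C P) D (comp_fun (prod_cat C P) (MF T) (PJ Q))
    (comp_fun (prod_cat C P) (PJ Q) (prod_fun C P (MF S) (id_fun P))) \<phi>"
begin

lemma mnd_left_adjoint_at:
  assumes [simp]: "p \<in> Obj P"
  shows "mnd_left_adjoint C S D T (adj_at C P D Q p) (trans_at C \<phi> p)"
proof -
  interpret A: adjunction C D "adj_at C P D Q p" by (rule adj) simp
  have cell: "mnd_1cell C S D T (LeftF (adj_at C P D Q p), trans_at C \<phi> p)"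
  proof (rule mnd_1cellI)
    fix f assume "f \<in> Arr C"
    then show "trans_at C \<phi> p (Cod C f) \<cdot>\<^bsub>D\<^esub> FA (MF T) (FA (LeftF (adj_at C P D Q p)) f)
      = FA (LeftF (adj_at C P D Q p)) (FA (MF S) f) \<cdot>\<^bsub>D\<^esub> trans_at C \<phi> p (Dom C f)"
      using psi_nat[of "(f, Ident P p)"] by simp
  next
    fix c assume "c \<in> Obj C"
    then show "trans_at C \<phi> p c \<cdot>\<^bsub>D\<^esub> Mult T (FO (LeftF (adj_at C P D Q p)) c)
        = FA (LeftF (adj_at C P D Q p)) (Mult S c) \<cdot>\<^bsub>D\<^esub> (trans_at C \<phi> p (FO (MF S) c) \<cdot>\<^bsub>D\<^esub>
          FA (MF T) (trans_at C \<phi> p c))"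
      and "trans_at C \<phi> p c \<cdot>\<^bsub>D\<^esub> Eta T (FO (LeftF (adj_at C P D Q p)) c)
        = FA (LeftF (adj_at C P D Q p)) (Eta S c)"
      using psi_mult[of "(c, p)"] psi_eta[of "(c, p)"] by simp_all
  qed (auto simp: A.left_fun CS.monad_axioms T.monad_axioms, simp_all add: A.left_fun[simplified] trans_at_def)
  then interpret M: mnd_cell C S D T "LeftF (adj_at C P D Q p)" "trans_at C \<phi> p"
    by unfold_locales
  show ?thesis
  proof unfold_locales
    show "invertible_trans C D (comp_fun C (MF T) (LeftF (adj_at C P D Q p)))
        (comp_fun C (LeftF (adj_at C P D Q p)) (MF S)) (trans_at C \<phi> p)"
      using M.psi_trans invertible unfolding invertible_trans_iff by fastforce
  qed
qed

abbreviation \<kappa> where "\<kappa> \<equiv> ad_param C S P D T Q \<phi>"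

lemma \<kappa>_at: "p \<in> Obj P \<Longrightarrow> d \<in> Obj D \<Longrightarrow> \<kappa> (p, d) = ad C S D T (adj_at C P D Q p) (trans_at C \<phi> p) d"
  by (simp add: ad_param_def)

lemma \<kappa>_Arr [simp]: "p \<in> Obj P \<Longrightarrow> d \<in> Obj D \<Longrightarrow> \<kappa> (p, d) \<in> Arr C"
  and Dom_\<kappa> [simp]: "p \<in> Obj P \<Longrightarrow> d \<in> Obj D \<Longrightarrow> Dom C (\<kappa> (p, d)) = FO (MF S) (FO (PK Q) (p, d))"
  and Cod_\<kappa> [simp]: "p \<in> Obj P \<Longrightarrow> d \<in> Obj D \<Longrightarrow> Cod C (\<kappa> (p, d)) = FO (PK Q) (p, FO (MF T) d)"
  using mnd_left_adjoint.ad_psi_Arr[OF mnd_left_adjoint_at, of p d]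
    mnd_left_adjoint.Dom_ad_psi[OF mnd_left_adjoint_at, of p d]
    mnd_left_adjoint.Cod_ad_psi[OF mnd_left_adjoint_at, of p d]
  by (simp_all add: \<kappa>_at)

lemma \<kappa>_ext: "\<kappa> \<in> extensional (Obj P \<times> Obj D)"
  by (simp add: ad_param_def)

text \<open>Precomposition with \<open>\<phi>\<close> cancels the inverse hidden in
  \<open>\<kappa>\<close>. This describes \<open>\<kappa>\<close> without any inverse, which is
  needed when the parameter varies.\<close>

lemma transpose_\<kappa>:
  assumes [simp]: "p \<in> Obj P" "d \<in> Obj D"
  shows "PCounit Q p (FO (MF T) d) \<cdot>\<^bsub>D\<^esub> (FA (PJ Q) (\<kappa> (p, d), Ident P p) \<cdot>\<^bsub>D\<^esub> \<phi> (FO (PK Q) (p, d), p))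
    = FA (MF T) (PCounit Q p d)"
proof -
  interpret A: mnd_left_adjoint C S D T "adj_at C P D Q p" "trans_at C \<phi> p"
    by (rule mnd_left_adjoint_at) fact
  show ?thesis
    using A.transpose_ad_psi_comp[of d "\<phi> (FO (PK Q) (p, d), p)"] A.psi_inv_left[of "FO (PK Q) (p, d)"]
    by (simp add: \<kappa>_at)
qed

lemma \<phi>_epi:
  assumes [simp]: "p \<in> Obj P" "c \<in> Obj C" and "f \<in> Arr D" and "g \<in> Arr D"
    and "Dom D f = FO (PJ Q) (FO (MF S) c, p)" and "Dom D g = FO (PJ Q) (FO (MF S) c, p)"
    and "f \<cdot>\<^bsub>D\<^esub> \<phi> (c, p) = g \<cdot>\<^bsub>D\<^esub> \<phi> (c, p)"
  shows "f = g"
proof -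
  obtain i where i: "i \<in> Arr D" "Dom D i = FO (PJ Q) (FO (MF S) c, p)"
    "Cod D i = FO (MF T) (FO (PJ Q) (c, p))" "\<phi> (c, p) \<cdot>\<^bsub>D\<^esub> i = Ident D (FO (PJ Q) (FO (MF S) c, p))"
    using invertible unfolding invertible_trans_iff by fastforce
  have "(f \<cdot>\<^bsub>D\<^esub> \<phi> (c, p)) \<cdot>\<^bsub>D\<^esub> i = (g \<cdot>\<^bsub>D\<^esub> \<phi> (c, p)) \<cdot>\<^bsub>D\<^esub> i" using assms by simp
  then show ?thesis using assms(3-6) i by simp
qed

text \<open>The two occurrences of \<open>\<kappa>\<close> belong to different adjunctions, at
  \<open>Dom P u\<close> and \<open>Cod P u\<close>. Both sides are transposed at the domain and
  precomposed with the epimorphism \<open>\<phi>\<close>; extranaturality of the counit then links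
  the parameters, once below T at d and once at T d.\<close>

lemma \<kappa>_nat_param:
  assumes [simp]: "u \<in> Arr P" "d \<in> Obj D"
  shows "\<kappa> (Dom P u, d) \<cdot>\<^bsub>C\<^esub> FA (MF S) (FA (PK Q) (u, Ident D d))
    = FA (PK Q) (u, Ident D (FO (MF T) d)) \<cdot>\<^bsub>C\<^esub> \<kappa> (Cod P u, d)" (is "?l = ?r")
proof (rule transpose_inj_at)
  let ?p = "Dom P u" and ?p' = "Cod P u" and ?Td = "FO (MF T) d"
  let ?c = "FO (PK Q) (?p', d)"
  show "PCounit Q ?p ?Td \<cdot>\<^bsub>D\<^esub> FA (PJ Q) (?l, Ident P ?p) = PCounit Q ?p ?Td \<cdot>\<^bsub>D\<^esub> FA (PJ Q) (?r, Ident P ?p)"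
  proof (rule \<phi>_epi)
    have J_comp: "FA (PJ Q) (g \<cdot>\<^bsub>C\<^esub> f, Ident P ?p) = FA (PJ Q) (g, Ident P ?p) \<cdot>\<^bsub>D\<^esub> FA (PJ Q) (f, Ident P ?p)"
      if "f \<in> Arr C" "g \<in> Arr C" "Cod C f = Dom C g" for f g
      using J.FA_split[of "(f, Ident P ?p)" "(g, Ident P ?p)"] that by simp
    have "PCounit Q ?p ?Td \<cdot>\<^bsub>D\<^esub> FA (PJ Q) (?l, Ident P ?p) \<cdot>\<^bsub>D\<^esub> \<phi> (?c, ?p)
      = PCounit Q ?p ?Td \<cdot>\<^bsub>D\<^esub> (FA (PJ Q) (\<kappa> (?p, d), Ident P ?p) \<cdot>\<^bsub>D\<^esub>
          (FA (PJ Q) (FA (MF S) (FA (PK Q) (u, Ident D d)), Ident P ?p) \<cdot>\<^bsub>D\<^esub> \<phi> (?c, ?p)))"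
      by (simp add: J_comp)
    also have "\<dots> = (PCounit Q ?p ?Td \<cdot>\<^bsub>D\<^esub> (FA (PJ Q) (\<kappa> (?p, d), Ident P ?p) \<cdot>\<^bsub>D\<^esub>
          \<phi> (FO (PK Q) (?p, d), ?p))) \<cdot>\<^bsub>D\<^esub> FA (MF T) (FA (PJ Q) (FA (PK Q) (u, Ident D d), Ident P ?p))"
      using psi_nat[of "(FA (PK Q) (u, Ident D d), Ident P ?p)" "(FO (PK Q) (?p, d), ?p)"] by simp
    also have "\<dots> = FA (MF T) (PCounit Q ?p d \<cdot>\<^bsub>D\<^esub> FA (PJ Q) (FA (PK Q) (u, Ident D d), Ident P ?p))"
      by (subst transpose_\<kappa>) (simp_all add: T.S.merge)
    also have "\<dots> = FA (MF T) (PCounit Q ?p' d) \<cdot>\<^bsub>D\<^esub> FA (MF T) (FA (PJ Q) (Ident C ?c, u))"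
      by (subst conjugate_transpose) (simp_all add: T.S.merge)
    \<comment> \<open>From here the computation unwinds at \<open>Cod P u\<close>: T of the counit
      is expanded through \<open>\<kappa>\<close> there, and naturality of \<open>\<phi>\<close> in
      the parameter leads back to \<open>Dom P u\<close>.\<close>
    also have "\<dots> = (PCounit Q ?p' ?Td \<cdot>\<^bsub>D\<^esub> (FA (PJ Q) (\<kappa> (?p', d), Ident P ?p') \<cdot>\<^bsub>D\<^esub>
        \<phi> (?c, ?p'))) \<cdot>\<^bsub>D\<^esub> FA (MF T) (FA (PJ Q) (Ident C ?c, u))"
      by (subst transpose_\<kappa>) simp_all
    also have "\<dots> = PCounit Q ?p' ?Td \<cdot>\<^bsub>D\<^esub> (FA (PJ Q) (\<kappa> (?p', d), Ident P ?p') \<cdot>\<^bsub>D\<^esub>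
        (FA (PJ Q) (Ident C (FO (MF S) ?c), u) \<cdot>\<^bsub>D\<^esub> \<phi> (?c, ?p)))"
      using psi_nat[of "(Ident C ?c, u)" "(?c, ?p')"] by simp
    also have "\<dots> = (PCounit Q ?p' ?Td \<cdot>\<^bsub>D\<^esub> FA (PJ Q) (Ident C (FO (PK Q) (?p', ?Td)), u)) \<cdot>\<^bsub>D\<^esub>
        (FA (PJ Q) (\<kappa> (?p', d), Ident P ?p) \<cdot>\<^bsub>D\<^esub> \<phi> (?c, ?p))"
      by (simp add: J.merge)
    also have "\<dots> = (PCounit Q ?p ?Td \<cdot>\<^bsub>D\<^esub> FA (PJ Q) (FA (PK Q) (u, Ident D ?Td), Ident P ?p)) \<cdot>\<^bsub>D\<^esub>
        (FA (PJ Q) (\<kappa> (?p', d), Ident P ?p) \<cdot>\<^bsub>D\<^esub> \<phi> (?c, ?p))"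
      by (subst conjugate_transpose) simp_all
    also have "\<dots> = PCounit Q ?p ?Td \<cdot>\<^bsub>D\<^esub> FA (PJ Q) (?r, Ident P ?p) \<cdot>\<^bsub>D\<^esub> \<phi> (?c, ?p)"
      by (simp add: J_comp)
    finally show "PCounit Q ?p ?Td \<cdot>\<^bsub>D\<^esub> FA (PJ Q) (?l, Ident P ?p) \<cdot>\<^bsub>D\<^esub> \<phi> (?c, ?p)
      = PCounit Q ?p ?Td \<cdot>\<^bsub>D\<^esub> FA (PJ Q) (?r, Ident P ?p) \<cdot>\<^bsub>D\<^esub> \<phi> (?c, ?p)" .
  qed auto
qed auto

text \<open>With the identity monad on the parameters, the multiplication and unit laws are those of
  \<open>ad_psi\<close> at each fixed parameter. Only naturality involves both variables.\<close>

lemma mnd_1cell_\<kappa>: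
  "mnd_1cell (prod_cat (op_cat P) D) (prod_mnd (op_cat P) D (id_mnd (op_cat P)) T) C S (PK Q, \<kappa>)"
proof (rule mnd_1cellI)
  fix f assume "f \<in> Arr (prod_cat (op_cat P) D)"
  then obtain u g where f: "f = (u, g)" and [simp]: "u \<in> Arr P" "g \<in> Arr D" by auto
  let ?p = "Dom P u" and ?p' = "Cod P u" and ?d = "Dom D g" and ?d' = "Cod D g"
  interpret A: mnd_left_adjoint C S D T "adj_at C P D Q ?p" "trans_at C \<phi> ?p"
    by (rule mnd_left_adjoint_at) simp
  interpret KA: mnd_cell D T C S "RightF (adj_at C P D Q ?p)" A.ad_psi
    by unfold_locales (rule A.mnd_1cell_ad_psi)
  have nat: "\<kappa> (?p, ?d') \<cdot>\<^bsub>C\<^esub> FA (MF S) (FA (PK Q) (Ident P ?p, g))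
      = FA (PK Q) (Ident P ?p, FA (MF T) g) \<cdot>\<^bsub>C\<^esub> \<kappa> (?p, ?d)"
    using KA.psi_nat[of g ?d'] by (simp add: \<kappa>_at)
  \<comment> \<open>K(u,g) factors as K(u,1) followed by K(1,g) at the domain of u, which separates
    the two naturalities.\<close>
  have "\<kappa> (?p, ?d') \<cdot>\<^bsub>C\<^esub> FA (MF S) (FA (PK Q) (u, g))
      = (\<kappa> (?p, ?d') \<cdot>\<^bsub>C\<^esub> FA (MF S) (FA (PK Q) (Ident P ?p, g))) \<cdot>\<^bsub>C\<^esub> FA (MF S) (FA (PK Q) (u, Ident D ?d))"
    by (simp add: CS.S.merge K.merge)
  also have "\<dots> = FA (PK Q) (Ident P ?p, FA (MF T) g) \<cdot>\<^bsub>C\<^esub> (\<kappa> (?p, ?d) \<cdot>\<^bsub>C\<^esub> FA (MF S) (FA (PK Q) (u, Ident D ?d)))"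
    unfolding nat by simp
  also have "\<dots> = FA (PK Q) (u, FA (MF T) g) \<cdot>\<^bsub>C\<^esub> \<kappa> (?p', ?d)"
    by (simp add: \<kappa>_nat_param K.merge)
  finally show "\<kappa> (Cod (prod_cat (op_cat P) D) f) \<cdot>\<^bsub>C\<^esub> FA (MF S) (FA (PK Q) f)
      = FA (PK Q) (FA (MF (prod_mnd (op_cat P) D (id_mnd (op_cat P)) T)) f) \<cdot>\<^bsub>C\<^esub>
        \<kappa> (Dom (prod_cat (op_cat P) D) f)"
    by (simp add: f)
next
  fix x assume "x \<in> Obj (prod_cat (op_cat P) D)"
  then obtain p d where x: "x = (p, d)" and [simp]: "p \<in> Obj P" "d \<in> Obj D" by auto
  interpret A: mnd_left_adjoint C S D T "adj_at C P D Q p" "trans_at C \<phi> p"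
    by (rule mnd_left_adjoint_at) simp
  interpret KA: mnd_cell D T C S "RightF (adj_at C P D Q p)" A.ad_psi
    by unfold_locales (rule A.mnd_1cell_ad_psi)
  show "\<kappa> x \<cdot>\<^bsub>C\<^esub> Mult S (FO (PK Q) x)
      = FA (PK Q) (Mult (prod_mnd (op_cat P) D (id_mnd (op_cat P)) T) x) \<cdot>\<^bsub>C\<^esub>
        (\<kappa> (FO (MF (prod_mnd (op_cat P) D (id_mnd (op_cat P)) T)) x) \<cdot>\<^bsub>C\<^esub> FA (MF S) (\<kappa> x))"
    using KA.psi_mult[of d] by (simp add: x \<kappa>_at)
  show "\<kappa> x \<cdot>\<^bsub>C\<^esub> Eta S (FO (PK Q) x)
      = FA (PK Q) (Eta (prod_mnd (op_cat P) D (id_mnd (op_cat P)) T) x)"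
    using KA.psi_eta[of d] by (simp add: x \<kappa>_at)
qed (auto simp: K_fun CS.monad_axioms T.monad_axioms \<kappa>_ext
    intro!: monad_prod_mnd monad_id_mnd category_op_cat P.category_axioms)

lemma mnd_adjoint_\<kappa>:
  assumes "p \<in> Obj P"
  shows "mnd_adjoint C S D T (adj_at C P D Q p) (trans_at C \<phi> p) (\<lambda>d\<in>Obj D. \<kappa> (p, d))"
proof -
  interpret A: mnd_left_adjoint C S D T "adj_at C P D Q p" "trans_at C \<phi> p"
    by (rule mnd_left_adjoint_at) fact
  have "(\<lambda>d\<in>Obj D. \<kappa> (p, d)) = A.ad_psi"
    using A.ad_psi_ext assms by (auto simp: \<kappa>_at extensional_def fun_eq_iff)
  then show ?thesis using A.mnd_adjoint_ad_psi by simp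
qed

end

section \<open>The transformation H and liftings of functors\<close>

locale two_variable_mnd_cell = CS: monad C S + PE: monad P E +
  mnd_cell "prod_cat C P" "prod_mnd C P S E" D T J \<psi>
  for C :: "('c, 'ca) category" and S :: "('c, 'ca) mnd" and P :: "('p, 'pa) category"
    and E :: "('p, 'pa) mnd" and D :: "('d, 'da) category" and T :: "('d, 'da) mnd"
    and J :: "('c \<times> 'p, 'ca \<times> 'pa, 'd, 'da) cfun" and \<psi> :: "'c \<times> 'p \<Rightarrow> 'da"
begin

lemma FA_J_Ident [simp]: "c \<in> Obj C \<Longrightarrow> m \<in> Obj P \<Longrightarrow> FA J (Ident C c, Ident P m) = Ident D (FO J (c, m))"
  by (rule FA_Ident_pair[OF B.cfunctor_axioms])

abbreviation J_EM where
  "J_EM \<equiv> comp_fun (prod_cat C (EM P E)) J (prod_fun C (EM P E) (id_fun C) (EM_forget P E))"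

abbreviation H_psi where "H_psi \<equiv> H_mnd C S P E D J \<psi>"

lemma H_psi_simp [simp]:
  "c \<in> Obj C \<Longrightarrow> (m, k) \<in> EM_Obj P E \<Longrightarrow>
    H_psi (c, (m, k)) = FA J (Ident C (FO (MF S) c), k) \<cdot>\<^bsub>D\<^esub> \<psi> (c, m)"
  by (simp add: H_mnd_def)

lemma cfunctor_J_EM: "cfunctor (prod_cat C (EM P E)) D J_EM"
  by (auto intro!: cfunctor_comp_fun[where B = "prod_cat C P"] cfunctor_prod_fun cfunctor_id_fun
      CS.C.category_axioms PE.cfunctor_EM_forget B.cfunctor_axioms)

text \<open>The algebra law exchanges k o mu for k o E k, and naturality of \<open>\<psi>\<close> at
  (1,k) carries E k through, so the multiplication of E disappears and the identity monad remains.
  Naturality holds because arrows of P^E commute with the structure maps.\<close>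

lemma mnd_1cell_H_psi:
  "mnd_1cell (prod_cat C (EM P E)) (prod_mnd C (EM P E) S (id_mnd (EM P E))) D T (J_EM, H_psi)"
proof (rule mnd_1cellI)
  show "monad (prod_cat C (EM P E)) (prod_mnd C (EM P E) S (id_mnd (EM P E)))"
    by (intro monad_prod_mnd CS.monad_axioms monad_id_mnd PE.category_EM)
  show "H_psi \<in> extensional (Obj (prod_cat C (EM P E)))"
    by (simp add: H_mnd_def)
next
  fix z assume "z \<in> Obj (prod_cat C (EM P E))"
  then obtain c m k where z: "z = (c, (m, k))" and [simp]: "c \<in> Obj C" and mk [simp]: "(m, k) \<in> EM_Obj P E"
    by auto
  have [simp]: "m \<in> Obj P" "k \<in> Arr P" "Dom P k = FO (MF E) m" "Cod P k = m"
    and k: "k \<cdot>\<^bsub>P\<^esub> Mult E m = k \<cdot>\<^bsub>P\<^esub> FA (MF E) k" "k \<cdot>\<^bsub>P\<^esub> Eta E m = Ident P m"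
    using mk by (simp_all add: EM_Obj_iff del: mk)
  let ?Sc = "FO (MF S) c"
  show "H_psi z \<in> Arr D \<and> Dom D (H_psi z) = FO (MF T) (FO J_EM z) \<and>
      Cod D (H_psi z) = FO J_EM (FO (MF (prod_mnd C (EM P E) S (id_mnd (EM P E)))) z)"
    by (simp add: z)
  have "H_psi z \<cdot>\<^bsub>D\<^esub> Mult T (FO J (c, m)) = FA J (Mult S c, k \<cdot>\<^bsub>P\<^esub> Mult E m) \<cdot>\<^bsub>D\<^esub>
      (\<psi> (?Sc, FO (MF E) m) \<cdot>\<^bsub>D\<^esub> FA (MF T) (\<psi> (c, m)))"
    using psi_mult[of "(c, m)"] by (simp add: z B.merge)
  also have "\<dots> = FA J (Mult S c, k) \<cdot>\<^bsub>D\<^esub> ((FA J (Ident C (FO (MF S) ?Sc), FA (MF E) k) \<cdot>\<^bsub>D\<^esub>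
      \<psi> (?Sc, FO (MF E) m)) \<cdot>\<^bsub>D\<^esub> FA (MF T) (\<psi> (c, m)))"
    unfolding k by (simp add: B.merge)
  also have "\<dots> = FA J (Mult S c, k) \<cdot>\<^bsub>D\<^esub> ((\<psi> (?Sc, m) \<cdot>\<^bsub>D\<^esub> FA (MF T) (FA J (Ident C ?Sc, k)))
      \<cdot>\<^bsub>D\<^esub> FA (MF T) (\<psi> (c, m)))"
    using psi_nat[of "(Ident C ?Sc, k)" "(?Sc, m)"] by simp
  also have "\<dots> = FA J (Mult S c, Ident P m) \<cdot>\<^bsub>D\<^esub> (H_psi (?Sc, (m, k)) \<cdot>\<^bsub>D\<^esub> FA (MF T) (H_psi z))"
    by (simp add: z T.S.FA_split B.merge)
  finally show "H_psi z \<cdot>\<^bsub>D\<^esub> Mult T (FO J_EM z)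
      = FA J_EM (Mult (prod_mnd C (EM P E) S (id_mnd (EM P E))) z) \<cdot>\<^bsub>D\<^esub>
        (H_psi (FO (MF (prod_mnd C (EM P E) S (id_mnd (EM P E)))) z) \<cdot>\<^bsub>D\<^esub> FA (MF T) (H_psi z))"
    by (simp add: z)
  show "H_psi z \<cdot>\<^bsub>D\<^esub> Eta T (FO J_EM z)
      = FA J_EM (Eta (prod_mnd C (EM P E) S (id_mnd (EM P E))) z)"
    using psi_eta[of "(c, m)"] by (simp add: z B.merge k)
next
  fix v assume "v \<in> Arr (prod_cat C (EM P E))"
  then obtain f m k n l u where v: "v = (f, ((m, k), (n, l), u))" and [simp]: "f \<in> Arr C"
    and u [simp]: "((m, k), (n, l), u) \<in> EM_Arr P E" by auto
  have [simp]: "(m, k) \<in> EM_Obj P E" "(n, l) \<in> EM_Obj P E" "u \<in> Arr P" "Dom P u = m" "Cod P u = n"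
    and uk: "u \<cdot>\<^bsub>P\<^esub> k = l \<cdot>\<^bsub>P\<^esub> FA (MF E) u"
    using u by (simp_all add: EM_Arr_iff del: u)
  then have [simp]: "m \<in> Obj P" "k \<in> Arr P" "Dom P k = FO (MF E) m" "Cod P k = m"
    "n \<in> Obj P" "l \<in> Arr P" "Dom P l = FO (MF E) n" "Cod P l = n"
    by (simp_all add: EM_Obj_iff)
  show "H_psi (Cod (prod_cat C (EM P E)) v) \<cdot>\<^bsub>D\<^esub> FA (MF T) (FA J_EM v)
      = FA J_EM (FA (MF (prod_mnd C (EM P E) S (id_mnd (EM P E)))) v) \<cdot>\<^bsub>D\<^esub>
        H_psi (Dom (prod_cat C (EM P E)) v)"
    using psi_nat[of "(f, u)" "(Cod C f, n)"] by (simp add: v B.merge uk)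
qed (rule T.monad_axioms cfunctor_J_EM)+

text \<open>The left Hopf condition names the target of H in one way, the law of a 1-cell over an
  identity monad in another. Identifying the two functors lets the former serve as the invertibility
  hypothesis of \<open>parametric_mnd_cell\<close>.\<close>

lemma J_EM_S: "comp_fun (prod_cat C (EM P E)) J_EM (prod_fun C (EM P E) (MF S) (id_fun (EM P E)))
    = comp_fun (prod_cat C (EM P E)) J (prod_fun C (EM P E) (MF S) (EM_forget P E))"
proof (rule cfun_eqI)
  show "cfunctor (prod_cat C (EM P E)) D
      (comp_fun (prod_cat C (EM P E)) J_EM (prod_fun C (EM P E) (MF S) (id_fun (EM P E))))"
    by (rule cfunctor_comp_fun[OF cfunctor_prod_fun[OF CS.S.cfunctor_axioms
      cfunctor_id_fun[OF PE.category_EM]] cfunctor_J_EM])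
  show "cfunctor (prod_cat C (EM P E)) D
      (comp_fun (prod_cat C (EM P E)) J (prod_fun C (EM P E) (MF S) (EM_forget P E)))"
    by (rule cfunctor_comp_fun[OF cfunctor_prod_fun[OF CS.S.cfunctor_axioms
      PE.cfunctor_EM_forget] B.cfunctor_axioms])
qed auto

lemma left_hopf_mnd_iff:
  "left_hopf_mnd C S P E D T (J, \<psi>) \<longleftrightarrow>
    invertible_trans (prod_cat C (EM P E)) D (comp_fun (prod_cat C (EM P E)) (MF T) J_EM)
      (comp_fun (prod_cat C (EM P E)) J_EM (prod_fun C (EM P E) (MF S) (id_fun (EM P E)))) H_psi"
  unfolding left_hopf_mnd_def J_EM_S using cell by simp

end

section \<open>Functors lying over J and the 1-cells they induce\<close>

locale functor_lifting = CS: monad C S + PE: monad P E + DT: monad D T +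
  J: cfunctor "prod_cat C P" D J + V: cfunctor "prod_cat (EM C S) (EM P E)" "EM D T" V
  for C :: "('c, 'ca) category" and S :: "('c, 'ca) mnd" and P :: "('p, 'pa) category"
    and E :: "('p, 'pa) mnd" and D :: "('d, 'da) category" and T :: "('d, 'da) mnd"
    and J :: "('c \<times> 'p, 'ca \<times> 'pa, 'd, 'da) cfun"
    and V :: "(('c, 'ca) alg \<times> ('p, 'pa) alg, ('c, 'ca) alg_arr \<times> ('p, 'pa) alg_arr,
        ('d, 'da) alg, ('d, 'da) alg_arr) cfun" +
  assumes lies_over: "comp_fun (prod_cat (EM C S) (EM P E)) (EM_forget D T) V
    = comp_fun (prod_cat (EM C S) (EM P E)) J
        (prod_fun (EM C S) (EM P E) (EM_forget C S) (EM_forget P E))"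
begin

lemma FA_J_Ident [simp]: "c \<in> Obj C \<Longrightarrow> m \<in> Obj P \<Longrightarrow> FA J (Ident C c, Ident P m) = Ident D (FO J (c, m))"
  by (rule FA_Ident_pair[OF J.cfunctor_axioms])

definition action where "action x y = snd (FO V (x, y))"

lemma FO_V_mem: "x \<in> EM_Obj C S \<Longrightarrow> y \<in> EM_Obj P E \<Longrightarrow> FO V (x, y) \<in> EM_Obj D T"
  using V.FO_Obj[of "(x, y)"] by simp

lemma FO_V:
  assumes [simp]: "x \<in> EM_Obj C S" "y \<in> EM_Obj P E"
  shows "FO V (x, y) = (FO J (fst x, fst y), action x y)"
proof -
  have "fst (FO V (x, y)) = FO (comp_fun (prod_cat (EM C S) (EM P E)) (EM_forget D T) V) (x, y)"
    by (simp add: FO_V_mem)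
  then show ?thesis unfolding lies_over by (simp add: action_def prod_eq_iff)
qed

lemma action_Obj:
  assumes "(c, h) \<in> EM_Obj C S" "(m, k) \<in> EM_Obj P E"
  shows "(FO J (c, m), action (c, h) (m, k)) \<in> EM_Obj D T"
  using FO_V_mem[OF assms] FO_V[OF assms] by simp

lemma FA_V:
  assumes [simp]: "(x, x', f) \<in> EM_Arr C S" "(y, y', u) \<in> EM_Arr P E"
  shows "FA V ((x, x', f), (y, y', u)) = (FO V (x, y), FO V (x', y'), FA J (f, u))"
proof -
  let ?v = "((x, x', f), (y, y', u))"
  obtain z z' g where v: "FA V ?v = (z, z', g)" by (cases "FA V ?v") auto
  have mem: "FA V ?v \<in> EM_Arr D T" using V.FA_Arr[of ?v] by simp
  have "FA (EM_forget D T) (FA V ?v)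
      = FA (comp_fun (prod_cat (EM C S) (EM P E)) (EM_forget D T) V) ?v"
    by simp
  then have "g = FA J (f, u)" using mem unfolding lies_over by (simp add: v)
  moreover have "z = FO V (x, y)" "z' = FO V (x', y')"
    using V.Dom_FA[of ?v] V.Cod_FA[of ?v] by (simp_all add: v)
  ultimately show ?thesis by (simp add: v)
qed

text \<open>V sends a pair of homomorphisms to a homomorphism over J(f,u). Every naturality
  statement about the structure maps of V is an instance of this.\<close>

lemma action_hom:
  assumes "((c, h), (c', h'), f) \<in> EM_Arr C S" "((m, k), (m', k'), u) \<in> EM_Arr P E"
  shows "FA J (f, u) \<cdot>\<^bsub>D\<^esub> action (c, h) (m, k) = action (c', h') (m', k') \<cdot>\<^bsub>D\<^esub> FA (MF T) (FA J (f, u))"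
proof -
  have "FA V (((c, h), (c', h'), f), ((m, k), (m', k'), u)) \<in> EM_Arr D T"
    using V.FA_Arr[of "(((c, h), (c', h'), f), ((m, k), (m', k'), u))"] assms by simp
  moreover have "(c, h) \<in> EM_Obj C S" "(c', h') \<in> EM_Obj C S" "(m, k) \<in> EM_Obj P E" "(m', k') \<in> EM_Obj P E"
    using assms by (simp_all add: EM_Arr_iff)
  ultimately show ?thesis
    using assms by (simp add: FA_V FO_V EM_Arr_iff)
qed

abbreviation free_action where
  "free_action c m \<equiv> action (FO (MF S) c, Mult S c) (FO (MF E) m, Mult E m)"

lemma free_action_Obj:
  "c \<in> Obj C \<Longrightarrow> m \<in> Obj P \<Longrightarrow> (FO J (FO (MF S) c, FO (MF E) m), free_action c m) \<in> EM_Obj D T"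
  by (rule action_Obj) simp_all

lemma free_action_Arr [simp]: "c \<in> Obj C \<Longrightarrow> m \<in> Obj P \<Longrightarrow> free_action c m \<in> Arr D"
  and Dom_free_action [simp]: "c \<in> Obj C \<Longrightarrow> m \<in> Obj P \<Longrightarrow>
    Dom D (free_action c m) = FO (MF T) (FO J (FO (MF S) c, FO (MF E) m))"
  and Cod_free_action [simp]: "c \<in> Obj C \<Longrightarrow> m \<in> Obj P \<Longrightarrow>
    Cod D (free_action c m) = FO J (FO (MF S) c, FO (MF E) m)"
  and free_action_mult: "c \<in> Obj C \<Longrightarrow> m \<in> Obj P \<Longrightarrow>
    free_action c m \<cdot>\<^bsub>D\<^esub> Mult T (FO J (FO (MF S) c, FO (MF E) m)) = free_action c m \<cdot>\<^bsub>D\<^esub> FA (MF T) (free_action c m)"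
  and free_action_eta: "c \<in> Obj C \<Longrightarrow> m \<in> Obj P \<Longrightarrow>
    free_action c m \<cdot>\<^bsub>D\<^esub> Eta T (FO J (FO (MF S) c, FO (MF E) m)) = Ident D (FO J (FO (MF S) c, FO (MF E) m))"
  using free_action_Obj[of c m] by (simp_all add: EM_Obj_iff)

lemma free_action_nat:
  assumes "f \<in> Arr C" "u \<in> Arr P"
  shows "free_action (Cod C f) (Cod P u) \<cdot>\<^bsub>D\<^esub> FA (MF T) (FA J (FA (MF S) f, FA (MF E) u))
    = FA J (FA (MF S) f, FA (MF E) u) \<cdot>\<^bsub>D\<^esub> free_action (Dom C f) (Dom P u)"
  by (rule action_hom[symmetric]) (use assms in \<open>simp_all add: EM_Arr_iff CS.mult_nat PE.mult_nat\<close>)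

definition psi_lift where
  "psi_lift = (\<lambda>(c, m)\<in>Obj C \<times> Obj P. free_action c m \<cdot>\<^bsub>D\<^esub> FA (MF T) (FA J (Eta S c, Eta E m)))"

lemma psi_lift_simp [simp]:
  "c \<in> Obj C \<Longrightarrow> m \<in> Obj P \<Longrightarrow> psi_lift (c, m) = free_action c m \<cdot>\<^bsub>D\<^esub> FA (MF T) (FA J (Eta S c, Eta E m))"
  by (simp add: psi_lift_def)

text \<open>The multiplications are homomorphisms from doubly free to free algebras, by
  associativity of S and E.\<close>

lemma free_action_eq:
  assumes [simp]: "c \<in> Obj C" "m \<in> Obj P"
  shows "FA J (Mult S c, Mult E m) \<cdot>\<^bsub>D\<^esub> free_action (FO (MF S) c) (FO (MF E) m)
    = free_action c m \<cdot>\<^bsub>D\<^esub> FA (MF T) (FA J (Mult S c, Mult E m))"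
  by (rule action_hom) (simp_all add: EM_Arr_iff CS.mult_assoc PE.mult_assoc)

text \<open>In other words, \<open>psi_lift\<close> is a homomorphism from the free T-algebra on
  J(c,m). It yields the multiplication law of the 1-cell and also allows \<open>psi_lift\<close> to
  underlie an arrow of D^T.\<close>

lemma psi_lift_mult:
  assumes [simp]: "c \<in> Obj C" "m \<in> Obj P"
  shows "psi_lift (c, m) \<cdot>\<^bsub>D\<^esub> Mult T (FO J (c, m)) = free_action c m \<cdot>\<^bsub>D\<^esub> FA (MF T) (psi_lift (c, m))"
proof -
  have "psi_lift (c, m) \<cdot>\<^bsub>D\<^esub> Mult T (FO J (c, m))
      = (free_action c m \<cdot>\<^bsub>D\<^esub> Mult T (FO J (FO (MF S) c, FO (MF E) m))) \<cdot>\<^bsub>D\<^esub> FA (MF T) (FA (MF T) (FA J (Eta S c, Eta E m)))"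
    by (simp add: DT.mult_nat)
  also have "\<dots> = free_action c m \<cdot>\<^bsub>D\<^esub> FA (MF T) (psi_lift (c, m))"
    unfolding free_action_mult[OF assms] by (simp add: DT.S.FA_split)
  finally show ?thesis .
qed

lemma mnd_1cell_psi_lift: "mnd_1cell (prod_cat C P) (prod_mnd C P S E) D T (J, psi_lift)"
proof (rule mnd_1cellI)
  fix v assume "v \<in> Arr (prod_cat C P)"
  then obtain f u where v: "v = (f, u)" and [simp]: "f \<in> Arr C" "u \<in> Arr P" by auto
  have "psi_lift (Cod C f, Cod P u) \<cdot>\<^bsub>D\<^esub> FA (MF T) (FA J (f, u))
      = (free_action (Cod C f) (Cod P u) \<cdot>\<^bsub>D\<^esub> FA (MF T) (FA J (FA (MF S) f, FA (MF E) u))) \<cdot>\<^bsub>D\<^esub>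
        FA (MF T) (FA J (Eta S (Dom C f), Eta E (Dom P u)))"
    by (simp add: DT.S.merge J.merge CS.eta_nat PE.eta_nat)
  also have "\<dots> = FA J (FA (MF S) f, FA (MF E) u) \<cdot>\<^bsub>D\<^esub> psi_lift (Dom C f, Dom P u)"
    by (subst free_action_nat) simp_all
  finally show "psi_lift (Cod (prod_cat C P) v) \<cdot>\<^bsub>D\<^esub> FA (MF T) (FA J v)
      = FA J (FA (MF (prod_mnd C P S E)) v) \<cdot>\<^bsub>D\<^esub> psi_lift (Dom (prod_cat C P) v)"
    by (simp add: v)
next
  fix z assume "z \<in> Obj (prod_cat C P)"
  then obtain c m where z: "z = (c, m)" and [simp]: "c \<in> Obj C" "m \<in> Obj P" by auto
  let ?Sc = "FO (MF S) c" and ?Em = "FO (MF E) m"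
  have "psi_lift (c, m) \<cdot>\<^bsub>D\<^esub> Mult T (FO J (c, m)) = free_action c m \<cdot>\<^bsub>D\<^esub> FA (MF T) (psi_lift (c, m))"
    by (rule psi_lift_mult) simp_all
  \<comment> \<open>J(mu,mu) after J(eta,eta) at (S c, E m) is an identity, inserted below T so that
    the action of the doubly free algebra, and with it \<open>psi_lift\<close> at (S c, E m), can
    appear.\<close>
  also have "\<dots> = free_action c m \<cdot>\<^bsub>D\<^esub> (FA (MF T) (FA J (Mult S c, Mult E m)) \<cdot>\<^bsub>D\<^esub>
      (FA (MF T) (FA J (Eta S ?Sc, Eta E ?Em)) \<cdot>\<^bsub>D\<^esub> FA (MF T) (psi_lift (c, m))))"
    by (simp add: DT.S.merge J.merge CS.eta_left PE.eta_left)
  also have "\<dots> = (FA J (Mult S c, Mult E m) \<cdot>\<^bsub>D\<^esub> free_action ?Sc ?Em) \<cdot>\<^bsub>D\<^esub>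
      (FA (MF T) (FA J (Eta S ?Sc, Eta E ?Em)) \<cdot>\<^bsub>D\<^esub> FA (MF T) (psi_lift (c, m)))"
    by (subst free_action_eq) simp_all
  finally show "psi_lift z \<cdot>\<^bsub>D\<^esub> Mult T (FO J z) = FA J (Mult (prod_mnd C P S E) z) \<cdot>\<^bsub>D\<^esub>
      (psi_lift (FO (MF (prod_mnd C P S E)) z) \<cdot>\<^bsub>D\<^esub> FA (MF T) (psi_lift z))"
    by (simp add: z)
  show "psi_lift z \<cdot>\<^bsub>D\<^esub> Eta T (FO J z) = FA J (Eta (prod_mnd C P S E) z)"
    using DT.eta_nat[of "FA J (Eta S c, Eta E m)" "FO J (?Sc, ?Em)"]
      DT.C.precomp[OF free_action_eta, of c m "FA J (Eta S c, Eta E m)"] by (simp add: z)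
qed (auto simp: psi_lift_def intro!: monad_prod_mnd CS.monad_axioms PE.monad_axioms DT.monad_axioms
    J.cfunctor_axioms)

sublocale cell: two_variable_mnd_cell C S P E D T J psi_lift
  by unfold_locales (rule mnd_1cell_psi_lift)

text \<open>The structure maps h and k are homomorphisms out of free algebras, so the action is tied
  to the free one by \<open>action_hom\<close>; the unit laws of h and k then remove the extra
  factor.\<close>

lemma action_eq:
  assumes "(c, h) \<in> EM_Obj C S" "(m, k) \<in> EM_Obj P E"
  shows "action (c, h) (m, k) = FA J (h, k) \<cdot>\<^bsub>D\<^esub> psi_lift (c, m)"
proof -
  have [simp]: "c \<in> Obj C" "h \<in> Arr C" "Dom C h = FO (MF S) c" "Cod C h = c" "h \<cdot>\<^bsub>C\<^esub> Eta S c = Ident C c"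
    "m \<in> Obj P" "k \<in> Arr P" "Dom P k = FO (MF E) m" "Cod P k = m" "k \<cdot>\<^bsub>P\<^esub> Eta E m = Ident P m"
    using assms by (simp_all add: EM_Obj_iff)
  have [simp]: "action (c, h) (m, k) \<in> Arr D" "Dom D (action (c, h) (m, k)) = FO (MF T) (FO J (c, m))"
    using action_Obj[OF assms] by (simp_all add: EM_Obj_iff)
  have "FA J (h, k) \<cdot>\<^bsub>D\<^esub> psi_lift (c, m)
      = (FA J (h, k) \<cdot>\<^bsub>D\<^esub> free_action c m) \<cdot>\<^bsub>D\<^esub> FA (MF T) (FA J (Eta S c, Eta E m))"
    by simp
  also have "FA J (h, k) \<cdot>\<^bsub>D\<^esub> free_action c m = action (c, h) (m, k) \<cdot>\<^bsub>D\<^esub> FA (MF T) (FA J (h, k))"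
    by (rule action_hom) (simp_all add: CS.counit_EM_Arr PE.counit_EM_Arr assms)
  finally show ?thesis by (simp add: DT.S.merge J.merge)
qed

end

section \<open>Left Hopf 1-cells\<close>

context functor_lifting
begin

abbreviation free_T where "free_T d \<equiv> (FO (MF T) d, Mult T d)"

abbreviation V_free where
  "V_free c m \<equiv> FO V ((FO (MF S) c, Mult S c), (FO (MF E) m, Mult E m))"

lemma V_free_eq: "c \<in> Obj C \<Longrightarrow> m \<in> Obj P \<Longrightarrow> V_free c m = (FO J (FO (MF S) c, FO (MF E) m), free_action c m)"
  by (simp add: FO_V)

text \<open>An explicit candidate for \<open>lambda_lift\<close>, which is specified only through
  its mate and so needs both existence and uniqueness.\<close>

definition Lam where
  "Lam = (\<lambda>(c, m)\<in>Obj C \<times> Obj P. (free_T (FO J (c, m)), V_free c m, psi_lift (c, m)))"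

lemma Lam_simp: "c \<in> Obj C \<Longrightarrow> m \<in> Obj P \<Longrightarrow>
    Lam (c, m) = (free_T (FO J (c, m)), V_free c m, psi_lift (c, m))"
  by (simp add: Lam_def del: psi_lift_simp)

lemma Lam_Arr: "c \<in> Obj C \<Longrightarrow> m \<in> Obj P \<Longrightarrow>
    (free_T (FO J (c, m)), V_free c m, psi_lift (c, m)) \<in> EM_Arr D T"
  using psi_lift_mult[of c m] free_action_Obj[of c m]
  by (simp add: EM_Arr_iff V_free_eq)

abbreviation free_J where "free_J \<equiv> comp_fun (prod_cat C P) (EM_free D T) J"

abbreviation V_freefree where
  "V_freefree \<equiv> comp_fun (prod_cat C P) V (prod_fun C P (EM_free C S) (EM_free P E))"

lemma cfunctor_free_J: "cfunctor (prod_cat C P) (EM D T) free_J"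
  by (rule cfunctor_comp_fun[OF J.cfunctor_axioms DT.cfunctor_EM_free])

lemma cfunctor_V_freefree: "cfunctor (prod_cat C P) (EM D T) V_freefree"
  by (rule cfunctor_comp_fun[OF cfunctor_prod_fun[OF CS.cfunctor_EM_free PE.cfunctor_EM_free] V.cfunctor_axioms])

lemma nat_trans_Lam: "nat_trans (prod_cat C P) (EM D T) free_J V_freefree Lam"
proof (rule nat_transI)
  fix v assume "v \<in> Arr (prod_cat C P)"
  then obtain f u where v: "v = (f, u)" and [simp]: "f \<in> Arr C" "u \<in> Arr P" by auto
  show "Lam (Cod (prod_cat C P) v) \<cdot>\<^bsub>EM D T\<^esub> FA free_J v = FA V_freefree v \<cdot>\<^bsub>EM D T\<^esub> Lam (Dom (prod_cat C P) v)"
    using cell.psi_nat[of "(f, u)" "(Cod C f, Cod P u)"] by (simp add: v FA_V Lam_simp del: psi_lift_simp)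
qed (auto simp: cfunctor_free_J cfunctor_V_freefree Lam_simp Lam_Arr simp del: psi_lift_simp, simp add: Lam_def)

abbreviation mate_lift where
  "mate_lift \<equiv> mate (prod_cat (EM C S) (EM P E))
       (prod_adj C (EM C S) (EM_adj C S) P (EM P E) (EM_adj P E)) D (EM_adj D T) J V"

abbreviation J_forget where
  "J_forget \<equiv> comp_fun (prod_cat (EM C S) (EM P E)) J
           (prod_fun (EM C S) (EM P E) (EM_forget C S) (EM_forget P E))"

lemma mate_lift_simp:
  assumes "(c, h) \<in> EM_Obj C S" "(m, k) \<in> EM_Obj P E" "l (c, m) = (x, y, g)" "(x, y, g) \<in> EM_Arr D T"
  shows "mate_lift l ((c, h), (m, k)) = FA J (h, k) \<cdot>\<^bsub>D\<^esub> g \<cdot>\<^bsub>D\<^esub> Eta T (FO J (c, m))"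
proof -
  have "(FO V ((FO (MF S) c, Mult S c), (FO (MF E) m, Mult E m)), FO V ((c, h), (m, k)), FA J (h, k)) \<in> EM_Arr D T"
    using V.FA_Arr[of "(((FO (MF S) c, Mult S c), (c, h), h), ((FO (MF E) m, Mult E m), (m, k), k))"] assms
    by (simp add: FA_V CS.counit_EM_Arr PE.counit_EM_Arr)
  then show ?thesis
    using assms by (simp add: mate_def FA_V CS.counit_EM_Arr PE.counit_EM_Arr)
qed

text \<open>The unit law of \<open>psi_lift\<close> turns the mate at ((c,h),(m,k)) into J(h o eta,
  k o eta), an identity by the unit laws of the two algebras.\<close>

lemma mate_Lam:
  "mate_lift Lam = id_trans (prod_cat (EM C S) (EM P E)) D J_forget"
proof (rule extensionalityI[where A = "EM_Obj C S \<times> EM_Obj P E"])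
  fix z assume "z \<in> EM_Obj C S \<times> EM_Obj P E"
  then obtain c h m k where z: "z = ((c, h), (m, k))" and ch: "(c, h) \<in> EM_Obj C S" and mk: "(m, k) \<in> EM_Obj P E"
    by auto
  have [simp]: "c \<in> Obj C" "h \<in> Arr C" "Dom C h = FO (MF S) c" "Cod C h = c" "h \<cdot>\<^bsub>C\<^esub> Eta S c = Ident C c"
    "m \<in> Obj P" "k \<in> Arr P" "Dom P k = FO (MF E) m" "Cod P k = m" "k \<cdot>\<^bsub>P\<^esub> Eta E m = Ident P m"
    using ch mk by (simp_all add: EM_Obj_iff)
  have "mate_lift Lam z = FA J (h, k) \<cdot>\<^bsub>D\<^esub> psi_lift (c, m) \<cdot>\<^bsub>D\<^esub> Eta T (FO J (c, m))"
    unfolding z by (rule mate_lift_simp[where l = Lam, OF ch mk Lam_simp[of c m] Lam_Arr[of c m]]) simp_all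
  then show "mate_lift Lam z = id_trans (prod_cat (EM C S) (EM P E)) D J_forget z"
    using cell.psi_eta[of "(c, m)"] ch mk by (simp add: z J.merge del: psi_lift_simp)
qed (simp_all add: mate_def id_trans_def)

text \<open>The mate condition controls the component at (S c, E m) on units, naturality at
  (eta,eta) carries this back to (c,m), and a homomorphism out of a free algebra is determined along
  the unit.\<close>

lemma Lam_unique:
  assumes "nat_trans (prod_cat C P) (EM D T) free_J V_freefree l"
    and mate: "mate_lift l = id_trans (prod_cat (EM C S) (EM P E)) D J_forget"
  shows "l = Lam"
proof (rule extensionalityI[where A = "Obj C \<times> Obj P"])
  interpret l: nat_trans "prod_cat C P" "EM D T" free_J V_freefree l by fact
  have l_eq: "l (c, m) = (free_T (FO J (c, m)), V_free c m, snd (snd (l (c, m))))"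
    and l_Arr: "(free_T (FO J (c, m)), V_free c m, snd (snd (l (c, m)))) \<in> EM_Arr D T"
    if "c \<in> Obj C" "m \<in> Obj P" for c m
  proof -
    obtain x y g where xyg: "l (c, m) = (x, y, g)" by (cases "l (c, m)") auto
    show "l (c, m) = (free_T (FO J (c, m)), V_free c m, snd (snd (l (c, m))))"
      using l.Dom[of "(c, m)"] l.Cod[of "(c, m)"] that by (simp add: xyg)
    then show "(free_T (FO J (c, m)), V_free c m, snd (snd (l (c, m)))) \<in> EM_Arr D T"
      using l.Arr[of "(c, m)"] that by simp
  qed
  show "l \<in> extensional (Obj C \<times> Obj P)" using l.ext by simp
  fix z assume "z \<in> Obj C \<times> Obj P"
  then obtain c m where z: "z = (c, m)" and [simp]: "c \<in> Obj C" "m \<in> Obj P" by auto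
  let ?Sc = "FO (MF S) c" and ?Em = "FO (MF E) m"
  define g where "g = snd (snd (l (c, m)))"
  define g' where "g' = snd (snd (l (?Sc, ?Em)))"
  have lg: "l (c, m) = (free_T (FO J (c, m)), V_free c m, g)"
    unfolding g_def by (rule l_eq) simp_all
  have lg': "l (?Sc, ?Em) = (free_T (FO J (?Sc, ?Em)), V_free ?Sc ?Em, g')"
    unfolding g'_def by (rule l_eq) simp_all
  have g_Arr: "(free_T (FO J (c, m)), V_free c m, g) \<in> EM_Arr D T"
    unfolding g_def by (rule l_Arr) simp_all
  have g'_Arr: "(free_T (FO J (?Sc, ?Em)), V_free ?Sc ?Em, g') \<in> EM_Arr D T"
    unfolding g'_def by (rule l_Arr) simp_all
  have [simp]: "g \<in> Arr D" "Dom D g = FO (MF T) (FO J (c, m))" "Cod D g = FO J (?Sc, ?Em)"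
    "g' \<in> Arr D" "Dom D g' = FO (MF T) (FO J (?Sc, ?Em))" "Cod D g' = FO J (FO (MF S) ?Sc, FO (MF E) ?Em)"
    and g_hom: "g \<cdot>\<^bsub>D\<^esub> Mult T (FO J (c, m)) = free_action c m \<cdot>\<^bsub>D\<^esub> FA (MF T) g"
    using g_Arr g'_Arr by (simp_all add: EM_Arr_iff V_free_eq)
  have nat: "g' \<cdot>\<^bsub>D\<^esub> FA (MF T) (FA J (Eta S c, Eta E m)) = FA J (FA (MF S) (Eta S c), FA (MF E) (Eta E m)) \<cdot>\<^bsub>D\<^esub> g"
    using l.nat[of "(Eta S c, Eta E m)"] by (simp add: lg lg' FA_V)
  \<comment> \<open>The mate condition is read at the free algebras on c and m, whose structure maps
    are the multiplications.\<close>
  have unit: "FA J (Mult S c, Mult E m) \<cdot>\<^bsub>D\<^esub> (g' \<cdot>\<^bsub>D\<^esub> Eta T (FO J (?Sc, ?Em))) = Ident D (FO J (?Sc, ?Em))"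
    using mate_lift_simp[of ?Sc "Mult S c" ?Em "Mult E m" l, OF _ _ lg' g'_Arr] by (simp add: mate)
  have "g \<cdot>\<^bsub>D\<^esub> Eta T (FO J (c, m)) = FA J (Mult S c, Mult E m) \<cdot>\<^bsub>D\<^esub>
      ((FA J (FA (MF S) (Eta S c), FA (MF E) (Eta E m)) \<cdot>\<^bsub>D\<^esub> g) \<cdot>\<^bsub>D\<^esub> Eta T (FO J (c, m)))"
    by (simp add: J.merge CS.eta_right PE.eta_right)
  also have "\<dots> = FA J (Mult S c, Mult E m) \<cdot>\<^bsub>D\<^esub> (g' \<cdot>\<^bsub>D\<^esub> (Eta T (FO J (?Sc, ?Em)) \<cdot>\<^bsub>D\<^esub> FA J (Eta S c, Eta E m)))"
    unfolding nat[symmetric] by (simp add: DT.eta_nat)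
  also have "\<dots> = FA J (Eta S c, Eta E m)"
    using DT.C.precomp[OF unit, of "FA J (Eta S c, Eta E m)"] by simp
  finally have g_eta: "g \<cdot>\<^bsub>D\<^esub> Eta T (FO J (c, m)) = FA J (Eta S c, Eta E m)" .
  \<comment> \<open>Inserting mu o T eta = 1 and applying the homomorphism law leaves an expression
    in g o eta only.\<close>
  have "g = (g \<cdot>\<^bsub>D\<^esub> Mult T (FO J (c, m))) \<cdot>\<^bsub>D\<^esub> FA (MF T) (Eta T (FO J (c, m)))"
    by (simp add: DT.eta_right)
  also have "\<dots> = psi_lift (c, m)"
    unfolding g_hom by (simp add: DT.S.merge g_eta)
  finally show "l z = Lam z"
    by (simp add: z lg Lam_simp)
qed (simp add: Lam_def)

lemma lambda_lift_eq: "lambda_lift C S P E D T J V = Lam"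
  unfolding lambda_lift_def
  by (rule the_equality) (rule conjI nat_trans_Lam mate_Lam | erule conjE Lam_unique | assumption)+

text \<open>The mate is an identity transformation and so its own inverse; \<open>lies_over\<close>
  identifies its two ends.\<close>

lemma adjR_1cell_Lam:
  "adjR_1cell (prod_cat C P) (prod_cat (EM C S) (EM P E))
    (prod_adj C (EM C S) (EM_adj C S) P (EM P E) (EM_adj P E)) D (EM D T) (EM_adj D T) J V Lam"
proof -
  have "cfunctor (prod_cat (EM C S) (EM P E)) D J_forget"
    by (rule cfunctor_comp_fun[OF cfunctor_prod_fun[OF CS.cfunctor_EM_forget PE.cfunctor_EM_forget]
      J.cfunctor_axioms])
  then interpret F: cfunctor "prod_cat (EM C S) (EM P E)" D J_forget .
  have "invertible_trans (prod_cat (EM C S) (EM P E)) D J_forget J_forget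
      (id_trans (prod_cat (EM C S) (EM P E)) D J_forget)"
    unfolding invertible_trans_iff
    using nat_trans_id_trans[OF F.cfunctor_axioms] F.FO_Obj
    by (auto intro!: bexI[where x = "Ident D _"] simp del: comp_fun_simps)
  then show ?thesis
    using nat_trans_Lam
    by (simp add: adjR_1cell_def mate_Lam lies_over adjunction_prod_adj CS.adjunction_EM_adj
        PE.adjunction_EM_adj DT.adjunction_EM_adj J.cfunctor_axioms V.cfunctor_axioms)
qed

abbreviation H_Lam where "H_Lam \<equiv> H_adj C (EM C S) (EM_adj C S) (EM P E) (EM_adj P E) (EM D T) V Lam"

abbreviation V_free_left where
  "V_free_left \<equiv> comp_fun (prod_cat C (EM P E)) V (prod_fun C (EM P E) (EM_free C S) (id_fun (EM P E)))"

lemma H_Lam_simp: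
  assumes [simp]: "c \<in> Obj C" and mk: "(m, k) \<in> EM_Obj P E"
  shows "H_Lam (c, (m, k)) =
    (free_T (FO J (c, m)), FO V ((FO (MF S) c, Mult S c), (m, k)), cell.H_psi (c, (m, k)))"
    and "H_Lam (c, (m, k)) \<in> EM_Arr D T"
proof -
  have [simp]: "m \<in> Obj P" "k \<in> Arr P" "Dom P k = FO (MF E) m" "Cod P k = m"
    using mk by (simp_all add: EM_Obj_iff)
  let ?v = "(((FO (MF S) c, Mult S c), (FO (MF S) c, Mult S c), Ident C (FO (MF S) c)),
      ((FO (MF E) m, Mult E m), (m, k), k))"
  have v: "FA V ?v = (V_free c m, FO V ((FO (MF S) c, Mult S c), (m, k)), FA J (Ident C (FO (MF S) c), k))"
    using mk by (simp add: FA_V PE.counit_EM_Arr)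
  have "FA V ?v \<in> EM_Arr D T"
    using V.FA_Arr[of ?v] mk by (simp add: PE.counit_EM_Arr)
  moreover have eq: "H_Lam (c, (m, k)) = FA V ?v \<cdot>\<^bsub>EM D T\<^esub> Lam (c, m)"
    using mk by (simp add: H_adj_def)
  ultimately show "H_Lam (c, (m, k)) \<in> EM_Arr D T"
    unfolding eq v using Lam_Arr[of c m] by (auto simp: Lam_simp intro: DT.EM_Comp_Arr)
  show "H_Lam (c, (m, k)) =
    (free_T (FO J (c, m)), FO V ((FO (MF S) c, Mult S c), (m, k)), cell.H_psi (c, (m, k)))"
    unfolding eq v using mk by (simp add: Lam_simp)
qed

abbreviation free_J_EM where "free_J_EM \<equiv> comp_fun (prod_cat C (EM P E)) (EM_free D T) cell.J_EM"

text \<open>On triples only the third components need an argument, and there the square is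
  naturality of H(\<open>psi_lift\<close>), known from its being a 1-cell.\<close>

lemma nat_trans_H_Lam: "nat_trans (prod_cat C (EM P E)) (EM D T) free_J_EM V_free_left H_Lam"
proof (rule nat_transI)
  show "cfunctor (prod_cat C (EM P E)) (EM D T) free_J_EM"
    by (rule cfunctor_comp_fun[OF cell.cfunctor_J_EM DT.cfunctor_EM_free])
  show "cfunctor (prod_cat C (EM P E)) (EM D T) V_free_left"
    by (rule cfunctor_comp_fun[OF cfunctor_prod_fun[OF CS.cfunctor_EM_free
      cfunctor_id_fun[OF PE.category_EM]] V.cfunctor_axioms])
  show "H_Lam \<in> extensional (Obj (prod_cat C (EM P E)))"
    by (simp add: H_adj_def)
next
  fix z assume "z \<in> Obj (prod_cat C (EM P E))"
  then obtain c m k where z: "z = (c, (m, k))" and "c \<in> Obj C" "(m, k) \<in> EM_Obj P E" by auto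
  moreover from this have "m \<in> Obj P" by (simp add: EM_Obj_iff)
  ultimately show "H_Lam z \<in> Arr (EM D T) \<and> Dom (EM D T) (H_Lam z) = FO free_J_EM z \<and>
      Cod (EM D T) (H_Lam z) = FO V_free_left z"
    using H_Lam_simp[of c m k] by (simp del: cell.H_psi_simp)
next
  interpret H: mnd_cell "prod_cat C (EM P E)" "prod_mnd C (EM P E) S (id_mnd (EM P E))" D T cell.J_EM cell.H_psi
    by unfold_locales (rule cell.mnd_1cell_H_psi)
  fix v assume "v \<in> Arr (prod_cat C (EM P E))"
  then obtain f m k n l u where v: "v = (f, ((m, k), (n, l), u))" and [simp]: "f \<in> Arr C"
    and u [simp]: "((m, k), (n, l), u) \<in> EM_Arr P E" by auto
  have [simp]: "(m, k) \<in> EM_Obj P E" "(n, l) \<in> EM_Obj P E"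
    using u by (simp_all add: EM_Arr_iff del: u)
  have mem: "(f, u) \<in> Arr (prod_cat C P)" and [simp]: "Dom P u = m" "Cod P u = n"
    using u by (simp_all add: EM_Arr_iff del: u)
  show "H_Lam (Cod (prod_cat C (EM P E)) v) \<cdot>\<^bsub>EM D T\<^esub> FA free_J_EM v
      = FA V_free_left v \<cdot>\<^bsub>EM D T\<^esub> H_Lam (Dom (prod_cat C (EM P E)) v)"
    using H.psi_nat[of v "(Cod C f, (n, l))"] mem
    by (simp add: v H_Lam_simp FA_V del: cell.H_psi_simp)
qed

lemma left_hopf_adj_iff:
  "left_hopf_adj C (EM C S) (EM_adj C S) P (EM P E) (EM_adj P E) D (EM D T) (EM_adj D T)
       J V (lambda_lift C S P E D T J V) \<longleftrightarrow> left_hopf_mnd C S P E D T (J, psi_lift)"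
proof -
  interpret H: mnd_cell "prod_cat C (EM P E)" "prod_mnd C (EM P E) S (id_mnd (EM P E))" D T cell.J_EM cell.H_psi
    by unfold_locales (rule cell.mnd_1cell_H_psi)
  \<comment> \<open>Invertibility is compared component by component: an inverse homomorphism is
    stripped to its underlying arrow, and conversely an inverse arrow of D is made a homomorphism by
    \<open>EM_inverse_Arr\<close>.\<close>
  have iso: "(\<exists>g\<in>hom (EM D T) (FO V_free_left z) (FO free_J_EM z).
        g \<cdot>\<^bsub>EM D T\<^esub> H_Lam z = Ident (EM D T) (FO free_J_EM z) \<and> H_Lam z \<cdot>\<^bsub>EM D T\<^esub> g = Ident (EM D T) (FO V_free_left z))
     \<longleftrightarrow> (\<exists>g\<in>hom D (FO J (FO (MF S) c, m)) (FO (MF T) (FO J (c, m))).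
        g \<cdot>\<^bsub>D\<^esub> cell.H_psi z = Ident D (FO (MF T) (FO J (c, m))) \<and>
        cell.H_psi z \<cdot>\<^bsub>D\<^esub> g = Ident D (FO J (FO (MF S) c, m)))" (is "?L \<longleftrightarrow> ?R")
    if z: "z = (c, (m, k))" and [simp]: "c \<in> Obj C" and mk [simp]: "(m, k) \<in> EM_Obj P E" for z c m k
  proof
    have [simp]: "m \<in> Obj P" using mk by (simp add: EM_Obj_iff del: mk)
    assume ?L
    then obtain g where g: "g \<in> hom (EM D T) (FO V_free_left z) (FO free_J_EM z)"
      "g \<cdot>\<^bsub>EM D T\<^esub> H_Lam z = Ident (EM D T) (FO free_J_EM z)" "H_Lam z \<cdot>\<^bsub>EM D T\<^esub> g = Ident (EM D T) (FO V_free_left z)"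
      by blast
    obtain x y g' where xy: "g = (x, y, g')" by (cases g) auto
    show ?R
      by (rule bexI[of _ g']) (use g in \<open>simp_all add: z xy H_Lam_simp FO_V EM_Arr_iff del: cell.H_psi_simp\<close>)
  next
    have [simp]: "m \<in> Obj P" using mk by (simp add: EM_Obj_iff del: mk)
    assume ?R
    then obtain g where g: "g \<in> hom D (FO J (FO (MF S) c, m)) (FO (MF T) (FO J (c, m)))"
      "g \<cdot>\<^bsub>D\<^esub> cell.H_psi z = Ident D (FO (MF T) (FO J (c, m)))"
      "cell.H_psi z \<cdot>\<^bsub>D\<^esub> g = Ident D (FO J (FO (MF S) c, m))"
      by blast
    have "(FO V ((FO (MF S) c, Mult S c), (m, k)), free_T (FO J (c, m)), g) \<in> EM_Arr D T"
      by (rule EM_inverse_Arr[OF DT.monad_axioms, where f = "cell.H_psi z"])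
        (use g H_Lam_simp[of c m k] in \<open>simp_all add: z FO_V del: cell.H_psi_simp\<close>)
    then show ?L
      by (intro bexI[of _ "(FO V ((FO (MF S) c, Mult S c), (m, k)), free_T (FO J (c, m)), g)"])
        (use g in \<open>simp_all add: z H_Lam_simp FO_V del: cell.H_psi_simp\<close>)
  qed
  have "(\<forall>z\<in>Obj (prod_cat C (EM P E)). \<exists>g\<in>hom (EM D T) (FO V_free_left z) (FO free_J_EM z).
        g \<cdot>\<^bsub>EM D T\<^esub> H_Lam z = Ident (EM D T) (FO free_J_EM z) \<and> H_Lam z \<cdot>\<^bsub>EM D T\<^esub> g = Ident (EM D T) (FO V_free_left z))
    \<longleftrightarrow> invertible_trans (prod_cat C (EM P E)) D (comp_fun (prod_cat C (EM P E)) (MF T) cell.J_EM)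
      (comp_fun (prod_cat C (EM P E)) cell.J_EM (prod_fun C (EM P E) (MF S) (id_fun (EM P E)))) cell.H_psi"
    unfolding invertible_trans_iff using H.psi_trans iso by (fastforce simp del: cell.H_psi_simp)
  then show ?thesis
    unfolding left_hopf_adj_def lambda_lift_eq cell.left_hopf_mnd_iff invertible_trans_iff[where B = "EM D T"]
    using adjR_1cell_Lam nat_trans_H_Lam by simp
qed

end

section \<open>Algebra structures along an adjoint object\<close>

context mnd_left_adjoint
begin

interpretation K: mnd_cell D T C S "RightF A" ad_psi
  by unfold_locales (rule mnd_1cell_ad_psi)

text \<open>The target is M carried first along the left and then along the right 1-cell. The square
  is the 2-cell law of the unit, composed with R L k.\<close>

lemma unit_EM_Arr:
  assumes Mk: "(M, k) \<in> EM_Obj C S"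
  shows "((M, k), (FO (RightF A) (FO (LeftF A) M),
      FA (RightF A) (FA (LeftF A) k \<cdot>\<^bsub>D\<^esub> \<psi> M) \<cdot>\<^bsub>C\<^esub> ad_psi (FO (LeftF A) M)), Unit A M) \<in> EM_Arr C S"
proof -
  have [simp]: "M \<in> Obj C" "k \<in> Arr C" "Dom C k = FO (MF S) M" "Cod C k = M"
    using Mk by (simp_all add: EM_Obj_iff)
  have unit: "(FA (RightF A) (\<psi> M) \<cdot>\<^bsub>C\<^esub> ad_psi (FO (LeftF A) M)) \<cdot>\<^bsub>C\<^esub> FA (MF S) (Unit A M) = Unit A (FO (MF S) M)"
    using mnd_adjoint_ad_psi by (simp add: mnd_adjoint_def mnd_2cell_def mnd_id_def mnd_comp_def)
  have "(FA (RightF A) (FA (LeftF A) k \<cdot>\<^bsub>D\<^esub> \<psi> M) \<cdot>\<^bsub>C\<^esub> ad_psi (FO (LeftF A) M)) \<cdot>\<^bsub>C\<^esub> FA (MF S) (Unit A M)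
      = FA (RightF A) (FA (LeftF A) k) \<cdot>\<^bsub>C\<^esub> Unit A (FO (MF S) M)"
    unfolding unit[symmetric] by (simp add: R.FA_split)
  also have "\<dots> = Unit A M \<cdot>\<^bsub>C\<^esub> k"
    using unit_nat[of k M] by simp
  finally show ?thesis
    using K.alg_EM_Obj[OF alg_EM_Obj[OF Mk]] Mk by (simp add: EM_Arr_iff)
qed

lemma counit_EM_Arr:
  assumes dl: "(d, l) \<in> EM_Obj D T"
  shows "((FO (LeftF A) (FO (RightF A) d),
      FA (LeftF A) (FA (RightF A) l \<cdot>\<^bsub>C\<^esub> ad_psi d) \<cdot>\<^bsub>D\<^esub> \<psi> (FO (RightF A) d)), (d, l), Counit A d) \<in> EM_Arr D T"
proof -
  have [simp]: "d \<in> Obj D" "l \<in> Arr D" "Dom D l = FO (MF T) d" "Cod D l = d"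
    using dl by (simp_all add: EM_Obj_iff)
  have "Counit A d \<cdot>\<^bsub>D\<^esub> (FA (LeftF A) (FA (RightF A) l \<cdot>\<^bsub>C\<^esub> ad_psi d) \<cdot>\<^bsub>D\<^esub> \<psi> (FO (RightF A) d))
      = l \<cdot>\<^bsub>D\<^esub> FA (MF T) (Counit A d)"
    by (simp add: L.FA_split counit_nat_comp transpose_ad_psi_comp psi_inv_left)
  then show ?thesis
    using alg_EM_Obj[OF K.alg_EM_Obj[OF dl]] dl by (simp add: EM_Arr_iff)
qed

text \<open>The homomorphism square of the counit prescribes eps o L b o \<open>\<psi>\<close>.
  Since \<open>\<psi>\<close> is invertible this fixes the transpose of b, and hence b.\<close>

lemma right_action_unique:
  assumes "b \<in> hom C (FO (MF S) (FO (RightF A) d)) (FO (RightF A) d)"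
    and "((FO (LeftF A) (FO (RightF A) d), FA (LeftF A) b \<cdot>\<^bsub>D\<^esub> \<psi> (FO (RightF A) d)), (d, l), Counit A d) \<in> EM_Arr D T"
  shows "b = FA (RightF A) l \<cdot>\<^bsub>C\<^esub> ad_psi d"
proof -
  have dl: "(d, l) \<in> EM_Obj D T" using assms by (simp add: EM_Arr_iff)
  then have [simp]: "d \<in> Obj D" "l \<in> Arr D" "Dom D l = FO (MF T) d" "Cod D l = d"
    by (simp_all add: EM_Obj_iff)
  have [simp]: "b \<in> Arr C" "Dom C b = FO (MF S) (FO (RightF A) d)" "Cod C b = FO (RightF A) d"
    using assms by simp_all
  have b: "Counit A d \<cdot>\<^bsub>D\<^esub> (FA (LeftF A) b \<cdot>\<^bsub>D\<^esub> \<psi> (FO (RightF A) d)) = l \<cdot>\<^bsub>D\<^esub> FA (MF T) (Counit A d)"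
    using assms(2) by (simp add: EM_Arr_iff)
  show ?thesis
  proof (rule transpose_inj[where x = d])
    have "Counit A d \<cdot>\<^bsub>D\<^esub> FA (LeftF A) b
        = (Counit A d \<cdot>\<^bsub>D\<^esub> (FA (LeftF A) b \<cdot>\<^bsub>D\<^esub> \<psi> (FO (RightF A) d))) \<cdot>\<^bsub>D\<^esub> psi_inv (FO (RightF A) d)"
      by (simp add: psi_inv_right)
    also have "\<dots> = Counit A d \<cdot>\<^bsub>D\<^esub> FA (LeftF A) (FA (RightF A) l \<cdot>\<^bsub>C\<^esub> ad_psi d)"
      unfolding b by (simp add: L.FA_split counit_nat_comp transpose_ad_psi)
    finally show "Counit A d \<cdot>\<^bsub>D\<^esub> FA (LeftF A) b
        = Counit A d \<cdot>\<^bsub>D\<^esub> FA (LeftF A) (FA (RightF A) l \<cdot>\<^bsub>C\<^esub> ad_psi d)" .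
  qed simp_all
qed

end

text \<open>An object of Y is an algebra of the identity monad by its identity arrow. Pairing it
  with an algebra, in either order, allows 1-cells with inert parameter to transport algebras in the
  remaining variable.\<close>

lemma EM_pair_Obj:
  assumes "monad C S" and "category Y" and "(c, h) \<in> EM_Obj C S" and "y \<in> Obj Y"
  shows "((c, y), (h, Ident Y y)) \<in> EM_Obj (prod_cat C Y) (prod_mnd C Y S (id_mnd Y))"
    and "((y, c), (Ident Y y, h)) \<in> EM_Obj (prod_cat Y C) (prod_mnd Y C (id_mnd Y) S)"
proof -
  interpret S: monad C S by fact
  interpret Y: category Y by fact
  show "((c, y), (h, Ident Y y)) \<in> EM_Obj (prod_cat C Y) (prod_mnd C Y S (id_mnd Y))"
    and "((y, c), (Ident Y y, h)) \<in> EM_Obj (prod_cat Y C) (prod_mnd Y C (id_mnd Y) S)"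
    using assms(3,4) by (simp_all add: EM_Obj_iff)
qed

lemma EM_pair_Arr:
  assumes "monad C S" and "category Y" and "((c, h), (c', h'), f) \<in> EM_Arr C S" and "u \<in> Arr Y"
  shows "(((c, Dom Y u), (h, Ident Y (Dom Y u))), ((c', Cod Y u), (h', Ident Y (Cod Y u))), (f, u))
      \<in> EM_Arr (prod_cat C Y) (prod_mnd C Y S (id_mnd Y))"
    and "(((Dom Y u, c), (Ident Y (Dom Y u), h)), ((Cod Y u, c'), (Ident Y (Cod Y u), h')), (u, f))
      \<in> EM_Arr (prod_cat Y C) (prod_mnd Y C (id_mnd Y) S)"
proof -
  interpret S: monad C S by fact
  interpret Y: category Y by fact
  have "(c, h) \<in> EM_Obj C S" "(c', h') \<in> EM_Obj C S"
    using assms(3) by (simp_all add: EM_Arr_iff)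
  then show "(((c, Dom Y u), (h, Ident Y (Dom Y u))), ((c', Cod Y u), (h', Ident Y (Cod Y u))), (f, u))
      \<in> EM_Arr (prod_cat C Y) (prod_mnd C Y S (id_mnd Y))"
    and "(((Dom Y u, c), (Ident Y (Dom Y u), h)), ((Cod Y u, c'), (Ident Y (Cod Y u), h')), (u, f))
      \<in> EM_Arr (prod_cat Y C) (prod_mnd Y C (id_mnd Y) S)"
    using assms(3,4) EM_pair_Obj[OF assms(1,2)] by (simp_all add: EM_Arr_iff)
qed

text \<open>A common constructor for both lifted functors. That the attached maps are algebra
  structures and that G yields homomorphisms is left to the hypotheses of
  \<open>EM_lift_functor\<close>.\<close>

definition EM_lift :: "('o, 'a) category \<Rightarrow> ('o, 'a, 'p, 'b) cfun \<Rightarrow> ('o \<Rightarrow> 'b)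
    \<Rightarrow> ('o, 'a, ('p, 'b) alg, ('p, 'b) alg_arr) cfun" where
  "EM_lift A G \<alpha> = \<lparr>FO = (\<lambda>x\<in>Obj A. (FO G x, \<alpha> x)),
     FA = (\<lambda>f\<in>Arr A. ((FO G (Dom A f), \<alpha> (Dom A f)), (FO G (Cod A f), \<alpha> (Cod A f)), FA G f))\<rparr>"

lemma EM_lift_simps [simp]:
  "x \<in> Obj A \<Longrightarrow> FO (EM_lift A G \<alpha>) x = (FO G x, \<alpha> x)"
  "f \<in> Arr A \<Longrightarrow> FA (EM_lift A G \<alpha>) f
    = ((FO G (Dom A f), \<alpha> (Dom A f)), (FO G (Cod A f), \<alpha> (Cod A f)), FA G f)"
  by (simp_all add: EM_lift_def)

lemma EM_lift_functor:
  assumes "cfunctor A D G" and "monad D T"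
    and "\<And>x. x \<in> Obj A \<Longrightarrow> (FO G x, \<alpha> x) \<in> EM_Obj D T"
    and "\<And>f. f \<in> Arr A \<Longrightarrow>
      ((FO G (Dom A f), \<alpha> (Dom A f)), (FO G (Cod A f), \<alpha> (Cod A f)), FA G f) \<in> EM_Arr D T"
  shows "cfunctor A (EM D T) (EM_lift A G \<alpha>)"
    and "comp_fun A (EM_forget D T) (EM_lift A G \<alpha>) = G"
proof -
  interpret G: cfunctor A D G by fact
  interpret T: monad D T by fact
  show *: "cfunctor A (EM D T) (EM_lift A G \<alpha>)"
    by (rule cfunctorI) (auto simp: assms(3,4) G.FA_split G.A.category_axioms T.category_EM, auto simp: EM_lift_def)
  show "comp_fun A (EM_forget D T) (EM_lift A G \<alpha>) = G"
    by (rule cfun_eqI[OF cfunctor_comp_fun[OF * T.cfunctor_EM_forget] assms(1)]) (simp_all add: assms(3,4))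
qed

text \<open>A lifting of G has freedom only in its structure maps: an arrow of D^T consists of its
  endpoints and an underlying arrow, and the latter is prescribed by G.\<close>

lemma EM_lifting_determined:
  assumes "cfunctor A (EM D T) V" and "comp_fun A (EM_forget D T) V = G" and "monad D T"
  shows "x \<in> Obj A \<Longrightarrow> fst (FO V x) = FO G x"
    and "f \<in> Arr A \<Longrightarrow> FA V f = (FO V (Dom A f), FO V (Cod A f), FA G f)"
proof -
  interpret V: cfunctor A "EM D T" V by fact
  show "fst (FO V x) = FO G x" if "x \<in> Obj A"
    using that V.FO_Obj[OF that] by (simp add: assms(2)[symmetric])
  show "FA V f = (FO V (Dom A f), FO V (Cod A f), FA G f)" if f: "f \<in> Arr A"
  proof -
    obtain x y g where xyg: "FA V f = (x, y, g)" by (cases "FA V f") auto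
    then show ?thesis
      using f V.FA_Arr[OF f] V.Dom_FA[OF f] V.Cod_FA[OF f] by (simp add: assms(2)[symmetric])
  qed
qed

text \<open>Functoriality of J(-,p) is needed before any adjunction is available, since
  \<open>adjunctionI\<close> asks for it when the lifted adjunctions are built.\<close>

lemma cfunctor_J_at:
  assumes J: "cfunctor (prod_cat C P) D J" and "category C" and "category P" and p: "p \<in> Obj P"
  shows "cfunctor C D (J_at C P J p)"
proof -
  interpret J: cfunctor "prod_cat C P" D J by fact
  interpret C: category C by fact
  interpret P: category P by fact
  have split: "FA J (g \<cdot>\<^bsub>C\<^esub> f, Ident P p) = FA J (g, Ident P p) \<cdot>\<^bsub>D\<^esub> FA J (f, Ident P p)"
    if "f \<in> Arr C" "g \<in> Arr C" "Cod C f = Dom C g" for f g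
    using J.FA_split[of "(f, Ident P p)" "(g, Ident P p)"] that p by simp
  show ?thesis
    by (rule cfunctorI)
      (auto simp: C.category_axioms J.B.category_axioms p split FA_Ident_pair[OF J], auto simp: J_at_def)
qed

lemma cfunctor_K_at:
  assumes K: "cfunctor (prod_cat (op_cat P) D) C K" and "category D" and "category P" and p: "p \<in> Obj P"
  shows "cfunctor D C (K_at P D K p)"
proof -
  interpret K: cfunctor "prod_cat (op_cat P) D" C K by fact
  interpret D: category D by fact
  interpret P: category P by fact
  have split: "FA K (Ident P p, g \<cdot>\<^bsub>D\<^esub> f) = FA K (Ident P p, g) \<cdot>\<^bsub>C\<^esub> FA K (Ident P p, f)"
    if "f \<in> Arr D" "g \<in> Arr D" "Cod D f = Dom D g" for f g
    using K.FA_split[of "(Ident P p, f)" "(Ident P p, g)"] that p by simp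
  show ?thesis
    by (rule cfunctorI)
      (auto simp: D.category_axioms K.B.category_axioms p split FA_Ident_pair[OF K, simplified], auto simp: K_at_def)
qed

section \<open>Liftings of parametric adjunctions\<close>

locale monadic_parametric_adjunction =
  CS: monad C S + DT: monad D T + PE: monad P E + Q: parametric_adjunction C P D Q
  for C :: "('c, 'ca) category" and S :: "('c, 'ca) mnd"
    and D :: "('d, 'da) category" and T :: "('d, 'da) mnd"
    and P :: "('p, 'pa) category" and E :: "('p, 'pa) mnd"
    and Q :: "('c, 'ca, 'p, 'pa, 'd, 'da) param_adj"
begin

abbreviation QE where "QE \<equiv> reparam C D (EM P E) (EM_forget P E) Q"

abbreviation H where "H \<psi> \<equiv> H_mnd C S P E D (PJ Q) \<psi>"

abbreviation left_hopf where "left_hopf \<psi> \<equiv> left_hopf_mnd C S P E D T (PJ Q, \<psi>)"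

abbreviation JU where
  "JU \<equiv> comp_fun (prod_cat (EM C S) (EM P E)) (PJ Q)
     (prod_fun (EM C S) (EM P E) (EM_forget C S) (EM_forget P E))"

abbreviation KU where
  "KU \<equiv> comp_fun (prod_cat (op_cat (EM P E)) (EM D T)) (PK Q)
     (prod_fun (op_cat (EM P E)) (EM D T) (EM_forget P E) (EM_forget D T))"

text \<open>\<open>\<psi>\<close> enters only through H(\<open>\<psi>\<close>); hence different
  \<open>\<psi>\<close> with equal H would give the same structure.\<close>

definition mnd_structure where
  "mnd_structure \<psi> = \<lparr>Under = QE, PsiJ = H \<psi>, PsiK = ad_param C S (EM P E) D T QE (H \<psi>)\<rparr>"

lemma mnd_structure_simps [simp]:
  "Under (mnd_structure \<psi>) = QE" "PsiJ (mnd_structure \<psi>) = H \<psi>"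
  "PsiK (mnd_structure \<psi>) = ad_param C S (EM P E) D T QE (H \<psi>)"
  by (simp_all add: mnd_structure_def)

lemma parametric_adjunction_QE: "parametric_adjunction C (EM P E) D QE"
  by (rule parametric_adjunction_reparam[OF Q.parametric_adjunction_axioms PE.cfunctor_EM_forget])

lemma two_variable_mnd_cell_left_hopf:
  "left_hopf \<psi> \<Longrightarrow> two_variable_mnd_cell C S P E D T (PJ Q) \<psi>"
  by (simp add: two_variable_mnd_cell_def mnd_cell_def left_hopf_mnd_def CS.monad_axioms PE.monad_axioms)

lemma parametric_mnd_cell_left_hopf:
  assumes "left_hopf \<psi>"
  shows "parametric_mnd_cell C S (EM P E) D T QE (H \<psi>)"
proof -
  interpret \<psi>: two_variable_mnd_cell C S P E D T "PJ Q" \<psi>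
    by (rule two_variable_mnd_cell_left_hopf) fact
  show ?thesis
    using parametric_adjunction_QE \<psi>.mnd_1cell_H_psi CS.monad_axioms assms[unfolded \<psi>.left_hopf_mnd_iff]
    by (simp add: parametric_mnd_cell_def mnd_cell_def parametric_mnd_cell_axioms_def)
qed

text \<open>For a left Hopf \<open>\<psi>\<close> the remaining clauses of the definition, namely
  the 1-cell laws of both functors and the adjoint objects, are consequences.\<close>

lemma hopf_param_adjunction_iff:
  "hopf_param_adjunction C S P E D T Q X \<longleftrightarrow> (\<exists>\<psi>. left_hopf \<psi> \<and> X = mnd_structure \<psi>)"
proof
  assume "hopf_param_adjunction C S P E D T Q X"
  then obtain \<psi> where "left_hopf \<psi>" "Under X = QE" "PsiJ X = H \<psi>"
    "PsiK X = ad_param C S (EM P E) D T QE (H \<psi>)"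
    unfolding hopf_param_adjunction_def by metis
  then show "\<exists>\<psi>. left_hopf \<psi> \<and> X = mnd_structure \<psi>"
    by (intro exI[of _ \<psi>]) (simp add: mnd_structure_def)
next
  assume "\<exists>\<psi>. left_hopf \<psi> \<and> X = mnd_structure \<psi>"
  then obtain \<psi> where hopf: "left_hopf \<psi>" and X: "X = mnd_structure \<psi>" by blast
  interpret R: parametric_mnd_cell C S "EM P E" D T QE "H \<psi>"
    by (rule parametric_mnd_cell_left_hopf) fact
  show "hopf_param_adjunction C S P E D T Q X"
    unfolding hopf_param_adjunction_def X mnd_structure_simps
    using hopf parametric_adjunction_QE R.cell R.mnd_1cell_\<kappa> R.mnd_adjoint_\<kappa> by blast
qed

lemma lifting_functor_lifting:
  assumes "hopf_lifting C S P E D T Q R"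
  shows "functor_lifting C S P E D T (PJ Q) (PJ R)"
  using assms
  by (auto simp: hopf_lifting_def functor_lifting_def functor_lifting_axioms_def CS.monad_axioms
      DT.monad_axioms PE.monad_axioms Q.J_fun parametric_adjunction.J_fun)

definition mnd_structure_of where
  "mnd_structure_of R = mnd_structure (functor_lifting.psi_lift C S P E D T (PJ Q) (PJ R))"

lemma left_hopf_psi_lift:
  assumes "hopf_lifting C S P E D T Q R"
  shows "left_hopf (functor_lifting.psi_lift C S P E D T (PJ Q) (PJ R))"
proof -
  interpret R: functor_lifting C S P E D T "PJ Q" "PJ R"
    by (rule lifting_functor_lifting) fact
  show ?thesis using assms by (simp add: hopf_lifting_def R.left_hopf_adj_iff)
qed

text \<open>The relation fixes both functors on objects, and their arrow parts follow because they
  lie over J and K. Units and counits then have equal endpoints and lie over the same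
  arrows.\<close>

lemma corresponds_determines:
  assumes R: "hopf_lifting C S P E D T Q R" and R': "hopf_lifting C S P E D T Q R'"
    and "corresponds C S P E D T Q R X" and "corresponds C S P E D T Q R' X"
  shows "R = R'"
proof -
  interpret R: parametric_adjunction "EM C S" "EM P E" "EM D T" R
    using R by (simp add: hopf_lifting_def)
  interpret R': parametric_adjunction "EM C S" "EM P E" "EM D T" R'
    using R' by (simp add: hopf_lifting_def)
  have JU: "comp_fun (prod_cat (EM C S) (EM P E)) (EM_forget D T) (PJ R) = JU"
    "comp_fun (prod_cat (EM C S) (EM P E)) (EM_forget D T) (PJ R') = JU"
    and KU: "comp_fun (prod_cat (op_cat (EM P E)) (EM D T)) (EM_forget C S) (PK R) = KU"
    "comp_fun (prod_cat (op_cat (EM P E)) (EM D T)) (EM_forget C S) (PK R') = KU"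
    using R R' by (simp_all add: hopf_lifting_def)
  have FOJ: "FO (PJ R) z = FO (PJ R') z" if "z \<in> EM_Obj C S \<times> EM_Obj P E" for z
    using assms(3,4) that unfolding corresponds_def by fastforce
  have FOK: "FO (PK R) z = FO (PK R') z" if "z \<in> EM_Obj P E \<times> EM_Obj D T" for z
    using assms(3,4) that unfolding corresponds_def by fastforce
  have J: "PJ R = PJ R'"
  proof (rule cfun_eqI[OF R.J_fun R'.J_fun])
    show "FA (PJ R) f = FA (PJ R') f" if f: "f \<in> Arr (prod_cat (EM C S) (EM P E))" for f
      using EM_lifting_determined(2)[OF R.J_fun JU(1) DT.monad_axioms f] FOJ
        EM_lifting_determined(2)[OF R'.J_fun JU(2) DT.monad_axioms f] R.J.A.Dom_Obj[OF f] R.J.A.Cod_Obj[OF f]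
      by simp
  qed (use FOJ in simp)
  have K: "PK R = PK R'"
  proof (rule cfun_eqI[OF R.K_fun R'.K_fun])
    show "FA (PK R) f = FA (PK R') f" if f: "f \<in> Arr (prod_cat (op_cat (EM P E)) (EM D T))" for f
      using EM_lifting_determined(2)[OF R.K_fun KU(1) CS.monad_axioms f] FOK
        EM_lifting_determined(2)[OF R'.K_fun KU(2) CS.monad_axioms f] R.K.A.Dom_Obj[OF f] R.K.A.Cod_Obj[OF f]
      by simp
  qed (use FOK in simp)
  have "PUnit R m x = PUnit R' m x" if "m \<in> EM_Obj P E" "x \<in> EM_Obj C S" for m x
    by (rule EM_arr_eqI[OF CS.monad_axioms])
      (use that R R' R.PUnit_Arr[of m x] R'.PUnit_Arr[of m x] R.Dom_PUnit[of m x] R'.Dom_PUnit[of m x]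
        R.Cod_PUnit[of m x] R'.Cod_PUnit[of m x] in \<open>simp_all add: J K hopf_lifting_def\<close>)
  \<comment> \<open>Agreement on algebras becomes equality of functions through extensionality,
    separately in each of the two arguments.\<close>
  moreover have "PUnit R m \<in> extensional (EM_Obj C S)" "PUnit R' m \<in> extensional (EM_Obj C S)" if "m \<in> EM_Obj P E" for m
    using adjunction.unit_ext[OF R.adj, of m] adjunction.unit_ext[OF R'.adj, of m] that by simp_all
  ultimately have "PUnit R m = PUnit R' m" if "m \<in> EM_Obj P E" for m
    using that by (intro extensionalityI[where A = "EM_Obj C S"]) auto
  then have Un: "PUnit R = PUnit R'"
    using R.PUnit_ext R'.PUnit_ext by (intro extensionalityI[where A = "EM_Obj P E"]) auto
  have "PCounit R m y = PCounit R' m y" if "m \<in> EM_Obj P E" "y \<in> EM_Obj D T" for m y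
    by (rule EM_arr_eqI[OF DT.monad_axioms])
      (use that R R' R.PCounit_Arr[of m y] R'.PCounit_Arr[of m y] R.Dom_PCounit[of m y] R'.Dom_PCounit[of m y]
        R.Cod_PCounit[of m y] R'.Cod_PCounit[of m y] in \<open>simp_all add: J K hopf_lifting_def\<close>)
  moreover have "PCounit R m \<in> extensional (EM_Obj D T)" "PCounit R' m \<in> extensional (EM_Obj D T)" if "m \<in> EM_Obj P E" for m
    using adjunction.counit_ext[OF R.adj, of m] adjunction.counit_ext[OF R'.adj, of m] that by simp_all
  ultimately have "PCounit R m = PCounit R' m" if "m \<in> EM_Obj P E" for m
    using that by (intro extensionalityI[where A = "EM_Obj D T"]) auto
  then have "PCounit R = PCounit R'"
    using R.PCounit_ext R'.PCounit_ext by (intro extensionalityI[where A = "EM_Obj P E"]) auto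
  with J K Un show ?thesis by simp
qed

end

section \<open>Construction of a lifting from a left Hopf 1-cell\<close>

locale left_hopf_parametric_adjunction = monadic_parametric_adjunction +
  fixes \<psi>
  assumes left_hopf: "left_hopf \<psi>"
begin

sublocale \<psi>: two_variable_mnd_cell C S P E D T "PJ Q" \<psi>
  by (rule two_variable_mnd_cell_left_hopf) (rule left_hopf)

sublocale H: parametric_mnd_cell C S "EM P E" D T QE "H \<psi>"
  by (rule parametric_mnd_cell_left_hopf) (rule left_hopf)

text \<open>H(\<open>\<psi>\<close>) is now handled as an opaque 1-cell over P^E with its own
  laws.\<close>

declare \<psi>.H_psi_simp [simp del]

text \<open>The structure map k is absorbed in H(\<open>\<psi>\<close>), so the second entry of J is
  an identity. This is the transported structure of \<open>alg_EM_Obj\<close> for an algebra paired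
  with an inert parameter.\<close>

definition actJ where "actJ = (\<lambda>((c, h), (m, k)). FA (PJ Q) (h, Ident P m) \<cdot>\<^bsub>D\<^esub> H \<psi> (c, (m, k)))"

definition actK where "actK = (\<lambda>((m, k), (d, l)). FA (PK Q) (Ident P m, l) \<cdot>\<^bsub>C\<^esub> H.\<kappa> ((m, k), d))"

lemma actJ_simp: "actJ ((c, h), (m, k)) = FA (PJ Q) (h, Ident P m) \<cdot>\<^bsub>D\<^esub> H \<psi> (c, (m, k))"
  by (simp add: actJ_def)

lemma actK_simp: "actK ((m, k), (d, l)) = FA (PK Q) (Ident P m, l) \<cdot>\<^bsub>C\<^esub> H.\<kappa> ((m, k), d)"
  by (simp add: actK_def)

lemma mnd_left_adjoint_QE:
  assumes "(m, k) \<in> EM_Obj P E"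
  shows "mnd_left_adjoint C S D T (adj_at C P D Q m) (trans_at C (H \<psi>) (m, k))"
  using H.mnd_left_adjoint_at[of "(m, k)"] assms
    adj_at_reparam[OF Q.parametric_adjunction_axioms PE.cfunctor_EM_forget, of "(m, k)"] by simp

lemma \<kappa>_QE:
  assumes "(m, k) \<in> EM_Obj P E" and "d \<in> Obj D"
  shows "H.\<kappa> ((m, k), d) = ad C S D T (adj_at C P D Q m) (trans_at C (H \<psi>) (m, k)) d"
  using assms H.\<kappa>_at[of "(m, k)" d]
    adj_at_reparam[OF Q.parametric_adjunction_axioms PE.cfunctor_EM_forget, of "(m, k)"] by simp

lemma actJ_Obj:
  assumes "(c, h) \<in> EM_Obj C S" "(m, k) \<in> EM_Obj P E"
  shows "(FO (PJ Q) (c, m), actJ ((c, h), (m, k))) \<in> EM_Obj D T"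
proof -
  have "c \<in> Obj C" "h \<in> Arr C" using assms by (simp_all add: EM_Obj_iff)
  then show ?thesis
    using H.alg_EM_Obj[OF EM_pair_Obj(1)[OF CS.monad_axioms PE.category_EM assms(1)], of "(m, k)"] assms
    by (simp add: actJ_simp)
qed

lemma actK_Obj:
  assumes "(m, k) \<in> EM_Obj P E" "(d, l) \<in> EM_Obj D T"
  shows "(FO (PK Q) (m, d), actK ((m, k), (d, l))) \<in> EM_Obj C S"
proof -
  interpret K: mnd_cell "prod_cat (op_cat (EM P E)) D"
    "prod_mnd (op_cat (EM P E)) D (id_mnd (op_cat (EM P E))) T" C S "PK QE" H.\<kappa>
    by unfold_locales (rule H.mnd_1cell_\<kappa>)
  have "d \<in> Obj D" "l \<in> Arr D" using assms by (simp_all add: EM_Obj_iff)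
  then show ?thesis
    using K.alg_EM_Obj[OF EM_pair_Obj(2)[OF DT.monad_axioms category_op_cat[OF PE.category_EM] assms(2)],
        of "(m, k)"] assms
    by (simp add: actK_simp)
qed

lemma actJ_Arr:
  assumes f: "((c, h), (c', h'), f) \<in> EM_Arr C S" and u: "((m, k), (n, l), u) \<in> EM_Arr P E"
  shows "((FO (PJ Q) (c, m), actJ ((c, h), (m, k))), (FO (PJ Q) (c', n), actJ ((c', h'), (n, l))),
    FA (PJ Q) (f, u)) \<in> EM_Arr D T"
proof -
  have "c \<in> Obj C" "h \<in> Arr C" "c' \<in> Obj C" "h' \<in> Arr C" "f \<in> Arr C"
    "(m, k) \<in> EM_Obj P E" "(n, l) \<in> EM_Obj P E"
    using assms by (simp_all add: EM_Arr_iff EM_Obj_iff)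
  then show ?thesis
    using H.alg_EM_Arr[OF EM_pair_Arr(1)[OF CS.monad_axioms PE.category_EM f, of "((m, k), (n, l), u)"]] u
    by (simp add: actJ_simp)
qed

lemma actK_Arr:
  assumes u: "((m, k), (n, l), u) \<in> EM_Arr P E" and g: "((d, j), (d', j'), g) \<in> EM_Arr D T"
  shows "((FO (PK Q) (n, d), actK ((n, l), (d, j))), (FO (PK Q) (m, d'), actK ((m, k), (d', j'))),
    FA (PK Q) (u, g)) \<in> EM_Arr C S"
proof -
  interpret K: mnd_cell "prod_cat (op_cat (EM P E)) D"
    "prod_mnd (op_cat (EM P E)) D (id_mnd (op_cat (EM P E))) T" C S "PK QE" H.\<kappa>
    by unfold_locales (rule H.mnd_1cell_\<kappa>)
  have "d \<in> Obj D" "j \<in> Arr D" "d' \<in> Obj D" "j' \<in> Arr D" "g \<in> Arr D"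
    "(m, k) \<in> EM_Obj P E" "(n, l) \<in> EM_Obj P E"
    using assms by (simp_all add: EM_Arr_iff EM_Obj_iff)
  then show ?thesis
    using K.alg_EM_Arr[OF EM_pair_Arr(2)[OF DT.monad_axioms category_op_cat[OF PE.category_EM] g,
        of "((m, k), (n, l), u)"]] u
    by (simp add: actK_simp)
qed

abbreviation liftJ where "liftJ \<equiv> EM_lift (prod_cat (EM C S) (EM P E)) JU actJ"

abbreviation liftK where "liftK \<equiv> EM_lift (prod_cat (op_cat (EM P E)) (EM D T)) KU actK"

lemma cfunctor_JU: "cfunctor (prod_cat (EM C S) (EM P E)) D JU"
  by (rule cfunctor_comp_fun[OF cfunctor_prod_fun[OF CS.cfunctor_EM_forget PE.cfunctor_EM_forget] Q.J_fun])

lemma cfunctor_KU: "cfunctor (prod_cat (op_cat (EM P E)) (EM D T)) C KU"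
  by (rule cfunctor_comp_fun[OF cfunctor_prod_fun[OF cfunctor_op_cat[OF PE.cfunctor_EM_forget]
    DT.cfunctor_EM_forget] Q.K_fun])

lemma liftJ_functor: "cfunctor (prod_cat (EM C S) (EM P E)) (EM D T) liftJ"
  and liftJ_lies_over: "comp_fun (prod_cat (EM C S) (EM P E)) (EM_forget D T) liftJ = JU"
proof -
  have "((FO JU (Dom (prod_cat (EM C S) (EM P E)) v), actJ (Dom (prod_cat (EM C S) (EM P E)) v)),
      (FO JU (Cod (prod_cat (EM C S) (EM P E)) v), actJ (Cod (prod_cat (EM C S) (EM P E)) v)), FA JU v) \<in> EM_Arr D T"
    if "v \<in> Arr (prod_cat (EM C S) (EM P E))" for v
  proof -
    obtain c h c' h' f m k n l u where v: "v = (((c, h), (c', h'), f), ((m, k), (n, l), u))"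
      by (metis prod.exhaust)
    show ?thesis using that actJ_Arr[of c h c' h' f m k n l u] by (auto simp: v EM_Arr_iff)
  qed
  moreover have "(FO JU z, actJ z) \<in> EM_Obj D T" if "z \<in> Obj (prod_cat (EM C S) (EM P E))" for z
    using that actJ_Obj by auto
  ultimately show "cfunctor (prod_cat (EM C S) (EM P E)) (EM D T) liftJ"
    and "comp_fun (prod_cat (EM C S) (EM P E)) (EM_forget D T) liftJ = JU"
    using EM_lift_functor[OF cfunctor_JU DT.monad_axioms] by blast+
qed

lemma liftK_functor: "cfunctor (prod_cat (op_cat (EM P E)) (EM D T)) (EM C S) liftK"
  and liftK_lies_over: "comp_fun (prod_cat (op_cat (EM P E)) (EM D T)) (EM_forget C S) liftK = KU"
proof -
  let ?A = "prod_cat (op_cat (EM P E)) (EM D T)"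
  have "((FO KU (Dom ?A v), actK (Dom ?A v)), (FO KU (Cod ?A v), actK (Cod ?A v)), FA KU v) \<in> EM_Arr C S"
    if "v \<in> Arr ?A" for v
  proof -
    obtain d j d' j' g m k n l u where v: "v = (((m, k), (n, l), u), ((d, j), (d', j'), g))"
      by (metis prod.exhaust)
    show ?thesis using that actK_Arr[of m k n l u d j d' j' g] by (auto simp: v EM_Arr_iff)
  qed
  moreover have "(FO KU z, actK z) \<in> EM_Obj C S" if "z \<in> Obj ?A" for z
    using that actK_Obj by auto
  ultimately show "cfunctor ?A (EM C S) liftK" and "comp_fun ?A (EM_forget C S) liftK = KU"
    using EM_lift_functor[OF cfunctor_KU CS.monad_axioms] by blast+
qed

text \<open>The third components are the unit and counit of Q, as lying over them demands; what
  remains to be shown is that they are homomorphisms.\<close>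

definition lift_adj where
  "lift_adj = \<lparr>PJ = liftJ, PK = liftK,
     PUnit = (\<lambda>y\<in>EM_Obj P E. \<lambda>x\<in>EM_Obj C S.
       (x, FO liftK (y, FO liftJ (x, y)), PUnit Q (fst y) (fst x))),
     PCounit = (\<lambda>y\<in>EM_Obj P E. \<lambda>z\<in>EM_Obj D T.
       (FO liftJ (FO liftK (y, z), y), z, PCounit Q (fst y) (fst z)))\<rparr>"

lemma lift_adj_simps [simp]: "PJ lift_adj = liftJ" "PK lift_adj = liftK"
  by (simp_all add: lift_adj_def)

lemma FA_liftJ: "(x, x', f) \<in> EM_Arr C S \<Longrightarrow> (y, y', u) \<in> EM_Arr P E \<Longrightarrow>
    FA liftJ ((x, x', f), (y, y', u)) = (FO liftJ (x, y), FO liftJ (x', y'), FA (PJ Q) (f, u))"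
  by (simp add: EM_Arr_iff)

lemma FA_liftK: "(y, y', u) \<in> EM_Arr P E \<Longrightarrow> (z, z', g) \<in> EM_Arr D T \<Longrightarrow>
    FA liftK ((y, y', u), (z, z', g)) = (FO liftK (y', z), FO liftK (y, z'), FA (PK Q) (u, g))"
  by (simp add: EM_Arr_iff)

lemma liftJ_mem: "x \<in> EM_Obj C S \<Longrightarrow> y \<in> EM_Obj P E \<Longrightarrow> FO liftJ (x, y) \<in> EM_Obj D T"
  and liftK_mem: "y \<in> EM_Obj P E \<Longrightarrow> z \<in> EM_Obj D T \<Longrightarrow> FO liftK (y, z) \<in> EM_Obj C S"
  using cfunctor.FO_Obj[OF liftJ_functor, of "(x, y)"] cfunctor.FO_Obj[OF liftK_functor, of "(y, z)"]
  by (simp_all del: EM_lift_simps)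

lemma PUnit_lift: "y \<in> EM_Obj P E \<Longrightarrow> x \<in> EM_Obj C S \<Longrightarrow>
    PUnit lift_adj y x = (x, FO liftK (y, FO liftJ (x, y)), PUnit Q (fst y) (fst x))"
  and PCounit_lift: "y \<in> EM_Obj P E \<Longrightarrow> z \<in> EM_Obj D T \<Longrightarrow>
    PCounit lift_adj y z = (FO liftJ (FO liftK (y, z), y), z, PCounit Q (fst y) (fst z))"
  by (simp_all add: lift_adj_def del: EM_lift_simps)

lemma PUnit_lift_Arr:
  assumes y: "y \<in> EM_Obj P E" and x: "x \<in> EM_Obj C S"
  shows "(x, FO liftK (y, FO liftJ (x, y)), PUnit Q (fst y) (fst x)) \<in> EM_Arr C S"
proof -
  obtain c h m k where xy: "x = (c, h)" "y = (m, k)" by (metis prod.exhaust)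
  interpret A: mnd_left_adjoint C S D T "adj_at C P D Q m" "trans_at C (H \<psi>) (m, k)"
    using mnd_left_adjoint_QE y xy by simp
  have "c \<in> Obj C" "h \<in> Arr C" "m \<in> Obj P" using x y xy by (simp_all add: EM_Obj_iff)
  moreover have "actJ ((c, h), (m, k)) \<in> Arr D"
    using actJ_Obj[of c h m k] x y xy by (simp add: EM_Obj_iff)
  ultimately show ?thesis
    using A.unit_EM_Arr[of c h] x y xy actJ_Obj[of c h m k]
    by (simp add: actJ_simp actK_simp \<kappa>_QE)
qed

lemma PCounit_lift_Arr:
  assumes y: "y \<in> EM_Obj P E" and z: "z \<in> EM_Obj D T"
  shows "(FO liftJ (FO liftK (y, z), y), z, PCounit Q (fst y) (fst z)) \<in> EM_Arr D T"
proof -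
  obtain d l m k where zy: "z = (d, l)" "y = (m, k)" by (metis prod.exhaust)
  interpret A: mnd_left_adjoint C S D T "adj_at C P D Q m" "trans_at C (H \<psi>) (m, k)"
    using mnd_left_adjoint_QE y zy by simp
  have "d \<in> Obj D" "l \<in> Arr D" "m \<in> Obj P" using z y zy by (simp_all add: EM_Obj_iff)
  moreover have "actK ((m, k), (d, l)) \<in> Arr C"
    using actK_Obj[of m k d l] z y zy by (simp add: EM_Obj_iff)
  ultimately show ?thesis
    using A.counit_EM_Arr[of d l] z y zy actK_Obj[of m k d l]
    by (simp add: actJ_simp actK_simp \<kappa>_QE)
qed

end

section \<open>The constructed data form a Hopf lifting\<close>

context left_hopf_parametric_adjunction
begin

lemma fst_liftJ: "x \<in> EM_Obj C S \<Longrightarrow> y \<in> EM_Obj P E \<Longrightarrow> fst (FO liftJ (x, y)) = FO (PJ Q) (fst x, fst y)"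
  and fst_liftK: "y \<in> EM_Obj P E \<Longrightarrow> z \<in> EM_Obj D T \<Longrightarrow> fst (FO liftK (y, z)) = FO (PK Q) (fst y, fst z)"
  by simp_all

lemma liftJ_Arr: "(x, x', f) \<in> EM_Arr C S \<Longrightarrow> (y, y', u) \<in> EM_Arr P E \<Longrightarrow>
    (FO liftJ (x, y), FO liftJ (x', y'), FA (PJ Q) (f, u)) \<in> EM_Arr D T"
  using cfunctor.FA_Arr[OF liftJ_functor, of "((x, x', f), (y, y', u))"]
  by (simp add: FA_liftJ del: EM_lift_simps)

lemma liftK_Arr: "(y, y', u) \<in> EM_Arr P E \<Longrightarrow> (z, z', g) \<in> EM_Arr D T \<Longrightarrow>
    (FO liftK (y', z), FO liftK (y, z'), FA (PK Q) (u, g)) \<in> EM_Arr C S"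
  using cfunctor.FA_Arr[OF liftK_functor, of "((y, y', u), (z, z', g))"]
  by (simp add: FA_liftK del: EM_lift_simps)

lemma Ident_liftK_Arr: "y \<in> EM_Obj P E \<Longrightarrow> z \<in> EM_Obj D T \<Longrightarrow>
    (FO liftK (y, z), FO liftK (y, z), Ident C (FO (PK Q) (fst y, fst z))) \<in> EM_Arr C S"
  using EM_Ident_fst_Arr[OF CS.monad_axioms liftK_mem[of y z]] by (simp del: EM_lift_simps add: fst_liftK)

text \<open>With these rules the values of \<open>liftJ\<close> and \<open>liftK\<close> stay
  folded: the structure maps only serve as endpoints, and all equations reduce to underlying
  arrows.\<close>

lemmas lift_rules = FA_liftJ FA_liftK liftJ_Arr liftK_Arr liftJ_mem liftK_mem fst_liftJ fst_liftK
  PUnit_lift PCounit_lift PUnit_lift_Arr PCounit_lift_Arr Ident_liftK_Arr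
  EM_Obj_fst[of _ C S] EM_Obj_fst[of _ P E] EM_Obj_fst[of _ D T]
  EM_Ident_fst_Arr[OF CS.monad_axioms] EM_Ident_fst_Arr[OF PE.monad_axioms] EM_Ident_fst_Arr[OF DT.monad_axioms]

text \<open>Once the units and counits are known to be homomorphisms, naturality and the triangles
  are equations between triples, and their third components are the same equations for Q at
  \<open>fst y\<close>.\<close>

lemma adjunction_lift:
  assumes y: "y \<in> EM_Obj P E"
  shows "adjunction (EM C S) (EM D T) (adj_at (EM C S) (EM P E) (EM D T) lift_adj y)"
proof -
  interpret A: adjunction C D "adj_at C P D Q (fst y)"
    using y by (intro Q.adj) (simp add: EM_Obj_fst)
  note [simp] = y lift_rules
  note [simp del] = EM_lift_simps
  have objs: "x \<in> EM_Obj C S" "x' \<in> EM_Obj C S" "f \<in> Arr C" "Dom C f = fst x" "Cod C f = fst x'"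
    if "(x, x', f) \<in> EM_Arr C S" for x x' f
    using that by (simp_all add: EM_Arr_iff)
  have objs': "z \<in> EM_Obj D T" "z' \<in> EM_Obj D T" "g \<in> Arr D" "Dom D g = fst z" "Cod D g = fst z'"
    if "(z, z', g) \<in> EM_Arr D T" for z z' g
    using that by (simp_all add: EM_Arr_iff)
  show ?thesis
  proof (rule adjunctionI)
    show "cfunctor (EM C S) (EM D T) (LeftF (adj_at (EM C S) (EM P E) (EM D T) lift_adj y))"
      by (simp add: cfunctor_J_at liftJ_functor CS.category_EM PE.category_EM)
    show "cfunctor (EM D T) (EM C S) (RightF (adj_at (EM C S) (EM P E) (EM D T) lift_adj y))"
      by (simp add: cfunctor_K_at liftK_functor DT.category_EM PE.category_EM)
  next
    fix v assume "v \<in> Arr (EM C S)"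
    then obtain x x' f where v: "v = (x, x', f)" and f: "(x, x', f) \<in> EM_Arr C S" by (cases v) auto
    show "Unit (adj_at (EM C S) (EM P E) (EM D T) lift_adj y) (Cod (EM C S) v) \<cdot>\<^bsub>EM C S\<^esub> v =
        FA (RightF (adj_at (EM C S) (EM P E) (EM D T) lift_adj y))
          (FA (LeftF (adj_at (EM C S) (EM P E) (EM D T) lift_adj y)) v) \<cdot>\<^bsub>EM C S\<^esub>
        Unit (adj_at (EM C S) (EM P E) (EM D T) lift_adj y) (Dom (EM C S) v)"
      using A.unit_nat[of f "fst x'"] f objs[OF f] by (simp add: v)
  next
    fix v assume "v \<in> Arr (EM D T)"
    then obtain z z' g where v: "v = (z, z', g)" and g: "(z, z', g) \<in> EM_Arr D T" by (cases v) auto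
    show "Counit (adj_at (EM C S) (EM P E) (EM D T) lift_adj y) (Cod (EM D T) v) \<cdot>\<^bsub>EM D T\<^esub>
        FA (LeftF (adj_at (EM C S) (EM P E) (EM D T) lift_adj y))
          (FA (RightF (adj_at (EM C S) (EM P E) (EM D T) lift_adj y)) v) =
        v \<cdot>\<^bsub>EM D T\<^esub> Counit (adj_at (EM C S) (EM P E) (EM D T) lift_adj y) (Dom (EM D T) v)"
      using A.counit_nat[of g "fst z'"] g objs'[OF g] by (simp add: v)
  next
    fix x assume "x \<in> Obj (EM C S)"
    then show "Counit (adj_at (EM C S) (EM P E) (EM D T) lift_adj y)
          (FO (LeftF (adj_at (EM C S) (EM P E) (EM D T) lift_adj y)) x) \<cdot>\<^bsub>EM D T\<^esub>
        FA (LeftF (adj_at (EM C S) (EM P E) (EM D T) lift_adj y))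
          (Unit (adj_at (EM C S) (EM P E) (EM D T) lift_adj y) x) =
        Ident (EM D T) (FO (LeftF (adj_at (EM C S) (EM P E) (EM D T) lift_adj y)) x)"
      using A.triangle_left[of "fst x"] by simp
  next
    fix z assume "z \<in> Obj (EM D T)"
    then show "FA (RightF (adj_at (EM C S) (EM P E) (EM D T) lift_adj y))
          (Counit (adj_at (EM C S) (EM P E) (EM D T) lift_adj y) z) \<cdot>\<^bsub>EM C S\<^esub>
        Unit (adj_at (EM C S) (EM P E) (EM D T) lift_adj y)
          (FO (RightF (adj_at (EM C S) (EM P E) (EM D T) lift_adj y)) z) =
        Ident (EM C S) (FO (RightF (adj_at (EM C S) (EM P E) (EM D T) lift_adj y)) z)"
      using A.triangle_right[of "fst z"] by simp
  qed (simp_all add: lift_adj_def)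
qed

lemma parametric_adjunction_lift: "parametric_adjunction (EM C S) (EM P E) (EM D T) lift_adj"
proof (rule parametric_adjunction.intro)
  fix v y y' z assume v: "v \<in> hom (EM P E) y y'" and z: "z \<in> Obj (EM D T)"
  then obtain u where [simp]: "v = (y, y', u)" and u: "(y, y', u) \<in> EM_Arr P E"
    by (cases v) auto
  then have yy': "y \<in> EM_Obj P E" "y' \<in> EM_Obj P E" "u \<in> Arr P" "Dom P u = fst y" "Cod P u = fst y'"
    by (simp_all add: EM_Arr_iff)
  note [simp] = lift_rules
  note [simp del] = EM_lift_simps
  show "FA (PK lift_adj) (v, Ident (EM D T) z) =
        FA (K_at (EM P E) (EM D T) (PK lift_adj) y) (PCounit lift_adj y' z)
        \<cdot>\<^bsub>EM C S\<^esub> FA (K_at (EM P E) (EM D T) (PK lift_adj) y)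
          (FA (PJ lift_adj) (Ident (EM C S) (FO (PK lift_adj) (y', z)), v))
        \<cdot>\<^bsub>EM C S\<^esub> PUnit lift_adj y (FO (PK lift_adj) (y', z))"
    using Q.conjugate[of u "fst y" "fst y'" "fst z"] u yy' z by simp
qed (simp_all add: PE.category_EM liftJ_functor liftK_functor adjunction_lift, simp_all add: lift_adj_def)

lemma functor_lifting_liftJ: "functor_lifting C S P E D T (PJ Q) liftJ"
  using liftJ_functor liftJ_lies_over
  by (simp add: functor_lifting_def functor_lifting_axioms_def CS.monad_axioms
      DT.monad_axioms PE.monad_axioms Q.J_fun)

text \<open>Naturality of \<open>\<psi>\<close> at (eta,eta) moves the units past it, where they
  cancel against J(mu,mu). Lifting and then extracting a 1-cell is thus the identity, which gives
  surjectivity.\<close>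

lemma psi_lift_liftJ: "functor_lifting.psi_lift C S P E D T (PJ Q) liftJ = \<psi>"
proof (rule extensionalityI[where A = "Obj C \<times> Obj P"])
  interpret L: functor_lifting C S P E D T "PJ Q" liftJ by (rule functor_lifting_liftJ)
  show "L.psi_lift \<in> extensional (Obj C \<times> Obj P)" by (simp add: L.psi_lift_def)
  show "\<psi> \<in> extensional (Obj C \<times> Obj P)" using \<psi>.psi_ext by simp
  fix z assume "z \<in> Obj C \<times> Obj P"
  then obtain c m where z: "z = (c, m)" and [simp]: "c \<in> Obj C" "m \<in> Obj P" by auto
  let ?Sc = "FO (MF S) c" and ?Em = "FO (MF E) m"
  have "L.free_action c m = FA (PJ Q) (Mult S c, Mult E m) \<cdot>\<^bsub>D\<^esub> \<psi> (?Sc, ?Em)"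
    by (simp add: L.action_def actJ_simp \<psi>.H_psi_simp Q.J.merge)
  then have "L.psi_lift z = FA (PJ Q) (Mult S c, Mult E m) \<cdot>\<^bsub>D\<^esub>
      (\<psi> (?Sc, ?Em) \<cdot>\<^bsub>D\<^esub> FA (MF T) (FA (PJ Q) (Eta S c, Eta E m)))"
    by (simp add: z)
  also have "\<dots> = FA (PJ Q) (Mult S c, Mult E m) \<cdot>\<^bsub>D\<^esub>
      (FA (PJ Q) (FA (MF S) (Eta S c), FA (MF E) (Eta E m)) \<cdot>\<^bsub>D\<^esub> \<psi> (c, m))"
    using \<psi>.psi_nat[of "(Eta S c, Eta E m)" "(?Sc, ?Em)"] by simp
  finally show "L.psi_lift z = \<psi> z"
    by (simp add: z Q.J.merge CS.eta_right PE.eta_right)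
qed

text \<open>The Hopf clause is transferred by \<open>left_hopf_adj_iff\<close>, which concerns the
  1-cell extracted from \<open>liftJ\<close>; that 1-cell is \<open>\<psi>\<close>.\<close>

lemma hopf_lifting_lift: "hopf_lifting C S P E D T Q lift_adj"
proof -
  interpret L: functor_lifting C S P E D T "PJ Q" liftJ by (rule functor_lifting_liftJ)
  show ?thesis
    unfolding hopf_lifting_def
    using parametric_adjunction_lift liftJ_lies_over liftK_lies_over L.left_hopf_adj_iff left_hopf
    by (simp add: psi_lift_liftJ PUnit_lift PCounit_lift PUnit_lift_Arr PCounit_lift_Arr del: EM_lift_simps)
qed

lemma mnd_structure_of_lift: "mnd_structure_of lift_adj = mnd_structure \<psi>"
  by (simp add: mnd_structure_of_def psi_lift_liftJ)

end

section \<open>The bijection\<close>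

context monadic_parametric_adjunction
begin

text \<open>For J this is \<open>action_eq\<close>, with k moved into H. For K no formula is at
  hand, and the structure is identified by \<open>right_action_unique\<close> from the counit of
  R.\<close>

lemma corresponds_mnd_structure_of:
  assumes "hopf_lifting C S P E D T Q R"
  shows "corresponds C S P E D T Q R (mnd_structure_of R)"
proof -
  interpret R: functor_lifting C S P E D T "PJ Q" "PJ R"
    by (rule lifting_functor_lifting) fact
  interpret A: parametric_adjunction "EM C S" "EM P E" "EM D T" R
    using assms by (simp add: hopf_lifting_def)
  interpret L: left_hopf_parametric_adjunction C S D T P E Q R.psi_lift
    by unfold_locales (rule left_hopf_psi_lift[OF assms])
  have J: "FO (PJ R) ((c, h), (m, k)) = (FO (PJ Q) (c, m), FA (PJ Q) (h, Ident P m) \<cdot>\<^bsub>D\<^esub> H R.psi_lift (c, (m, k)))"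
    if "(c, h) \<in> EM_Obj C S" "(m, k) \<in> EM_Obj P E" for c h m k
  proof -
    have "c \<in> Obj C" "h \<in> Arr C" "Dom C h = FO (MF S) c" "Cod C h = c"
      "m \<in> Obj P" "k \<in> Arr P" "Dom P k = FO (MF E) m" "Cod P k = m"
      using that by (simp_all add: EM_Obj_iff)
    then show ?thesis
      using that by (simp add: R.FO_V R.action_eq R.cell.H_psi_simp Q.J.merge del: R.psi_lift_simp)
  qed
  have K: "FO (PK R) ((m, k), (d, l)) = (FO (PK Q) (m, d), FA (PK Q) (Ident P m, l) \<cdot>\<^bsub>C\<^esub> L.H.\<kappa> ((m, k), d))"
    if mk: "(m, k) \<in> EM_Obj P E" and dl: "(d, l) \<in> EM_Obj D T" for m k d l
  proof -
    interpret M: mnd_left_adjoint C S D T "adj_at C P D Q m" "trans_at C (H R.psi_lift) (m, k)"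
      by (rule L.mnd_left_adjoint_QE) fact
    have [simp]: "d \<in> Obj D" "l \<in> Arr D" "m \<in> Obj P" using mk dl by (simp_all add: EM_Obj_iff)
    have "fst (FO (PK R) ((m, k), (d, l))) = FO KU ((m, k), (d, l))"
      using assms mk dl
      by (intro EM_lifting_determined(1)[OF A.K_fun _ CS.monad_axioms]) (simp_all add: hopf_lifting_def)
    then obtain b where b: "FO (PK R) ((m, k), (d, l)) = (FO (PK Q) (m, d), b)"
      using mk dl by (cases "FO (PK R) ((m, k), (d, l))") auto
    have b_Obj: "(FO (PK Q) (m, d), b) \<in> EM_Obj C S"
      using A.K.FO_Obj[of "((m, k), (d, l))"] mk dl by (simp add: b)
    then have [simp]: "b \<in> Arr C" "Dom C b = FO (MF S) (FO (PK Q) (m, d))" "Cod C b = FO (PK Q) (m, d)"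
      by (simp_all add: EM_Obj_iff)
    have "FA (EM_forget D T) (PCounit R (m, k) (d, l)) = PCounit Q m d"
      using assms mk dl by (simp add: hopf_lifting_def)
    moreover obtain x y g where xyg: "PCounit R (m, k) (d, l) = (x, y, g)"
      by (cases "PCounit R (m, k) (d, l)") auto
    \<comment> \<open>The counit of R is a homomorphism over that of Q, and its source carries the
      structure that the J part computes from the unknown b.\<close>
    ultimately have "((FO (PJ Q) (FO (PK Q) (m, d), m), FA (PJ Q) (b, Ident P m) \<cdot>\<^bsub>D\<^esub>
        H R.psi_lift (FO (PK Q) (m, d), (m, k))), (d, l), PCounit Q m d) \<in> EM_Arr D T"
      using A.PCounit_Arr[of "(m, k)" "(d, l)"] A.Dom_PCounit[of "(m, k)" "(d, l)"]
        A.Cod_PCounit[of "(m, k)" "(d, l)"] mk dl J[OF b_Obj mk] by (simp add: b)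
    then have "b = FA (PK Q) (Ident P m, l) \<cdot>\<^bsub>C\<^esub> M.ad_psi d"
      using M.right_action_unique[of b d l] by simp
    then show ?thesis by (simp add: b L.\<kappa>_QE[OF mk])
  qed
  show ?thesis
    using J K by (auto simp: corresponds_def mnd_structure_of_def)
qed

text \<open>Injectivity: liftings with equal images correspond to one common structure, which
  determines them. Surjectivity: the lifting constructed from any witness \<open>\<psi>\<close> of X
  is sent back to X.\<close>

lemma bij_betw_mnd_structure_of:
  "bij_betw mnd_structure_of {R. hopf_lifting C S P E D T Q R} {X. hopf_param_adjunction C S P E D T Q X}"
proof (rule bij_betwI')
  fix R R' assume "R \<in> {R. hopf_lifting C S P E D T Q R}" "R' \<in> {R. hopf_lifting C S P E D T Q R}"
  then show "mnd_structure_of R = mnd_structure_of R' \<longleftrightarrow> R = R'"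
    using corresponds_determines corresponds_mnd_structure_of by (metis mem_Collect_eq)
next
  fix R assume "R \<in> {R. hopf_lifting C S P E D T Q R}"
  then show "mnd_structure_of R \<in> {X. hopf_param_adjunction C S P E D T Q X}"
    using left_hopf_psi_lift by (auto simp: hopf_param_adjunction_iff mnd_structure_of_def)
next
  fix X assume "X \<in> {X. hopf_param_adjunction C S P E D T Q X}"
  then obtain \<psi> where hopf: "left_hopf \<psi>" and X: "X = mnd_structure \<psi>"
    by (auto simp: hopf_param_adjunction_iff)
  interpret L: left_hopf_parametric_adjunction C S D T P E Q \<psi>
    by unfold_locales fact
  show "\<exists>R\<in>{R. hopf_lifting C S P E D T Q R}. X = mnd_structure_of R"
    using L.hopf_lifting_lift L.mnd_structure_of_lift X by auto
qed

end

theorem theorem6p2p1: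
  fixes C :: "('c, 'ca) category" and S :: "('c, 'ca) mnd"
    and D :: "('d, 'da) category" and T :: "('d, 'da) mnd"
    and P :: "('p, 'pa) category" and E :: "('p, 'pa) mnd"
    and Q :: "('c, 'ca, 'p, 'pa, 'd, 'da) param_adj"
  assumes "monad C S" and "monad D T" and "monad P E"
    and "parametric_adjunction C P D Q"
  shows "\<exists>\<Phi>. bij_betw \<Phi> {R. hopf_lifting C S P E D T Q R}
                        {X. hopf_param_adjunction C S P E D T Q X} \<and>
           (\<forall>R. hopf_lifting C S P E D T Q R \<longrightarrow> corresponds C S P E D T Q R (\<Phi> R))"
proof -
  interpret monadic_parametric_adjunction C S D T P E Q
    using assms by (simp add: monadic_parametric_adjunction_def)
  show ?thesis
    using bij_betw_mnd_structure_of corresponds_mnd_structure_of by blast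
qed

end
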